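(* Let $\mathbb F$ be a field of characteristic zero. Every $2$-generated primitive axial algebra of Monster type $(\tfrac14,\tfrac1{32})$ over $\mathbb F$ is a Norton-Sakuma algebra, i.e. is isomorphic to one of the nine algebras of types $1A,2A,2B,3A,3C,4A,4B,5A,6A$ over $\mathbb F$.
   Context: Put $\alpha=\tfrac14$, $\beta=\tfrac1{32}$. For a commutative, not necessarily associative $\mathbb F$-algebra $V$, $a\in V$ and $\lambda\in\mathbb F$, let $V_\lambda^a=\{v\in V : va=\lambda v\}$. The Monster fusion law $\mathcal M(\alpha,\beta)$ is the symmetric map $\star$ from $\{1,0,\alpha,\beta\}^2$ to the set of subsets of $\{1,0,\alpha,\beta\}$ given by $1\star1=\{1\}$, $1\star0=\emptyset$, $1\star\alpha=\{\alpha\}$, $1\star\beta=\{\beta\}$, $0\star0=\{0\}$, $0\star\alpha=\{\alpha\}$, $0\star\beta=\{\beta\}$, $\alpha\star\alpha=\{1,0\}$, $\alpha\star\beta=\{\beta\}$, $\beta\star\beta=\{1,0,\alpha\}$. A primitive axis of Monster type $(\alpha,\beta)$ in $V$ is a nonzero idempotent $a$ such that $V=V_1^a\oplus V_0^a\oplus V_\alpha^a\oplus V_\beta^a$, $V_\lambda^aV_\mu^a\subseteq\sum_{\nu\in\lambda\star\mu}V_\nu^a$ for all $\lambda,\mu$, and $V_1^a=\mathbb Fa$. A $2$-generated primitive axial algebra of Monster type $(\alpha,\beta)$ over $\mathbb F$ is a commutative non-associative $\mathbb F$-algebra generated, as an algebra, by two (not necessarily distinct) such axes. (No invariant bilinear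 form is assumed.) The Norton-Sakuma algebras over $\mathbb F$ are the following commutative algebras, given by a basis; all elements denoted by $a$ with some index are idempotent. In types $3A,3C,4A,4B,5A,6A$ the indices of the $a_i$ are read modulo $3,3,4,4,5,6$ respectively, and the displayed products hold also after applying to all indices any shift $i\mapsto i+r$ and the reflection $i\mapsto -i$, the elements $u_\rho,v_\rho,w_\rho,a_{\rho^2},a_{\rho^3},u_{\rho^2}$ being fixed. - $1A$: basis $a_0$ (the algebra $\mathbb F$). - $2A$: basis $a_0,a_1,a_\rho$; the product of any two distinct basis elements $b,b'$ is $\tfrac18(b+b'-b'')$, with $b''$ the third one. - $2B$: basis $a_0,a_1$; $a_0a_1=0$. - $3A$: basis $a_{-1},a_0,a_1,u_\rho$; $a_0a_1=\tfrac1{2^5}(2a_0+2a_1+a_{-1})-\tfrac{3^3\cdot5}{2^{11}}u_\rho$, $a_0u_\rho=\tfrac1{3^2}(2a_0-a_1-a_{-1})+\tfrac5{2^5}u_\rho$, $u_\rho u_\rho=u_\rho$. - $3C$: basis $a_{-1},a_0,a_1$; $a_0a_1=\tfrac1{2^6}(a_0+a_1-a_{-1})$. - $4A$: basis $a_{-1},a_0,a_1,a_2,v_\rho$; $a_0a_1=\tfrac1{2^6}(3a_0+3a_1+a_2+a_{-1}-3v_\rho)$, $a_0a_2=0$, $a_0v_\rho=\tfrac1{2^4}(5a_0-2a_1-a_2-2a_{-1}+3v_\rho)$, $v_\rho v_\rho=v_\rho$. - $4B$: basis $a_{-1},a_0,a_1,a_2,a_{\rho^2}$; $a_0a_1=\tfrac1{2^6}(a_0+a_1-a_{-1}-a_2+a_{\rho^2})$,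 $a_0a_2=\tfrac1{2^3}(a_0+a_2-a_{\rho^2})$, $a_0a_{\rho^2}=\tfrac1{2^3}(a_0+a_{\rho^2}-a_2)$. - $5A$: basis $a_{-2},a_{-1},a_0,a_1,a_2,w_\rho$; $a_0a_1=\tfrac1{2^7}(3a_0+3a_1-a_2-a_{-1}-a_{-2})+w_\rho$, $a_0a_2=\tfrac1{2^7}(3a_0+3a_2-a_1-a_{-1}-a_{-2})-w_\rho$, $a_0w_\rho=\tfrac7{2^{12}}(a_1+a_{-1}-a_2-a_{-2})+\tfrac7{2^5}w_\rho$, $w_\rho w_\rho=\tfrac{5^2\cdot7}{2^{19}}(a_{-2}+a_{-1}+a_0+a_1+a_2)$. - $6A$: basis $a_{-2},a_{-1},a_0,a_1,a_2,a_3,a_{\rho^3},u_{\rho^2}$; $a_0a_1=\tfrac1{2^6}(a_0+a_1-a_{-2}-a_{-1}-a_2-a_3+a_{\rho^3})+\tfrac{3^2\cdot5}{2^{11}}u_{\rho^2}$, $a_0a_2=\tfrac1{2^5}(2a_0+2a_2+a_{-2})-\tfrac{3^3\cdot5}{2^{11}}u_{\rho^2}$, $a_0a_3=\tfrac1{2^3}(a_0+a_3-a_{\rho^3})$, $a_0a_{\rho^3}=\tfrac1{2^3}(a_0+a_{\rho^3}-a_3)$, $a_0u_{\rho^2}=\tfrac1{3^2}(2a_0-a_2-a_{-2})+\tfrac5{2^5}u_{\rho^2}$, $a_{\rho^3}u_{\rho^2}=0$, $u_{\rho^2}u_{\rho^2}=u_{\rho^2}$. *)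

theory Defs
  imports Complex_Main
begin

section \<open>Commutative non-associative algebras and axes of Monster type\<close>

definition monster_law :: "'f::field \<Rightarrow> 'f \<Rightarrow> 'f \<Rightarrow> 'f \<Rightarrow> 'f set" where
  "monster_law \<alpha> \<beta> x y =
    (if {x, y} = {1} then {1}
     else if {x, y} = {1, 0} then {}
     else if {x, y} = {1, \<alpha>} then {\<alpha>}
     else if {x, y} = {1, \<beta>} then {\<beta>}
     else if {x, y} = {0} then {0}
     else if {x, y} = {0, \<alpha>} then {\<alpha>}
     else if {x, y} = {0, \<beta>} then {\<beta>}
     else if {x, y} = {\<alpha>} then {1, 0}
     else if {x, y} = {\<alpha>, \<beta>} then {\<beta>}
     else if {x, y} = {\<beta>} then {1, 0, \<alpha>}
     else {})"

locale comm_algebra = vector_space scale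
  for scale :: "'f::field \<Rightarrow> 'v::ab_group_add \<Rightarrow> 'v" (infixr \<open>*s\<close> 75) +
  fixes mult :: "'v \<Rightarrow> 'v \<Rightarrow> 'v" (infixl \<open>\<cdot>\<close> 70)
  assumes mult_commute: "u \<cdot> v = v \<cdot> u"
    and mult_add_left: "(u + v) \<cdot> w = u \<cdot> w + v \<cdot> w"
    and mult_scale_left: "(c *s u) \<cdot> v = c *s (u \<cdot> v)"
begin

definition eigenspace :: "'v \<Rightarrow> 'f \<Rightarrow> 'v set" where
  "eigenspace a l = {v. v \<cdot> a = l *s v}"

text \<open>The sum of the eigenspaces for the values in a finite set \<open>S\<close>; it is \<open>{0}\<close> for \<open>S = {}\<close>.\<close>

definition eigenspace_sum :: "'v \<Rightarrow> 'f set \<Rightarrow> 'v set" where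
  "eigenspace_sum a S = {\<Sum>l\<in>S. f l | f. \<forall>l\<in>S. f l \<in> eigenspace a l}"

definition eigenspaces_independent :: "'v \<Rightarrow> 'f set \<Rightarrow> bool" where
  "eigenspaces_independent a S \<longleftrightarrow>
    (\<forall>f. (\<forall>l\<in>S. f l \<in> eigenspace a l) \<and> (\<Sum>l\<in>S. f l) = 0 \<longrightarrow> (\<forall>l\<in>S. f l = 0))"

definition primitive_axis :: "'f \<Rightarrow> 'f \<Rightarrow> 'v \<Rightarrow> bool" where
  "primitive_axis \<alpha> \<beta> a \<longleftrightarrow>
     a \<noteq> 0 \<and> a \<cdot> a = a \<and>
     eigenspace_sum a {1, 0, \<alpha>, \<beta>} = UNIV \<and> eigenspaces_independent a {1, 0, \<alpha>, \<beta>} \<and>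
     (\<forall>l\<in>{1, 0, \<alpha>, \<beta>}. \<forall>m\<in>{1, 0, \<alpha>, \<beta>}. \<forall>u\<in>eigenspace a l. \<forall>v\<in>eigenspace a m.
        u \<cdot> v \<in> eigenspace_sum a (monster_law \<alpha> \<beta> l m)) \<and>
     eigenspace a 1 = range (\<lambda>c. c *s a)"

definition subalgebra :: "'v set \<Rightarrow> bool" where
  "subalgebra S \<longleftrightarrow> subspace S \<and> (\<forall>u\<in>S. \<forall>v\<in>S. u \<cdot> v \<in> S)"

definition two_generated_primitive_axial :: "'f \<Rightarrow> 'f \<Rightarrow> bool" where
  "two_generated_primitive_axial \<alpha> \<beta> \<longleftrightarrow>
     (\<exists>a b. primitive_axis \<alpha> \<beta> a \<and> primitive_axis \<alpha> \<beta> b \<and> subalgebra hull {a, b} = UNIV)"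

end


section \<open>The Norton-Sakuma algebras\<close>

datatype ns_type = NS1A | NS2A | NS2B | NS3A | NS3C | NS4A | NS4B | NS5A | NS6A

datatype ns_aux = A_rho | A_rho2 | A_rho3 | U_rho | U_rho2 | V_rho | W_rho

datatype ns_elt = Ax int | Aux ns_aux

text \<open>\<open>Ax i\<close> stands for \<open>a\<^sub>i\<close>, the index being represented by its residue in \<open>{0..<n}\<close>, where
  \<open>n\<close> is the number of the \<open>a\<^sub>i\<close> in the basis. For types 2A and 2B, which have the basis elements
  \<open>a\<^sub>0\<close> and \<open>a\<^sub>1\<close> only, reading indices modulo 2 swaps these two under a shift.\<close>

fun ns_period :: "ns_type \<Rightarrow> int" where
  "ns_period NS1A = 1"
| "ns_period NS2A = 2"
| "ns_period NS2B = 2"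
| "ns_period NS3A = 3"
| "ns_period NS3C = 3"
| "ns_period NS4A = 4"
| "ns_period NS4B = 4"
| "ns_period NS5A = 5"
| "ns_period NS6A = 6"

fun ns_auxs :: "ns_type \<Rightarrow> ns_aux set" where
  "ns_auxs NS1A = {}"
| "ns_auxs NS2A = {A_rho}"
| "ns_auxs NS2B = {}"
| "ns_auxs NS3A = {U_rho}"
| "ns_auxs NS3C = {}"
| "ns_auxs NS4A = {V_rho}"
| "ns_auxs NS4B = {A_rho2}"
| "ns_auxs NS5A = {W_rho}"
| "ns_auxs NS6A = {A_rho3, U_rho2}"

definition ns_basis :: "ns_type \<Rightarrow> ns_elt set" where
  "ns_basis T = Ax ` {0..<ns_period T} \<union> Aux ` ns_auxs T"

text \<open>The next three functions give one coordinate of the products \<open>a\<^sub>0 a\<^sub>k\<close> with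
  \<open>0 \<le> 2k \<le> n\<close>, of \<open>a\<^sub>0 x\<close>, and of \<open>x y\<close>, where \<open>x\<close> and \<open>y\<close> are basis elements
  other than the \<open>a\<^sub>i\<close>. The arguments \<open>a\<close> and \<open>e\<close> stand for that coordinate of
  the \<open>a\<^sub>i\<close> and of the other basis elements.\<close>

definition ns_axis_axis ::
  "ns_type \<Rightarrow> int \<Rightarrow> (int \<Rightarrow> 'f) \<Rightarrow> (ns_aux \<Rightarrow> 'f) \<Rightarrow> 'f::field" where
  "ns_axis_axis T k a e =
    (if k = 0 then a 0 else
     case T of
       NS1A \<Rightarrow> 0
     | NS2A \<Rightarrow> 1/8 * (a 0 + a 1 - e A_rho)
     | NS2B \<Rightarrow> 0
     | NS3A \<Rightarrow> 1/2^5 * (2 * a 0 + 2 * a 1 + a (-1)) - (3^3 * 5)/2^11 * e U_rho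
     | NS3C \<Rightarrow> 1/2^6 * (a 0 + a 1 - a (-1))
     | NS4A \<Rightarrow>
         if k = 1 then 1/2^6 * (3 * a 0 + 3 * a 1 + a 2 + a (-1) - 3 * e V_rho)
         else 0
     | NS4B \<Rightarrow>
         if k = 1 then 1/2^6 * (a 0 + a 1 - a (-1) - a 2 + e A_rho2)
         else 1/2^3 * (a 0 + a 2 - e A_rho2)
     | NS5A \<Rightarrow>
         if k = 1 then 1/2^7 * (3 * a 0 + 3 * a 1 - a 2 - a (-1) - a (-2)) + e W_rho
         else 1/2^7 * (3 * a 0 + 3 * a 2 - a 1 - a (-1) - a (-2)) - e W_rho
     | NS6A \<Rightarrow>
         if k = 1 then 1/2^6 * (a 0 + a 1 - a (-2) - a (-1) - a 2 - a 3 + e A_rho3)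
           + (3^2 * 5)/2^11 * e U_rho2
         else if k = 2 then 1/2^5 * (2 * a 0 + 2 * a 2 + a (-2)) - (3^3 * 5)/2^11 * e U_rho2
         else 1/2^3 * (a 0 + a 3 - e A_rho3))"

fun ns_axis_aux ::
  "ns_type \<Rightarrow> ns_aux \<Rightarrow> (int \<Rightarrow> 'f) \<Rightarrow> (ns_aux \<Rightarrow> 'f) \<Rightarrow> 'f::field" where
  "ns_axis_aux NS2A A_rho a e = 1/8 * (a 0 + e A_rho - a 1)"
| "ns_axis_aux NS3A U_rho a e = 1/3^2 * (2 * a 0 - a 1 - a (-1)) + 5/2^5 * e U_rho"
| "ns_axis_aux NS4A V_rho a e = 1/2^4 * (5 * a 0 - 2 * a 1 - a 2 - 2 * a (-1) + 3 * e V_rho)"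
| "ns_axis_aux NS4B A_rho2 a e = 1/2^3 * (a 0 + e A_rho2 - a 2)"
| "ns_axis_aux NS5A W_rho a e = 7/2^12 * (a 1 + a (-1) - a 2 - a (-2)) + 7/2^5 * e W_rho"
| "ns_axis_aux NS6A A_rho3 a e = 1/2^3 * (a 0 + e A_rho3 - a 3)"
| "ns_axis_aux NS6A U_rho2 a e = 1/3^2 * (2 * a 0 - a 2 - a (-2)) + 5/2^5 * e U_rho2"
| "ns_axis_aux _ _ a e = 0"

text \<open>The only product of two different elements is \<open>a\<^sub>\<rho>\<^sub>3 u\<^sub>\<rho>\<^sub>2 = 0\<close> in type 6A, and
  \<open>w\<^sub>\<rho>\<close> is the only element that is not idempotent.\<close>

definition ns_aux_aux ::
  "ns_aux \<Rightarrow> ns_aux \<Rightarrow> (int \<Rightarrow> 'f) \<Rightarrow> (ns_aux \<Rightarrow> 'f) \<Rightarrow> 'f::field" where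
  "ns_aux_aux x y a e =
    (if x \<noteq> y then 0
     else if x = W_rho then (5^2 * 7)/2^19 * (a (-2) + a (-1) + a 0 + a 1 + a 2)
     else e x)"

text \<open>\<open>ns_coeff T x y z\<close> is the coefficient of \<open>z\<close> in the product \<open>x y\<close>. In the first equation,
  the index map \<open>m \<mapsto> i + m\<close> or \<open>m \<mapsto> i - m\<close> turns the product \<open>a\<^sub>0 a\<^sub>k\<close> into \<open>a\<^sub>i a\<^sub>j\<close>.\<close>

fun ns_coeff :: "ns_type \<Rightarrow> ns_elt \<Rightarrow> ns_elt \<Rightarrow> ns_elt \<Rightarrow> 'f::field" where
  "ns_coeff T (Ax i) (Ax j) z =
    (let n = ns_period T; d = (j - i) mod n;
         a = (\<lambda>m. of_bool (Ax (m mod n) = z)); e = (\<lambda>x. of_bool (Aux x = z))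
     in if 2 * d \<le> n then ns_axis_axis T d (\<lambda>m. a (i + m)) e
        else ns_axis_axis T (n - d) (\<lambda>m. a (i - m)) e)"
| "ns_coeff T (Ax i) (Aux x) z =
    ns_axis_aux T x (\<lambda>m. of_bool (Ax ((i + m) mod ns_period T) = z)) (\<lambda>x. of_bool (Aux x = z))"
| "ns_coeff T (Aux x) (Ax i) z =
    ns_axis_aux T x (\<lambda>m. of_bool (Ax ((i + m) mod ns_period T) = z)) (\<lambda>x. of_bool (Aux x = z))"
| "ns_coeff T (Aux x) (Aux y) z =
    ns_aux_aux x y (\<lambda>m. of_bool (Ax (m mod ns_period T) = z)) (\<lambda>x. of_bool (Aux x = z))"

text \<open>The algebra of type \<open>T\<close> consists of the coordinate vectors with respect to \<open>ns_basis T\<close>,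
  with pointwise addition and scalar multiplication.\<close>

definition ns_carrier :: "ns_type \<Rightarrow> (ns_elt \<Rightarrow> 'f::field) set" where
  "ns_carrier T = {x. \<forall>z. z \<notin> ns_basis T \<longrightarrow> x z = 0}"

definition ns_mult ::
  "ns_type \<Rightarrow> (ns_elt \<Rightarrow> 'f) \<Rightarrow> (ns_elt \<Rightarrow> 'f) \<Rightarrow> ns_elt \<Rightarrow> 'f::field" where
  "ns_mult T x y = (\<lambda>z. \<Sum>b\<in>ns_basis T. \<Sum>c\<in>ns_basis T. x b * y c * ns_coeff T b c z)"

definition (in comm_algebra) isomorphic_to_ns :: "ns_type \<Rightarrow> bool" where
  "isomorphic_to_ns T \<longleftrightarrow>
    (\<exists>\<phi> :: 'v \<Rightarrow> ns_elt \<Rightarrow> 'f.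
       bij_betw \<phi> UNIV (ns_carrier T) \<and>
       (\<forall>u v. \<phi> (u + v) = (\<lambda>z. \<phi> u z + \<phi> v z)) \<and>
       (\<forall>c v. \<phi> (c *s v) = (\<lambda>z. c * \<phi> v z)) \<and>
       (\<forall>u v. \<phi> (u \<cdot> v) = ns_mult T (\<phi> u) (\<phi> v)))"

end

theory Submission
  imports Defs
begin

text \<open>The fusion law is graded by a group of order two, the odd part being the eigenvalue 1/32. So
  the map \<open>tau a\<close> that is -1 on the 1/32-eigenspace of an axis \<open>a\<close> and 1 on the others is an
  automorphism, and the two generating axes spread out to a sequence of axes \<open>c i\<close>, \<open>i\<close> an
  integer, on which the involutions act as the reflections of the integers (\<open>dihedral_exists\<close>).
  Primitivity gives for each axis \<open>a\<close> a linear functional \<open>lam a\<close>, the coefficient of \<open>a\<close> in the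
  decomposition into eigenvectors.

  On a vector fixed by \<open>tau a\<close>, multiplication by \<open>a\<close> separates the three remaining components.
  Applied to \<open>c n + c (- n)\<close> this yields explicit eigenvectors of \<open>c 0\<close>: \<open>U\<^sub>1, U\<^sub>2\<close> for the
  eigenvalue 0 and \<open>V\<^sub>1, V\<^sub>2\<close> for 1/4 (\<open>eigenvectors\<close>). Since \<open>U\<^sub>i U\<^sub>j\<close> is a 0-eigenvector,
  \<open>U\<^sub>i V\<^sub>j\<close> a 1/4-eigenvector and \<open>V\<^sub>i V\<^sub>j\<close> a multiple of \<open>c 0\<close> plus a 0-eigenvector, expanding
  these products determines products that are not known from the definition: first \<open>c 0 \<cdot> e'\<close>
  and \<open>s \<cdot> s\<close>, where \<open>s\<close>, \<open>e\<close>, \<open>e'\<close> stand for the products of axes at distance one and two.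
  Computing \<open>s \<cdot> s\<close> once from \<open>c 0\<close> and once from \<open>c 1\<close> gives a recurrence (\<open>relation_0\<close>) that
  expresses \<open>c 3\<close> by \<open>c (- 2), \<dots>, c 2\<close>, \<open>s\<close>, \<open>e\<close> and \<open>e'\<close>.

  The coefficients are polynomials in four scalars \<open>\<xi>, \<eta>, \<zeta>, \<theta>\<close>, the values of \<open>lam\<close> on axes at
  distance one and two. The pair \<open>(U\<^sub>2, V\<^sub>2)\<close> yields one equation between them
  (\<open>param_equation\<close>) and a linear dependency between \<open>V\<^sub>1\<close> and \<open>V\<^sub>2\<close> (\<open>proportional\<close>), which
  multiplied by \<open>V\<^sub>1\<close> and \<open>V\<^sub>2\<close> yields two more (\<open>determinant_equations\<close>). Together with the
  same equations at \<open>c 1\<close> they have at most nine solutions, all with \<open>\<eta> = \<xi>\<close> and \<open>\<theta> = \<zeta>\<close>, one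
  for each Norton-Sakuma type (\<open>parameter_values\<close>).

  For each solution the recurrence and the dependency become relations with numerical
  coefficients between the \<open>c i\<close>, that is, polynomials in the shift \<open>c i \<mapsto> c (i + 1)\<close>. A
  combination of them is the shift to the power \<open>n\<close> minus one, so the sequence has period \<open>n\<close>.
  All products of the \<open>c i\<close> and \<open>s\<close> are then known; a suitable combination of these vectors
  plays the role of the additional basis vector, and the functionals \<open>lam (c i)\<close> show that the
  expected basis is linearly independent.

  Identities between vectors with polynomial coefficients occur throughout. They are verified by
  applying an arbitrary linear functional (\<open>vec_eqI\<close>), which turns them into identities in the
  field.\<close>

section \<open>Axes of Monster type and their Miyamoto involutions\<close>

locale char_0_algebra = comm_algebra scale mult
  for scale :: "'f::field_char_0 \<Rightarrow> 'v::ab_group_add \<Rightarrow> 'v" (infixr \<open>*s\<close> 75)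
    and mult :: "'v \<Rightarrow> 'v \<Rightarrow> 'v" (infixl \<open>\<cdot>\<close> 70)
begin

lemma mult_add_right: "u \<cdot> (v + w) = u \<cdot> v + u \<cdot> w"
  by (metis mult_commute mult_add_left)

lemma mult_scale_right: "u \<cdot> (c *s v) = c *s (u \<cdot> v)"
  by (metis mult_commute mult_scale_left)

lemma mult_zero_left [simp]: "0 \<cdot> v = 0"
  by (metis mult_add_left add_cancel_right_left)

lemma mult_zero_right [simp]: "v \<cdot> 0 = 0"
  by (metis mult_commute mult_zero_left)

lemma mult_minus_left: "(- u) \<cdot> v = - (u \<cdot> v)"
  by (metis mult_add_left mult_zero_left add_eq_0_iff neg_eq_iff_add_eq_0)

lemma mult_minus_right: "v \<cdot> (- u) = - (v \<cdot> u)"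
  by (metis mult_commute mult_minus_left)

lemma mult_diff_left: "(u - v) \<cdot> w = u \<cdot> w - v \<cdot> w"
  by (metis mult_add_left mult_minus_left diff_conv_add_uminus)

lemma mult_diff_right: "w \<cdot> (u - v) = w \<cdot> u - w \<cdot> v"
  by (metis mult_commute mult_diff_left)

lemmas mult_linear = mult_add_left mult_add_right mult_diff_left mult_diff_right
  mult_minus_left mult_minus_right mult_scale_left mult_scale_right

lemma mult_sum_left: "sum f A \<cdot> v = (\<Sum>i\<in>A. f i \<cdot> v)"
  by (induction A rule: infinite_finite_induct) (auto simp: mult_add_left)

lemma mult_sum_right: "v \<cdot> sum f A = (\<Sum>i\<in>A. v \<cdot> f i)"
  by (induction A rule: infinite_finite_induct) (auto simp: mult_add_right)

text \<open>Linear functionals serve as coordinates: by \<open>vec_eqI\<close> below they separate vectors.\<close>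

definition functional :: "('v \<Rightarrow> 'f) \<Rightarrow> bool" where
  "functional f \<longleftrightarrow> (\<forall>u v. f (u + v) = f u + f v) \<and> (\<forall>c v. f (c *s v) = c * f v)"

lemma functional_simps:
  assumes "functional f"
  shows "f (u + v) = f u + f v" "f (c *s v) = c * f v" "f 0 = 0" "f (- v) = - f v"
    "f (u - v) = f u - f v"
proof -
  show a: "f (u + v) = f u + f v" for u v using assms by (simp add: functional_def)
  show s: "f (c *s v) = c * f v" for c v using assms by (simp add: functional_def)
  show z: "f 0 = 0" using s[of 0 0] by simp
  show m: "f (- v) = - f v" for v using a[of v "- v"] z
      by (simp add: eq_neg_iff_add_eq_0 add.commute)
  show "f (u - v) = f u - f v" using a[of u "- v"] m by simp
qed

lemma vec_eqI:
  assumes "\<And>f. functional f \<Longrightarrow> f u = f v"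
  shows "u = v"
proof (rule ccontr)
  assume "u \<noteq> v"
  interpret pr: vector_space_pair scale "(*) :: 'f \<Rightarrow> 'f \<Rightarrow> 'f"
    by unfold_locales (auto simp: algebra_simps)
  have "independent {u - v}" using \<open>u \<noteq> v\<close> by simp
  from pr.linear_independent_extend[OF this, of "\<lambda>_. 1"]
  obtain g where g: "Vector_Spaces.linear scale (*) g" "g (u - v) = 1" by auto
  then have "functional g"
    unfolding functional_def by (metis Vector_Spaces.linear.axioms(3) module_hom.add
        module_hom.scale
        Vector_Spaces.linear_iff_module_hom)
  with assms[OF this] g(2) show False by (simp add: functional_simps)
qed

lemma eigenspaceD: "v \<in> eigenspace a l \<Longrightarrow> a \<cdot> v = l *s v"
  by (simp add: eigenspace_def mult_commute)

lemma eigenspace_linear: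
  "u \<in> eigenspace a l \<Longrightarrow> v \<in> eigenspace a l \<Longrightarrow> u + v \<in> eigenspace a l"
  "u \<in> eigenspace a l \<Longrightarrow> v \<in> eigenspace a l \<Longrightarrow> u - v \<in> eigenspace a l"
  "u \<in> eigenspace a l \<Longrightarrow> - u \<in> eigenspace a l"
  "u \<in> eigenspace a l \<Longrightarrow> c *s u \<in> eigenspace a l"
  "0 \<in> eigenspace a l"
  by (auto simp: eigenspace_def mult_linear scale_right_distrib scale_right_diff_distrib
      scale_left_commute)

abbreviation axis :: "'v \<Rightarrow> bool" where
  "axis \<equiv> primitive_axis (1/4) (1/32)"

text \<open>The scalar \<open>c\<close> and the vectors \<open>u\<close>, \<open>w\<close>, \<open>d\<close> belong to the eigenvalues 1, 0, 1/4 and 1/32, in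
  this order. By primitivity a scalar suffices for the eigenvalue 1.\<close>

definition decomposes :: "'v \<Rightarrow> 'v \<Rightarrow> 'f \<Rightarrow> 'v \<Rightarrow> 'v \<Rightarrow> 'v \<Rightarrow> bool" where
  "decomposes a v c u w d \<longleftrightarrow> v = c *s a + u + w + d \<and>
     u \<in> eigenspace a 0 \<and> w \<in> eigenspace a (1/4) \<and> d \<in> eigenspace a (1/32)"

lemma eigenvalue_distinct:
  "(1::'f) \<noteq> 1/4" "(1::'f) \<noteq> 1/32" "(1/4::'f) \<noteq> 1/32" "(1/32::'f) \<noteq> 1/4" "(1/4::'f) \<noteq> 1"
      "(1/32::'f) \<noteq> 1"
  by (auto simp: field_simps)

lemma axis_nonzero: "axis a \<Longrightarrow> a \<noteq> 0" and axis_idem: "axis a \<Longrightarrow> a \<cdot> a = a"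
  by (auto simp: primitive_axis_def)

lemma axis_eigenspace_1: "axis a \<Longrightarrow> v \<in> eigenspace a 1 \<Longrightarrow> \<exists>c. v = c *s a"
  by (auto simp: primitive_axis_def)

lemma axis_mem_1: "axis a \<Longrightarrow> c *s a \<in> eigenspace a 1"
  by (auto simp: primitive_axis_def)

lemma decomposes_exists:
  assumes "axis a"
  shows "\<exists>c u w d. decomposes a v c u w d"
proof -
  have "v \<in> eigenspace_sum a {1, 0, 1/4, 1/32}" using assms by (simp add: primitive_axis_def)
  then obtain f where f: "v = (\<Sum>l\<in>{1, 0, 1/4, 1/32}. f l)"
    "\<forall>l\<in>{1, 0, 1/4, 1/32}. f l \<in> eigenspace a l"
    unfolding eigenspace_sum_def by blast
  obtain c where "f 1 = c *s a" using axis_eigenspace_1[OF assms] f(2) by blast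
  then have "decomposes a v c (f 0) (f (1/4)) (f (1/32))"
    using f by (simp add: decomposes_def eigenvalue_distinct add.assoc)
  then show ?thesis by blast
qed

lemma decomposes_zero:
  assumes "axis a" "decomposes a 0 c u w d"
  shows "c = 0 \<and> u = 0 \<and> w = 0 \<and> d = 0"
proof -
  define f where "f = (\<lambda>l::'f. if l = 1 then c *s a else if l = 0 then u else if l
      = 1/4 then w else d)"
  have "(\<forall>l\<in>{1, 0, 1/4, 1/32}. f l \<in> eigenspace a l) \<and> (\<Sum>l\<in>{1, 0, 1/4, 1/32}. f l) = 0"
    using assms(2) axis_mem_1[OF assms(1)]
    by (auto simp: f_def decomposes_def eigenvalue_distinct add.assoc)
  then have "\<forall>l\<in>{1, 0, 1/4, 1/32}. f l = 0"
    using assms(1) unfolding primitive_axis_def eigenspaces_independent_def by blast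
  then show ?thesis using axis_nonzero[OF assms(1)]
    by (auto simp: f_def eigenvalue_distinct)
qed

lemma decomposes_diff:
  assumes "decomposes a v c u w d" "decomposes a v' c' u' w' d'"
  shows "decomposes a (v - v') (c - c') (u - u') (w - w') (d - d')"
  using assms by (auto simp: decomposes_def eigenspace_linear algebra_simps)

lemma decomposes_add:
  assumes "decomposes a v c u w d" "decomposes a v' c' u' w' d'"
  shows "decomposes a (v + v') (c + c') (u + u') (w + w') (d + d')"
  using assms by (auto simp: decomposes_def eigenspace_linear algebra_simps)

lemma decomposes_scale:
  assumes "decomposes a v c u w d"
  shows "decomposes a (k *s v) (k * c) (k *s u) (k *s w) (k *s d)"
  using assms by (auto simp: decomposes_def eigenspace_linear scale_right_distrib)

lemma decomposes_unique:
  assumes "axis a" "decomposes a v c u w d" "decomposes a v c' u' w' d'"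
  shows "c = c' \<and> u = u' \<and> w = w' \<and> d = d'"
  using decomposes_zero[OF assms(1), of "c - c'" "u - u'" "w - w'" "d - d'"]
    decomposes_diff[OF assms(2,3)] by simp

definition lam :: "'v \<Rightarrow> 'v \<Rightarrow> 'f" where
  "lam a v = (THE c. \<exists>u w d. decomposes a v c u w d)"

definition tau :: "'v \<Rightarrow> 'v \<Rightarrow> 'v" where
  "tau a v = (THE v'. \<exists>c u w d. decomposes a v c u w d \<and> v' = c *s a + u + w - d)"

lemma lam_eq: "axis a \<Longrightarrow> decomposes a v c u w d \<Longrightarrow> lam a v = c"
  unfolding lam_def by (rule the_equality) (use decomposes_unique in blast)+

lemma tau_eq: "axis a \<Longrightarrow> decomposes a v c u w d \<Longrightarrow> tau a v = c *s a + u + w - d"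
  unfolding tau_def by (rule the_equality) (use decomposes_unique in blast)+

lemma decomposesE:
  assumes "axis a"
  obtains u w d where "decomposes a v (lam a v) u w d"
    "tau a v = lam a v *s a + u + w - d"
  using decomposes_exists[OF assms] lam_eq[OF assms] tau_eq[OF assms] by metis

lemma lam_functional: "axis a \<Longrightarrow> functional (lam a)"
  unfolding functional_def
  by (metis decomposesE lam_eq decomposes_add decomposes_scale)

lemma tau_add: "axis a \<Longrightarrow> tau a (u + v) = tau a u + tau a v"
proof -
  assume a: "axis a"
  obtain p q r where 1: "decomposes a u (lam a u) p q r" using decomposesE[OF a] .
  obtain p' q' r' where 2: "decomposes a v (lam a v) p' q' r'" using decomposesE[OF a] .
  show ?thesis
    unfolding tau_eq[OF a 1] tau_eq[OF a 2] tau_eq[OF a decomposes_add[OF 1 2]]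
    by (simp add: algebra_simps)
qed

lemma tau_scale: "axis a \<Longrightarrow> tau a (k *s v) = k *s tau a v"
proof -
  assume a: "axis a"
  obtain p q r where 1: "decomposes a v (lam a v) p q r" using decomposesE[OF a] .
  show ?thesis
    using tau_eq[OF a 1] tau_eq[OF a decomposes_scale[OF 1]]
    by (simp add: scale_right_distrib scale_right_diff_distrib)
qed

lemma decomposes_eigen:
  "axis a \<Longrightarrow> decomposes a a 1 0 0 0"
  "u \<in> eigenspace a 0 \<Longrightarrow> decomposes a u 0 u 0 0"
  "u \<in> eigenspace a (1/4) \<Longrightarrow> decomposes a u 0 0 u 0"
  "u \<in> eigenspace a (1/32) \<Longrightarrow> decomposes a u 0 0 0 u"
  by (auto simp: decomposes_def eigenspace_linear)

lemma lam_eigen: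
  assumes "axis a"
  shows "lam a a = 1" "u \<in> eigenspace a 0 \<Longrightarrow> lam a u = 0"
    "u \<in> eigenspace a (1/4) \<Longrightarrow> lam a u = 0" "u \<in> eigenspace a (1/32) \<Longrightarrow> lam a u = 0"
  using lam_eq[OF assms] decomposes_eigen assms by blast+

lemma tau_eigen:
  assumes "axis a"
  shows "tau a a = a" "u \<in> eigenspace a 0 \<Longrightarrow> tau a u = u"
    "u \<in> eigenspace a (1/4) \<Longrightarrow> tau a u = u" "u \<in> eigenspace a (1/32) \<Longrightarrow> tau a u = - u"
  using tau_eq[OF assms] decomposes_eigen assms by (fastforce)+

lemma lam_tau: "axis a \<Longrightarrow> lam a (tau a v) = lam a v"
proof -
  assume a: "axis a"
  obtain p q r where 1: "decomposes a v (lam a v) p q r" "tau a v = lam a v *s a + p + q - r"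
    using decomposesE[OF a] .
  then have "decomposes a (tau a v) (lam a v) p q (- r)"
    by (simp add: decomposes_def eigenspace_linear)
  then show ?thesis using lam_eq[OF a] by blast
qed

lemma tau_tau: "axis a \<Longrightarrow> tau a (tau a v) = v"
proof -
  assume a: "axis a"
  obtain p q r where 1: "decomposes a v (lam a v) p q r" "tau a v = lam a v *s a + p + q - r"
    using decomposesE[OF a] .
  then have "decomposes a (tau a v) (lam a v) p q (- r)"
    by (simp add: decomposes_def eigenspace_linear)
  from tau_eq[OF a this] show ?thesis using 1(1) by (simp add: decomposes_def)
qed

lemma decomposes_mult:
  assumes "axis a" "decomposes a v c u w d"
  shows "decomposes a (a \<cdot> v) c 0 ((1/4) *s w) ((1/32) *s d)"
  using assms by (auto simp: decomposes_def eigenspace_linear mult_linear axis_idem dest!: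
      eigenspaceD)

lemma lam_mult: "axis a \<Longrightarrow> lam a (a \<cdot> v) = lam a v"
  by (metis decomposesE decomposes_mult lam_eq)

text \<open>The difference \<open>v - tau a v\<close> is twice the 1/32-component of \<open>v\<close>.\<close>

lemma mult_diff_tau: "axis a \<Longrightarrow> a \<cdot> v - a \<cdot> tau a v = (1/32) *s (v - tau a v)"
proof -
  assume a: "axis a"
  obtain p q r where 1: "decomposes a v (lam a v) p q r" "tau a v = lam a v *s a + p + q - r"
    using decomposesE[OF a] .
  then have "v - tau a v = r + r" unfolding 1(2) by (simp add: decomposes_def algebra_simps)
  moreover have "a \<cdot> r = (1/32) *s r" using 1 by (auto simp: decomposes_def dest!: eigenspaceD)
  ultimately show ?thesis
    by (metis mult_diff_right mult_add_right scale_right_distrib)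
qed

text \<open>A vector fixed by \<open>tau a\<close> has no 1/32-component, so \<open>v = l *s a + p + q\<close> with
  \<open>a \<cdot> v = l *s a + (1/4) *s q\<close>, and the components \<open>q\<close> and \<open>p\<close> can be read off from \<open>v\<close>,
  \<open>a \<cdot> v\<close> and \<open>l = lam a v\<close>.\<close>

lemma fixed_parts:
  assumes a: "axis a" and fx: "tau a v = v"
  shows "4 *s (a \<cdot> v - lam a v *s a) \<in> eigenspace a (1/4)"
    and "v - lam a v *s a - 4 *s (a \<cdot> v - lam a v *s a) \<in> eigenspace a 0"
proof -
  obtain p q r where 1: "decomposes a v (lam a v) p q r" "tau a v = lam a v *s a + p + q - r"
    using decomposesE[OF a] .
  have "v - tau a v = r + r" using 1(1) unfolding 1(2) by (simp add: decomposes_def algebra_simps)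
  then have "r + r = 0" using fx by simp
  then have "2 *s r = 0" by (metis one_add_one scale_left_distrib scale_one)
  then have r: "r = 0" by simp
  have v: "v = lam a v *s a + p + q" "a \<cdot> p = 0" "a \<cdot> q = (1/4) *s q"
    using 1 r by (auto simp: decomposes_def dest!: eigenspaceD)
  have "a \<cdot> v = a \<cdot> (lam a v *s a + p + q)" using v(1) by (rule arg_cong)
  also have "\<dots> = lam a v *s a + (1/4) *s q" by (simp add: mult_linear axis_idem[OF a] v(2,3))
  finally have "a \<cdot> v = lam a v *s a + (1/4) *s q" .
  then have "4 *s (a \<cdot> v - lam a v *s a) = q" by simp
  moreover have "v - l *s a - q = p" if "l = lam a v" for l
    using v(1) that by (metis add.commute add_diff_cancel_left' diff_diff_eq)
  ultimately show "4 *s (a \<cdot> v - lam a v *s a) \<in> eigenspace a (1/4)"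
    "v - lam a v *s a - 4 *s (a \<cdot> v - lam a v *s a) \<in> eigenspace a 0"
    using 1(1) by (simp_all add: decomposes_def)
qed

lemma fusion:
  assumes "axis a" "u \<in> eigenspace a l" "v \<in> eigenspace a m"
    "l \<in> {1, 0, 1/4, 1/32}" "m \<in> {1, 0, 1/4, 1/32}"
  shows "u \<cdot> v \<in> eigenspace_sum a (monster_law (1/4) (1/32) l m)"
  using assms unfolding primitive_axis_def by blast

lemma law_simps:
  "monster_law (1/4) (1/32) 0 0 = {0::'f}"
  "monster_law (1/4) (1/32) 0 (1/4) = {1/4::'f}"
  "monster_law (1/4) (1/32) 0 (1/32) = {1/32::'f}"
  "monster_law (1/4) (1/32) (1/4) (1/4) = {1, 0::'f}"
  "monster_law (1/4) (1/32) (1/4) (1/32) = {1/32::'f}"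
  "monster_law (1/4) (1/32) (1/32) (1/32) = {1, 0, 1/4::'f}"
  by (simp_all add: monster_law_def eigenvalue_distinct doubleton_eq_iff insert_eq_iff)

lemma eigenspace_sum_single: "eigenspace_sum a {l} = eigenspace a l"
  by (auto simp: eigenspace_sum_def)

lemma fusion_rules:
  assumes a: "axis a"
  shows "u \<in> eigenspace a 0 \<Longrightarrow> v \<in> eigenspace a 0 \<Longrightarrow> u \<cdot> v \<in> eigenspace a 0"
    and "u \<in> eigenspace a 0 \<Longrightarrow> v \<in> eigenspace a (1/4) \<Longrightarrow> u \<cdot> v \<in> eigenspace a (1/4)"
    and "u \<in> eigenspace a 0 \<Longrightarrow> v \<in> eigenspace a (1/32) \<Longrightarrow> u \<cdot> v \<in> eigenspace a (1/32)"
    and "u \<in> eigenspace a (1/4) \<Longrightarrow> v \<in> eigenspace a (1/32) \<Longrightarrow> u \<cdot> v \<in> eigenspace a (1/32)"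
  using fusion[OF a, of u _ v] law_simps by (fastforce simp: eigenspace_sum_single)+

lemma fusion_alpha_alpha:
  assumes a: "axis a" and "u \<in> eigenspace a (1/4)" "v \<in> eigenspace a (1/4)"
  shows "\<exists>c z. z \<in> eigenspace a 0 \<and> u \<cdot> v = c *s a + z"
proof -
  have "u \<cdot> v \<in> eigenspace_sum a {1, 0}" using fusion[OF assms] law_simps(4) by simp
  then obtain f where f: "u \<cdot> v = (\<Sum>l\<in>{1, 0}. f l)" "\<forall>l\<in>{1, 0}. f l \<in> eigenspace a l"
    unfolding eigenspace_sum_def by blast
  moreover obtain c where "f 1 = c *s a" using axis_eigenspace_1[OF a] f(2) by blast
  ultimately show ?thesis by auto
qed

lemma fusion_beta_beta:
  assumes a: "axis a" and "u \<in> eigenspace a (1/32)" "v \<in> eigenspace a (1/32)"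
  shows "\<exists>c z w. z \<in> eigenspace a 0 \<and> w \<in> eigenspace a (1/4) \<and> u \<cdot> v = c *s a + z + w"
proof -
  have "u \<cdot> v \<in> eigenspace_sum a {1, 0, 1/4}" using fusion[OF assms] law_simps(6) by simp
  then obtain f where f: "u \<cdot> v = (\<Sum>l\<in>{1, 0, 1/4}. f l)" "\<forall>l\<in>{1, 0, 1/4}. f l \<in> eigenspace a l"
    unfolding eigenspace_sum_def by blast
  moreover obtain c where "f 1 = c *s a" using axis_eigenspace_1[OF a] f(2) by blast
  ultimately have "f 0 \<in> eigenspace a 0 \<and> f (1/4) \<in> eigenspace a (1/4) \<and> u \<cdot> v = c *s a + f 0
      + f (1/4)"
    by (simp add: eigenvalue_distinct add.assoc)
  then show ?thesis by blast
qed

lemma fusion_zero_zero: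
  assumes "axis a" "u \<in> eigenspace a 0" "v \<in> eigenspace a 0"
  shows "a \<cdot> (u \<cdot> v) = 0" "lam a (u \<cdot> v) = 0"
  using fusion_rules(1)[OF assms] lam_eigen[OF assms(1)] by (auto dest: eigenspaceD)

lemma fusion_zero_alpha:
  assumes "axis a" "u \<in> eigenspace a 0" "v \<in> eigenspace a (1/4)"
  shows "a \<cdot> (u \<cdot> v) = (1/4) *s (u \<cdot> v)" "lam a (u \<cdot> v) = 0"
  using fusion_rules(2)[OF assms] lam_eigen[OF assms(1)] by (auto dest: eigenspaceD)

text \<open>This is the source of all later relations: a product of two 1/4-eigenvectors is determined up
  to a 0-eigenvector by the scalar \<open>lam a\<close>, and multiplication by \<open>a\<close> removes the 0-eigenvector.\<close>

lemma fusion_alpha_alpha':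
  assumes a: "axis a" and "u \<in> eigenspace a (1/4)" "v \<in> eigenspace a (1/4)"
  shows "a \<cdot> (u \<cdot> v) = lam a (u \<cdot> v) *s a"
proof -
  obtain c z where "z \<in> eigenspace a 0" "u \<cdot> v = c *s a + z" using fusion_alpha_alpha[OF assms]
      by blast
  then show ?thesis
    using lam_functional[OF a] lam_eigen[OF a] axis_idem[OF a]
    by (auto simp: mult_linear functional_simps dest: eigenspaceD)
qed

text \<open>Together with the next two lemmas: the fusion law is graded, with even part spanned by the
  eigenvalues 1, 0, 1/4 and odd part 1/32. Hence \<open>tau a\<close> is multiplicative.\<close>

lemma even_part_closed:
  assumes a: "axis a"
    and "u \<in> eigenspace a 0" "w \<in> eigenspace a (1/4)" "u' \<in> eigenspace a 0"
        "w' \<in> eigenspace a (1/4)"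
  shows "tau a ((c *s a + u + w) \<cdot> (c' *s a + u' + w')) = (c *s a + u + w) \<cdot> (c' *s a + u' + w')"
proof -
  have ww: "tau a (w \<cdot> w') = w \<cdot> w'"
    using fusion_alpha_alpha[OF a assms(3,5)] tau_eigen[OF a]
        by (auto simp: tau_add[OF a] tau_scale[OF a])
  have 1: "u \<cdot> a = 0" "w \<cdot> a = (1/4) *s w"
    using assms(2,3) by (auto simp: eigenspace_def)
  have 2: "a \<cdot> u' = 0" "a \<cdot> w' = (1/4) *s w'"
    using assms(4,5) by (auto dest: eigenspaceD)
  have 3: "tau a (u \<cdot> u') = u \<cdot> u'" "tau a (u \<cdot> w') = u \<cdot> w'" "tau a (w \<cdot> u') = w \<cdot> u'"
    using fusion_rules[OF a] assms tau_eigen[OF a] mult_commute by metis+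
  show ?thesis
    using tau_eigen[OF a] assms(2-5)
    by (simp add: mult_linear 1 2 3 ww axis_idem[OF a] tau_add[OF a] tau_scale[OF a])
qed

lemma even_odd:
  assumes a: "axis a"
    and "u \<in> eigenspace a 0" "w \<in> eigenspace a (1/4)" "d \<in> eigenspace a (1/32)"
  shows "tau a ((c *s a + u + w) \<cdot> d) = - ((c *s a + u + w) \<cdot> d)"
proof -
  have "a \<cdot> d \<in> eigenspace a (1/32)" using assms(4) eigenspace_linear(4)[OF assms(4)]
      by (simp add: eigenspaceD)
  then have "(c *s a + u + w) \<cdot> d \<in> eigenspace a (1/32)"
    using fusion_rules[OF a] assms by (auto simp: mult_linear intro!: eigenspace_linear)
  then show ?thesis using tau_eigen[OF a] by blast
qed

lemma odd_odd:
  assumes a: "axis a" and "d \<in> eigenspace a (1/32)" "d' \<in> eigenspace a (1/32)"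
  shows "tau a (d \<cdot> d') = d \<cdot> d'"
  using fusion_beta_beta[OF assms] tau_eigen[OF a] by (auto simp: tau_add[OF a] tau_scale[OF a])

lemma tau_mult:
  assumes a: "axis a"
  shows "tau a (v \<cdot> v') = tau a v \<cdot> tau a v'"
proof -
  obtain u w d where 1: "decomposes a v (lam a v) u w d" "tau a v = lam a v *s a + u + w - d"
    using decomposesE[OF a] .
  obtain u' w' d' where 2: "decomposes a v' (lam a v') u' w' d'"
      "tau a v' = lam a v' *s a + u' + w' - d'"
    using decomposesE[OF a] .
  define e where "e = lam a v *s a + u + w"
  define e' where "e' = lam a v' *s a + u' + w'"
  have m: "u \<in> eigenspace a 0" "w \<in> eigenspace a (1/4)" "d \<in> eigenspace a (1/32)"
    "u' \<in> eigenspace a 0" "w' \<in> eigenspace a (1/4)" "d' \<in> eigenspace a (1/32)"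
    using 1 2 by (auto simp: decomposes_def)
  have v: "v = e + d" "v' = e' + d'" using 1 2 by (simp_all add: decomposes_def e_def e'_def)
  have "tau a (e \<cdot> e') = e \<cdot> e'" "tau a (e \<cdot> d') = - (e \<cdot> d')" "tau a (d \<cdot> e') = - (d \<cdot> e')"
      "tau a (d \<cdot> d') = d \<cdot> d'"
    unfolding e_def e'_def using even_part_closed[OF a m(1,2,4,5)] even_odd[OF a m(1,2,6)]
      even_odd[OF a m(4,5,3)] odd_odd[OF a m(3,6)] by (simp_all add: mult_commute[of d])
  then have "tau a (v \<cdot> v') = (e - d) \<cdot> (e' - d')"
    by (simp add: v mult_linear tau_add[OF a] algebra_simps)
  then show ?thesis using 1 2 by (simp add: e_def e'_def)
qed

definition automorphism :: "('v \<Rightarrow> 'v) \<Rightarrow> bool" where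
  "automorphism g \<longleftrightarrow> bij g \<and> (\<forall>u v. g (u + v) = g u + g v) \<and> (\<forall>c v. g (c *s v) = c *s g v) \<and>
     (\<forall>u v. g (u \<cdot> v) = g u \<cdot> g v)"

lemma automorphism_tau: "axis a \<Longrightarrow> automorphism (tau a)"
  unfolding automorphism_def using tau_add tau_scale tau_mult tau_tau
  by (metis involuntory_imp_bij)

lemma automorphism_comp: "automorphism g \<Longrightarrow> automorphism h \<Longrightarrow> automorphism (g \<circ> h)"
  by (simp add: automorphism_def bij_comp)

context
  fixes g :: "'v \<Rightarrow> 'v"
  assumes g: "automorphism g"
begin

lemma aut_simps: "g (u + v) = g u + g v" "g (c *s v) = c *s g v" "g (u \<cdot> v) = g u \<cdot> g v"
  "g 0 = 0" "g (u - v) = g u - g v"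
proof -
  show a: "g (u + v) = g u + g v" for u v using g by (simp add: automorphism_def)
  show "g (c *s v) = c *s g v" "g (u \<cdot> v) = g u \<cdot> g v" using g by (simp_all add: automorphism_def)
  show "g 0 = 0" using a[of 0 0] by simp
  show "g (u - v) = g u - g v" using a[of "u - v" v] by simp
qed

lemma aut_sum: "g (sum f A) = (\<Sum>i\<in>A. g (f i))"
  by (induction A rule: infinite_finite_induct) (auto simp: aut_simps)

lemma aut_inv: "inv g (g v) = v" "g (inv g v) = v" "g u = g v \<longleftrightarrow> u = v"
  using g by (simp_all add: automorphism_def bij_is_inj bij_is_surj surj_f_inv_f inj_eq)

lemma aut_eigenspace: "g v \<in> eigenspace (g a) l \<longleftrightarrow> v \<in> eigenspace a l"
  by (simp add: eigenspace_def aut_inv flip: aut_simps)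

lemma aut_eigenspace_sum: "g v \<in> eigenspace_sum (g a) S \<longleftrightarrow> v \<in> eigenspace_sum a S"
proof
  assume "g v \<in> eigenspace_sum (g a) S"
  then obtain f where f: "g v = sum f S" "\<forall>l\<in>S. f l \<in> eigenspace (g a) l"
    unfolding eigenspace_sum_def by blast
  have "g v = g (\<Sum>l\<in>S. inv g (f l))" by (simp add: aut_sum aut_inv f)
  then have "v = (\<Sum>l\<in>S. inv g (f l))" by (simp add: aut_inv)
  moreover have "\<forall>l\<in>S. inv g (f l) \<in> eigenspace a l"
    using f(2) aut_eigenspace[of "inv g (f _)"] by (simp add: aut_inv)
  ultimately show "v \<in> eigenspace_sum a S" unfolding eigenspace_sum_def by blast
next
  assume "v \<in> eigenspace_sum a S"
  then obtain f where f: "v = sum f S" "\<forall>l\<in>S. f l \<in> eigenspace a l"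
    unfolding eigenspace_sum_def by blast
  have "g v = (\<Sum>l\<in>S. g (f l))" "\<forall>l\<in>S. g (f l) \<in> eigenspace (g a) l"
    using f by (simp_all add: aut_sum aut_eigenspace)
  then show "g v \<in> eigenspace_sum (g a) S" unfolding eigenspace_sum_def by blast
qed

lemma aut_axis:
  assumes a: "axis a"
  shows "axis (g a)"
  unfolding primitive_axis_def
proof (intro conjI)
  show "g a \<noteq> 0" using axis_nonzero[OF a] aut_inv(3)[of a 0] by (simp add: aut_simps)
  show "g a \<cdot> g a = g a" by (simp add: axis_idem[OF a] flip: aut_simps)
  show "eigenspace_sum (g a) {1, 0, 1/4, 1/32} = UNIV"
  proof -
    have "g (inv g v) \<in> eigenspace_sum (g a) {1, 0, 1/4, 1/32}" for v
      using a by (subst aut_eigenspace_sum) (simp add: primitive_axis_def)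
    then show ?thesis by (auto simp: aut_inv)
  qed
  show "eigenspaces_independent (g a) {1, 0, 1/4, 1/32}"
    unfolding eigenspaces_independent_def
  proof (intro allI impI)
    fix f :: "'f \<Rightarrow> 'v"
    let ?S = "{1, 0, 1/4, 1/32} :: 'f set"
    assume f: "(\<forall>l\<in>?S. f l \<in> eigenspace (g a) l) \<and> sum f ?S = 0"
    have "g (\<Sum>l\<in>?S. inv g (f l)) = g 0"
      using f by (simp only: aut_sum aut_inv aut_simps)
    then have "(\<Sum>l\<in>?S. inv g (f l)) = 0" by (simp only: aut_inv)
    moreover have "\<forall>l\<in>?S. inv g (f l) \<in> eigenspace a l"
      using f aut_eigenspace[of "inv g (f _)"] by (simp add: aut_inv)
    moreover have "eigenspaces_independent a ?S" using a by (simp add: primitive_axis_def)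
    ultimately have "\<forall>l\<in>?S. inv g (f l) = 0"
      unfolding eigenspaces_independent_def by (elim allE[of _ "\<lambda>l. inv g (f l)"]) blast
    then show "\<forall>l\<in>?S. f l = 0" by (metis aut_inv(2) aut_simps(4))
  qed
  show "\<forall>l\<in>{1, 0, 1/4, 1/32}. \<forall>m\<in>{1, 0, 1/4, 1/32}. \<forall>u\<in>eigenspace (g a) l. \<forall>v\<in>eigenspace (g a) m.
        u \<cdot> v \<in> eigenspace_sum (g a) (monster_law (1/4) (1/32) l m)"
  proof (intro ballI)
    fix l m u v assume lm: "l \<in> {1, 0, 1/4, 1/32::'f}" "m \<in> {1, 0, 1/4, 1/32::'f}"
      and u: "u \<in> eigenspace (g a) l" and v: "v \<in> eigenspace (g a) m"
    have "inv g u \<in> eigenspace a l" "inv g v \<in> eigenspace a m"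
      using u v aut_eigenspace[of "inv g _"] by (simp_all add: aut_inv)
    then have "inv g u \<cdot> inv g v \<in> eigenspace_sum a (monster_law (1/4) (1/32) l m)"
      using fusion[OF a] lm by blast
    then have "g (inv g u \<cdot> inv g v) \<in> eigenspace_sum (g a) (monster_law (1/4) (1/32) l m)"
      by (simp only: aut_eigenspace_sum)
    then show "u \<cdot> v \<in> eigenspace_sum (g a) (monster_law (1/4) (1/32) l m)"
      by (simp add: aut_simps aut_inv)
  qed
  show "eigenspace (g a) 1 = range (\<lambda>c. c *s g a)"
  proof -
    have "v \<in> eigenspace (g a) 1 \<longleftrightarrow> (\<exists>c. v = c *s g a)" for v
    proof -
      have "v \<in> eigenspace (g a) 1 \<longleftrightarrow> inv g v \<in> eigenspace a 1"
        using aut_eigenspace[of "inv g v"] by (simp add: aut_inv)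
      also have "\<dots> \<longleftrightarrow> (\<exists>c. inv g v = c *s a)" using a by (auto simp: primitive_axis_def)
      also have "\<dots> \<longleftrightarrow> (\<exists>c. v = c *s g a)" by (metis aut_inv(1,2) aut_simps(2))
      finally show ?thesis .
    qed
    then show ?thesis by auto
  qed
qed

lemma aut_lam_tau:
  assumes a: "axis a"
  shows "lam (g a) (g v) = lam a v" "tau (g a) (g v) = g (tau a v)"
proof -
  obtain p q r where 1: "decomposes a v (lam a v) p q r" "tau a v = lam a v *s a + p + q - r"
    using decomposesE[OF a] .
  have "g v = g (lam a v *s a + p + q + r)" using 1(1) unfolding decomposes_def
      by (intro arg_cong[of _ _ g]) blast
  then have 2: "decomposes (g a) (g v) (lam a v) (g p) (g q) (g r)"
    using 1(1) by (simp add: decomposes_def aut_eigenspace aut_simps)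
  show "lam (g a) (g v) = lam a v" using lam_eq[OF aut_axis[OF a] 2] .
  show "tau (g a) (g v) = g (tau a v)" using tau_eq[OF aut_axis[OF a] 2] 1(2)
      by (simp add: aut_simps)
qed

end

end

section \<open>Dihedral sequences of axes\<close>

context char_0_algebra
begin

text \<open>The form in which known relations \<open>w = 0\<close> enter: the functional identity in the second
  assumption is a ring identity, because \<open>w\<close> is the exact multiple of a relation that makes up
  the difference of \<open>u\<close> and \<open>v\<close>.\<close>

lemma vec_eq_by:
  assumes "w = 0" "\<And>f. functional f \<Longrightarrow> f u = f v + f w"
  shows "u = v"
  using assms by (intro vec_eqI) (simp add: functional_simps)

definition dihedral :: "(int \<Rightarrow> 'v) \<Rightarrow> bool" where
  "dihedral c \<longleftrightarrow> (\<forall>i. axis (c i)) \<and> (\<forall>i j. tau (c i) (c j) = c (2 * i - j))"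

text \<open>The summands subtracted from the product make \<open>sg c n i\<close> invariant under the reflections
  \<open>tau (c i)\<close> and \<open>tau (c (i + n))\<close>; so it depends only on \<open>i\<close> modulo \<open>n\<close> (lemma \<open>sg_cong\<close>).
  These are the vectors usually called \<open>s\<^sub>i\<^sub>,\<^sub>n\<close>.\<close>

definition sg :: "(int \<Rightarrow> 'v) \<Rightarrow> int \<Rightarrow> int \<Rightarrow> 'v" where
  "sg c n i = c i \<cdot> c (i + n) - (1/32) *s (c i + c (i + n))"

lemma dihedral_reindex:
  assumes "dihedral c"
  shows "dihedral (\<lambda>i. c (k + m * i))"
proof -
  have "2 * (k + m * i) - (k + m * j) = k + m * (2 * i - j)" for i j by (simp add: algebra_simps)
  then show ?thesis using assms by (simp add: dihedral_def)
qed

text \<open>The product \<open>r\<close> of the two involutions acts as the shift by two, so the even members are the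
  images of \<open>a\<close> under the powers of \<open>r\<close> and the odd ones those of \<open>b\<close>.\<close>

lemma dihedral_exists:
  assumes a: "axis a" and b: "axis b"
  shows "\<exists>c. dihedral c \<and> c 0 = a \<and> c 1 = b"
proof -
  define r where "r = (\<lambda>v. tau b (tau a v))"
  define r' where "r' = (\<lambda>v. tau a (tau b v))"
  have r_r': "r (r' v) = v" "r' (r v) = v" for v by (simp_all add: r_def r'_def tau_tau a b)
  have aut: "automorphism r" "automorphism r'"
    using automorphism_comp[OF automorphism_tau automorphism_tau] a b
    by (simp_all add: r_def r'_def comp_def)
  define pw where "pw = (\<lambda>k::int. if k \<ge> 0 then r ^^ nat k else r' ^^ nat (- k))"
  have pw_Suc: "pw (k + 1) v = r (pw k v)" for k v
  proof (cases "k \<ge> 0")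
    case True
    then have "nat (k + 1) = Suc (nat k)" by simp
    then show ?thesis using True by (simp add: pw_def)
  next
    case False
    then have m: "nat (- k) = Suc (nat (- (k + 1)))" by arith
    show ?thesis
    proof (cases "k = -1")
      case True then show ?thesis by (simp add: pw_def r_r')
    next
      case False
      with \<open>\<not> 0 \<le> k\<close> m show ?thesis by (simp add: pw_def r_r')
    qed
  qed
  define c where "c = (\<lambda>i::int. pw (i div 2) (if even i then a else b))"
  have c01: "c 0 = a" "c 1 = b" by (simp_all add: c_def pw_def)
  have step: "c (i + 2) = r (c i)" for i
  proof -
    have "(i + 2) div 2 = i div 2 + 1" by simp
    then show ?thesis by (simp add: c_def pw_Suc)
  qed
  have prev: "c (i - 2) = r' (c i)" for i using step[of "i - 2"] by (simp add: r_r')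
  have ind: "R i" if "R 0" "R 1" "\<And>i. R i \<Longrightarrow> R (i + 2)" "\<And>i. R i \<Longrightarrow> R (i - 2)" for R and i :: int
  proof -
    have "R (2 * k) \<and> R (2 * k + 1)" for k
    proof (induction k rule: int_induct[of _ 0])
      case base then show ?case using that by simp
    next
      case (step1 i)
      then show ?case using that(3)[of "2 * i"] that(3)[of "2 * i + 1"] by (simp add: algebra_simps)
    next
      case (step2 i)
      then show ?case using that(4)[of "2 * i"] that(4)[of "2 * i + 1"] by (simp add: algebra_simps)
    qed
    moreover have "i = 2 * (i div 2) \<or> i = 2 * (i div 2) + 1" by presburger
    ultimately show ?thesis by metis
  qed
  have t0: "tau a (c i) = c (- i)" for i
  proof (induction i rule: ind)
    case 1 then show ?case by (simp add: c01 tau_eigen a)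
  next
    case 2
    have "c (- 1) = r' (c 1)" using prev[of 1] by simp
    then show ?case by (simp add: c01 r'_def tau_eigen b)
  next
    case (3 i)
    have "tau a (r (c i)) = r' (tau a (c i))" by (simp add: r_def r'_def)
    then show ?case using 3 prev[of "- i"] by (simp add: step algebra_simps)
  next
    case (4 i)
    have "tau a (r' (c i)) = r (tau a (c i))" by (simp add: r_def r'_def tau_tau a)
    then show ?case using 4 step[of "- i"] by (simp add: prev algebra_simps)
  qed
  have t1: "tau b (c i) = c (2 - i)" for i
  proof -
    have "tau b (c i) = r (tau a (c i))" by (simp add: r_def tau_tau a)
    then show ?thesis using step[of "- i"] by (simp add: t0)
  qed
  have "axis (c i) \<and> (\<forall>j. tau (c i) (c j) = c (2 * i - j))" for i
  proof (induction i rule: ind)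
    case 1 then show ?case by (simp add: c01 a t0)
  next
    case 2 then show ?case by (simp add: c01 b t1)
  next
    case (3 i)
    have "tau (r (c i)) (c j) = c (2 * (i + 2) - j)" for j
    proof -
      have "tau (r (c i)) (r (c (j - 2))) = r (tau (c i) (c (j - 2)))"
        using aut_lam_tau(2)[OF aut(1)] 3 by blast
      also have "\<dots> = c (2 * i - (j - 2) + 2)" using 3 by (simp flip: step)
      also have "2 * i - (j - 2) + 2 = 2 * (i + 2) - j" by simp
      finally show ?thesis using step[of "j - 2"] by simp
    qed
    then show ?case using 3 aut_axis[OF aut(1)] by (simp add: step)
  next
    case (4 i)
    have "tau (r' (c i)) (c j) = c (2 * (i - 2) - j)" for j
    proof -
      have "tau (r' (c i)) (r' (c (j + 2))) = r' (tau (c i) (c (j + 2)))"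
        using aut_lam_tau(2)[OF aut(2)] 4 by blast
      also have "\<dots> = c (2 * i - (j + 2) - 2)" using 4 by (simp flip: prev)
      also have "2 * i - (j + 2) - 2 = 2 * (i - 2) - j" by simp
      finally show ?thesis using prev[of "j + 2"] by simp
    qed
    then show ?case using 4 aut_axis[OF aut(2)] by (simp add: prev)
  qed
  then show ?thesis using c01 unfolding dihedral_def by blast
qed

lemma sg_reindex: "sg (\<lambda>i. c (k + m * i)) n i = sg c (m * n) (k + m * i)"
  by (simp add: sg_def algebra_simps)

end

locale dihedral_axes = char_0_algebra scale mult
  for scale :: "'f::field_char_0 \<Rightarrow> 'v::ab_group_add \<Rightarrow> 'v" (infixr \<open>*s\<close> 75)
    and mult :: "'v \<Rightarrow> 'v \<Rightarrow> 'v" (infixl \<open>\<cdot>\<close> 70) +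
  fixes c :: "int \<Rightarrow> 'v"
  assumes dihedral: "dihedral c"
begin

lemma axis_c: "axis (c i)" and tau_c: "tau (c i) (c j) = c (2 * i - j)"
  using dihedral by (auto simp: dihedral_def)

lemma idem_c [simp]: "c i \<cdot> c i = c i"
  using axis_idem[OF axis_c] .

lemma reindex: "dihedral_axes scale mult (\<lambda>i. c (k + m * i))"
  by unfold_locales (rule dihedral_reindex[OF dihedral])

lemma lam_reflect: "lam (c i) (c (2 * i - j)) = lam (c i) (c j)"
  using lam_tau[OF axis_c, of i "c j"] by (simp add: tau_c)

text \<open>The involution of \<open>c (i + 1)\<close> maps \<open>c i\<close> to \<open>c (i + 2)\<close>. An automorphism that shifts by one
  need not exist, so \<open>lam (c i) (c j)\<close> depends on \<open>j - i\<close> and the parity of \<open>i\<close>.\<close>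

lemma lam_shift: "lam (c (i + 2)) (c (j + 2)) = lam (c i) (c j)"
proof -
  have "lam (tau (c (i + 1)) (c i)) (tau (c (i + 1)) (c (2 * i - j))) = lam (c i) (c (2 * i - j))"
    by (rule aut_lam_tau(1)[OF automorphism_tau[OF axis_c] axis_c])
  moreover have "2 * (i + 1) - (2 * i - j) = j + 2" "2 * (i + 1) - i = i + 2" by simp_all
  ultimately show ?thesis by (simp only: tau_c lam_reflect)
qed

lemma lam_shift_even: "lam (c (2 * k + i)) (c (2 * k + j)) = lam (c i) (c j)"
proof (induction k rule: int_induct[of _ 0])
  case base then show ?case by simp
next
  case (step1 k) then show ?case using lam_shift[of "2 * k + i" "2 * k + j"]
      by (simp add: algebra_simps)
next
  case (step2 k)
  then show ?case using lam_shift[of "2 * (k - 1) + i" "2 * (k - 1) + j"]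
      by (simp add: algebra_simps)
qed

text \<open>The vectors \<open>c i\<close> and \<open>c (i + 2 * n)\<close> are exchanged by the involution of \<open>c (i + n)\<close>, so their
  difference is a 1/32-eigenvector of \<open>c (i + n)\<close>.\<close>

lemma sg_shift: "sg c n (i + n) = sg c n i"
proof -
  have "c (i + n) \<cdot> c (i + n + n) - c (i + n) \<cdot> c i = (1/32) *s (c (i + n + n) - c i)"
    using mult_diff_tau[OF axis_c, of "i + n" "c (i + n + n)"] by (simp add: tau_c algebra_simps)
  then show ?thesis by (simp add: sg_def mult_commute[of "c i"] algebra_simps eq_diff_eq diff_eq_eq)
qed

lemma sg_shift_mult: "sg c n (i + k * n) = sg c n i"
proof (induction k rule: int_induct[of _ 0])
  case base then show ?case by simp
next
  case (step1 k) then show ?case using sg_shift[of n "i + k * n"] by (simp add: algebra_simps)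
next
  case (step2 k) then show ?case using sg_shift[of n "i + (k - 1) * n"] by (simp add: algebra_simps)
qed

lemma sg_cong: "i mod n = j mod n \<Longrightarrow> sg c n i = sg c n j"
  using sg_shift_mult[of n j "i div n - j div n"]
  by (metis add_diff_cancel_left' add.commute diff_add_cancel div_mult_mod_eq left_diff_distrib
      add_diff_eq)

lemma mult_c: "c i \<cdot> c (i + n) = sg c n i + (1/32) *s (c i + c (i + n))"
  by (simp add: sg_def)

text \<open>The vector \<open>P n\<close> is fixed by the involution of \<open>c 0\<close>; the two eigenvectors are its components,
  and their sum with \<open>(2 * lam (c 0) (c n)) *s c 0\<close> is \<open>P n\<close>.\<close>

lemma eigenvectors:
  defines "P \<equiv> \<lambda>n. c n + c (- n)"
  shows "8 *s sg c n 0 + (1/8) *s P n + (1/4 - 8 * lam (c 0) (c n)) *s c 0 \<in> eigenspace (c 0) (1/4)"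
    and "(7/8) *s P n - 8 *s sg c n 0 + (6 * lam (c 0) (c n) - 1/4) *s c 0 \<in> eigenspace (c 0) 0"
proof -
  let ?l = "lam (c 0) (c n)"
  have fixed: "tau (c 0) (P n) = P n"
    by (simp add: P_def tau_add[OF axis_c] tau_c add.commute)
  have l: "lam (c 0) (P n) = 2 * ?l"
    using lam_reflect[of 0 n] by (simp add: P_def functional_simps[OF lam_functional[OF axis_c]])
  have "c 0 \<cdot> c (- n) = sg c n 0 + (1/32) *s (c 0 + c (- n))"
    using sg_shift[of n "- n"] by (simp add: sg_def mult_commute algebra_simps)
  then have m: "c 0 \<cdot> P n = 2 *s sg c n 0 + (1/32) *s (2 *s c 0 + P n)"
    using mult_c[of 0 n] by (intro vec_eqI)
        (simp add: P_def mult_linear functional_simps field_simps)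
  have "4 *s (c 0 \<cdot> P n - lam (c 0) (P n) *s c 0)
      = 8 *s sg c n 0 + (1/8) *s P n + (1/4 - 8 * ?l) *s c 0"
    unfolding m l by (intro vec_eqI) (simp add: functional_simps field_simps)
  moreover from this have "P n - lam (c 0) (P n) *s c 0 - 4 *s (c 0 \<cdot> P n - lam (c 0) (P n) *s c 0)
      = (7/8) *s P n - 8 *s sg c n 0 + (6 * ?l - 1/4) *s c 0"
    unfolding l by (intro vec_eqI) (simp add: functional_simps field_simps)
  ultimately show
    "8 *s sg c n 0 + (1/8) *s P n + (1/4 - 8 * ?l) *s c 0 \<in> eigenspace (c 0) (1/4)"
    "(7/8) *s P n - 8 *s sg c n 0 + (6 * ?l - 1/4) *s c 0 \<in> eigenspace (c 0) 0"
    using fixed_parts[OF axis_c fixed] by (simp_all only:)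
qed

text \<open>The 1/4-eigenvector of the preceding lemma contains \<open>sg c n 0\<close> with coefficient 8, and the
  products of \<open>c 0\<close> with its other terms are known. So its eigenvector equation can be solved
  for \<open>c 0 \<cdot> sg c n 0\<close>.\<close>

lemma axis_mult_sg_0:
  "c 0 \<cdot> sg c n 0 = (3/4 * lam (c 0) (c n) - 25/1024) *s c 0 + (7/32) *s sg c n 0
      + (7/2048) *s (c n + c (- n))"
proof -
  have m2: "c 0 \<cdot> c (- n) = sg c n 0 + (1/32) *s (c 0 + c (- n))"
    using sg_shift[of n "- n"] by (simp add: sg_def mult_commute algebra_simps)
  have m1: "c 0 \<cdot> c n = sg c n 0 + (1/32) *s (c 0 + c n)" using mult_c[of 0 n] by simp
  define v where "v = 8 *s sg c n 0 + (1/8) *s (c n + c (- n)) + (1/4 - 8 * lam (c 0) (c n)) *s c 0"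
  have "c 0 \<cdot> v = (1/4) *s v" using eigenspaceD[OF eigenvectors(1)[of n]] by (simp add: v_def)
  then have "(1/8) *s (c 0 \<cdot> v - (1/4) *s v) = 0" by simp
  then show ?thesis
    by (rule vec_eq_by) (simp add: v_def mult_linear m1 m2 functional_simps field_simps)
qed

lemma axis_mult_sg:
  "c i \<cdot> sg c n i = (3/4 * lam (c i) (c (i + n)) - 25/1024) *s c i + (7/32) *s sg c n i
     + (7/2048) *s (c (i + n) + c (i - n))"
proof -
  interpret sh: dihedral_axes scale mult "\<lambda>j. c (i + 1 * j)" by (rule reindex)
  show ?thesis using sh.axis_mult_sg_0[of n] sg_reindex[of c i 1 n 0] by simp
qed

lemma lam_sg: "lam (c 0) (sg c n 0) = 31/32 * lam (c 0) (c n) - 1/32"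
proof -
  note fs = functional_simps[OF lam_functional[OF axis_c]]
  show ?thesis
    using lam_mult[OF axis_c, of 0 "c n"] lam_eigen(1)[OF axis_c, of 0]
        by (simp add: sg_def fs field_simps)
qed

end

section \<open>Products determined by axes at distance one\<close>

text \<open>In this function and all similar ones below, \<open>x, y, z, t\<close> stand for the four parameters
  \<open>\<xi>, \<eta>, \<zeta>, \<theta>\<close> of a dihedral sequence. Exchanging \<open>x\<close> with \<open>y\<close> and \<open>z\<close> with \<open>t\<close> corresponds to a
  shift of the sequence by one. The value of \<open>gram11\<close> is \<open>lam (c 0) (V\<^sub>1 \<cdot> V\<^sub>1)\<close>.\<close>

definition gram11 :: "'f::field_char_0 \<Rightarrow> 'f \<Rightarrow> 'f \<Rightarrow> 'f" where
  "gram11 x y z = - 124/7 * x^2 + 96/7 * x * y + 4 * x + 1/16 * z - 1/16"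

lemmas ring_nf = algebra_simps diff_divide_distrib add_divide_distrib power2_eq_square
    power3_eq_cube

context char_0_algebra
begin

text \<open>The value of the product of \<open>a = c 0\<close> with \<open>e'\<close> (lemma \<open>axis_e'\<close>), where \<open>p = c 1 + c (- 1)\<close>
  and \<open>q = c 2 + c (- 2)\<close>.\<close>

definition cross_product :: "'f \<Rightarrow> 'f \<Rightarrow> 'f \<Rightarrow> 'v \<Rightarrow> 'v \<Rightarrow> 'v \<Rightarrow> 'v \<Rightarrow> 'v \<Rightarrow> 'v" where
  "cross_product x y z a p q s e = (1/43008) *s
     ((- 65536 * x^2 - 393216 * x * y + 50176 * x + 21504 * y - 1792 * z - 1778) *s a
      + (- 229376 * x + 688128 * y - 17024) *s s
      + (- 3584 * x + 10752 * y - 266) *s p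
      + 3136 *s e + 49 *s q)"

text \<open>The value of \<open>s \<cdot> s\<close> computed at the axis \<open>a = c 0\<close> (lemma \<open>s_s\<close>), with \<open>p\<close>
    and \<open>q\<close> as before.\<close>

definition sg_square :: "'f \<Rightarrow> 'f \<Rightarrow> 'f \<Rightarrow> 'v \<Rightarrow> 'v \<Rightarrow> 'v \<Rightarrow> 'v \<Rightarrow> 'v \<Rightarrow> 'v \<Rightarrow> 'v" where
  "sg_square x y z a p q s e e' = (1/196608) *s
     ((114688 * x - 196608 * y - 1664) *s s
      + (32768 * x^2 + 196608 * x * y + 2560 * x - 6144 * y + 896 * z - 14) *s a
      + (1792 * x + 10752 * y - 245) *s p
      - 896 *s e + 49 *s q + 672 *s e')"

end

context dihedral_axes
begin

text \<open>Since \<open>lam\<close> is not assumed to come from a symmetric bilinear form, \<open>\<xi>\<close> and \<open>\<eta>\<close> have to be kept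
  apart; the parity of the base point likewise distinguishes \<open>\<zeta>\<close> from \<open>\<theta>\<close> and \<open>e\<close> from \<open>e'\<close>.\<close>

definition \<xi> :: 'f where "\<xi> = lam (c 0) (c 1)"
definition \<eta> :: 'f where "\<eta> = lam (c 1) (c 0)"
definition \<zeta> :: 'f where "\<zeta> = lam (c 0) (c 2)"
definition \<theta> :: 'f where "\<theta> = lam (c 1) (c 3)"

abbreviation s :: 'v where "s \<equiv> sg c 1 0"
abbreviation e :: 'v where "e \<equiv> sg c 2 0"
abbreviation e' :: 'v where "e' \<equiv> sg c 2 1"

lemma lam_parity:
  "even i \<Longrightarrow> lam (c i) (c j) = lam (c 0) (c (j - i))"
  "odd i \<Longrightarrow> lam (c i) (c j) = lam (c 1) (c (j - i + 1))"
proof -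
  show "lam (c i) (c j) = lam (c 0) (c (j - i))" if "even i"
  proof -
    obtain k where "i = 2 * k" using \<open>even i\<close> by (elim evenE)
    then show ?thesis using lam_shift_even[of k 0 "j - 2 * k"] by simp
  qed
  show "lam (c i) (c j) = lam (c 1) (c (j - i + 1))" if "odd i"
  proof -
    obtain k where "i = 2 * k + 1" using \<open>odd i\<close> by (elim oddE)
    then show ?thesis using lam_shift_even[of k 1 "j - 2 * k"] by simp
  qed
qed

lemma lam_neg: "lam (c 0) (c (- j)) = lam (c 0) (c j)" "lam (c 1) (c (2 - j)) = lam (c 1) (c j)"
  using lam_reflect[of 0 j] lam_reflect[of 1 j] by simp_all

lemma lam_values:
  "lam (c 0) (c 1) = \<xi>" "lam (c 0) (c (- 1)) = \<xi>" "lam (c 1) (c 0) = \<eta>" "lam (c 1) (c 2) = \<eta>"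
  "lam (c 0) (c 2) = \<zeta>" "lam (c 0) (c (- 2)) = \<zeta>" "lam (c 1) (c 3) = \<theta>" "lam (c 1) (c (- 1)) = \<theta>"
  "lam (c 0) (c 0) = 1" "lam (c 1) (c 1) = 1"
  using lam_neg(1)[of 1] lam_neg(2)[of 0] lam_neg(1)[of 2] lam_neg(2)[of "3"]
    lam_eigen(1)[OF axis_c, of 0] lam_eigen(1)[OF axis_c, of 1]
  by (simp_all add: \<xi>_def \<eta>_def \<zeta>_def \<theta>_def)

lemma sg_1: "sg c 1 i = s" by (rule sg_cong) simp

lemma sg_2: "even i \<Longrightarrow> sg c 2 i = e" "odd i \<Longrightarrow> sg c 2 i = e'"
  using sg_shift_mult[of 2 0] sg_shift_mult[of 2 1]
  by (auto elim!: evenE oddE simp: algebra_simps)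

lemma sg_neg: "sg c (- n) i = sg c n (i - n)"
  by (simp add: sg_def mult_commute add.commute)

lemma mult_1: "c i \<cdot> c (i + 1) = s + (1/32) *s (c i + c (i + 1))"
  using mult_c[of i 1] by (simp only: sg_1[of i])

lemma mult_2:
  "even i \<Longrightarrow> c i \<cdot> c (i + 2) = e + (1/32) *s (c i + c (i + 2))"
  "odd i \<Longrightarrow> c i \<cdot> c (i + 2) = e' + (1/32) *s (c i + c (i + 2))"
  using mult_c[of i 2] by (simp_all add: sg_2[of i])

lemma axis_axis:
  "c 0 \<cdot> c 1 = s + (1/32) *s (c 0 + c 1)" "c 0 \<cdot> c (- 1) = s + (1/32) *s (c 0 + c (- 1))"
  "c 0 \<cdot> c 2 = e + (1/32) *s (c 0 + c 2)" "c 0 \<cdot> c (- 2) = e + (1/32) *s (c 0 + c (- 2))"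
  "c 1 \<cdot> c 0 = s + (1/32) *s (c 0 + c 1)" "c 1 \<cdot> c 2 = s + (1/32) *s (c 1 + c 2)"
  "c 1 \<cdot> c 3 = e' + (1/32) *s (c 1 + c 3)" "c 1 \<cdot> c (- 1) = e' + (1/32) *s (c 1 + c (- 1))"
  "c (- 1) \<cdot> c 0 = s + (1/32) *s (c 0 + c (- 1))"
      "c (- 1) \<cdot> c (- 2) = s + (1/32) *s (c (- 1) + c (- 2))"
  "c (- 1) \<cdot> c 1 = e' + (1/32) *s (c 1 + c (- 1))"
  "c (- 1) \<cdot> c (- 3) = e' + (1/32) *s (c (- 1) + c (- 3))"
  using mult_1[of 0] mult_1[of "-1"] mult_1[of "1"] mult_1[of "-2"]
    mult_2[of 0] mult_2[of 1] mult_2[of "-1"] mult_2[of "-2"] mult_2[of "-3"]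
  by (simp_all add: mult_commute[of "c 1" "c 0"] mult_commute[of "c (- 1)" "c 0"]
      mult_commute[of "c (- 1)" "c 1"]
      mult_commute[of "c (- 2)" "c 0"] mult_commute[of "c (- 2)" "c (- 1)"]
          mult_commute[of "c (- 3)" "c (- 1)"]
      add.commute)

lemma axis_s:
  "even i \<Longrightarrow> c i \<cdot> s = (3/4 * \<xi> - 25/1024) *s c i + (7/32) *s s
      + (7/2048) *s (c (i + 1) + c (i - 1))"
  "odd i \<Longrightarrow> c i \<cdot> s = (3/4 * \<eta> - 25/1024) *s c i + (7/32) *s s + (7/2048) *s (c (i + 1) + c (i - 1))"
  using axis_mult_sg[of i 1] by (simp_all add: lam_parity sg_1[of i] lam_values)

lemma s_axis:
  "even i \<Longrightarrow> s \<cdot> c i = (3/4 * \<xi> - 25/1024) *s c i + (7/32) *s s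
      + (7/2048) *s (c (i + 1) + c (i - 1))"
  "odd i \<Longrightarrow> s \<cdot> c i = (3/4 * \<eta> - 25/1024) *s c i + (7/32) *s s + (7/2048) *s (c (i + 1) + c (i - 1))"
  using axis_s[of i] by (simp_all add: mult_commute)

lemma axis_e:
  "even i \<Longrightarrow> c i \<cdot> e = (3/4 * \<zeta> - 25/1024) *s c i + (7/32) *s e
      + (7/2048) *s (c (i + 2) + c (i - 2))"
  "odd i \<Longrightarrow> c i \<cdot> e' = (3/4 * \<theta> - 25/1024) *s c i + (7/32) *s e'
      + (7/2048) *s (c (i + 2) + c (i - 2))"
  using axis_mult_sg[of i 2] by (simp_all add: lam_parity sg_2[of i] lam_values)

lemma lam_sgs:
  "lam (c 0) s = 31/32 * \<xi> - 1/32" "lam (c 0) e = 31/32 * \<zeta> - 1/32"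
  using lam_sg[of 1] lam_sg[of 2] by (simp_all add: lam_values)

text \<open>The eigenvectors of \<open>c 0\<close> for the eigenvalues 1/4 (\<open>V\<close>) and 0 (\<open>U\<close>) that are the components of
  \<open>c 1 + c (- 1)\<close> and of \<open>c 2 + c (- 2)\<close>.\<close>

definition V\<^sub>1 :: 'v where "V\<^sub>1 = 8 *s s + (1/8) *s (c 1 + c (- 1)) + (1/4 - 8 * \<xi>) *s c 0"
definition U\<^sub>1 :: 'v where "U\<^sub>1 = (7/8) *s (c 1 + c (- 1)) - 8 *s s + (6 * \<xi> - 1/4) *s c 0"
definition V\<^sub>2 :: 'v where "V\<^sub>2 = 8 *s e + (1/8) *s (c 2 + c (- 2)) + (1/4 - 8 * \<zeta>) *s c 0"
definition U\<^sub>2 :: 'v where "U\<^sub>2 = (7/8) *s (c 2 + c (- 2)) - 8 *s e + (6 * \<zeta> - 1/4) *s c 0"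

lemma UV_eigen:
  "V\<^sub>1 \<in> eigenspace (c 0) (1/4)" "U\<^sub>1 \<in> eigenspace (c 0) 0"
  "V\<^sub>2 \<in> eigenspace (c 0) (1/4)" "U\<^sub>2 \<in> eigenspace (c 0) 0"
  using eigenvectors[of 1] eigenvectors[of 2]
  by (simp_all only: V\<^sub>1_def U\<^sub>1_def V\<^sub>2_def U\<^sub>2_def lam_values)

lemma UV_sum: "U\<^sub>1 = c 1 + c (- 1) - (2 * \<xi>) *s c 0 - V\<^sub>1"
    "U\<^sub>2 = c 2 + c (- 2) - (2 * \<zeta>) *s c 0 - V\<^sub>2"
  by (rule vec_eqI; simp add: V\<^sub>1_def U\<^sub>1_def V\<^sub>2_def U\<^sub>2_def functional_simps field_simps)+

lemmas lam_simps = functional_simps[OF lam_functional[OF axis_c]]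

text \<open>As \<open>c 1 + c (- 1)\<close> is \<open>U\<^sub>1 + V\<^sub>1\<close> plus a multiple of \<open>c 0\<close>, its product with \<open>U\<^sub>1\<close> or \<open>V\<^sub>1\<close>
  reduces to products of eigenvectors, and \<open>lam (c 0)\<close> vanishes on all of them except
  \<open>V\<^sub>1 \<cdot> V\<^sub>1\<close>.\<close>

lemma lam_UV_sum:
  "lam (c 0) (U\<^sub>1 \<cdot> (c 1 + c (- 1))) = 0"
  "lam (c 0) (V\<^sub>1 \<cdot> (c 1 + c (- 1))) = lam (c 0) (V\<^sub>1 \<cdot> V\<^sub>1)"
proof -
  have *: "c 1 + c (- 1) = U\<^sub>1 + V\<^sub>1 + (2 * \<xi>) *s c 0" by (simp add: UV_sum)
  have "c 0 \<cdot> U\<^sub>1 = 0" "c 0 \<cdot> V\<^sub>1 = (1/4) *s V\<^sub>1" using UV_eigen by (auto dest: eigenspaceD)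
  then have m: "U\<^sub>1 \<cdot> c 0 = 0" "V\<^sub>1 \<cdot> c 0 = (1/4) *s V\<^sub>1" by (simp_all add: mult_commute)
  note f = fusion_zero_zero[OF axis_c UV_eigen(2) UV_eigen(2)]
      fusion_zero_alpha[OF axis_c UV_eigen(2) UV_eigen(1)]
  show "lam (c 0) (U\<^sub>1 \<cdot> (c 1 + c (- 1))) = 0"
    unfolding * by (simp only: mult_linear m lam_simps f) simp
  show "lam (c 0) (V\<^sub>1 \<cdot> (c 1 + c (- 1))) = lam (c 0) (V\<^sub>1 \<cdot> V\<^sub>1)"
    unfolding * using f(4) lam_eigen(3)[OF axis_c UV_eigen(1)]
    by (simp only: mult_linear m lam_simps mult_commute[of V\<^sub>1 U\<^sub>1]) simp
qed

text \<open>The product of \<open>c 1\<close> and \<open>c (- 1)\<close> is \<open>e'\<close> up to axes, so the expansion of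
  \<open>U\<^sub>1 \<cdot> (c 1 + c (- 1))\<close> contains \<open>e'\<close>.\<close>

lemma lam_e': "lam (c 0) e' = - 48/7 * \<xi>^2 + 48/7 * \<xi> * \<eta> + 15/16 * \<xi> + 1/32 * \<zeta> - 1/32"
proof -
  have "lam (c 0) (U\<^sub>1 \<cdot> (c 1 + c (- 1))) = 0" by (rule lam_UV_sum)
  moreover have "lam (c 0) e' - (- 48/7 * \<xi>^2 + 48/7 * \<xi> * \<eta> + 15/16 * \<xi> + 1/32 * \<zeta> - 1/32)
      = (4/7) * lam (c 0) (U\<^sub>1 \<cdot> (c 1 + c (- 1)))"
    by (simp add: U\<^sub>1_def mult_linear axis_axis s_axis lam_simps lam_values lam_sgs ring_nf)
  ultimately show ?thesis by simp
qed

lemma lam_V1_V1: "lam (c 0) (V\<^sub>1 \<cdot> V\<^sub>1) = gram11 \<xi> \<eta> \<zeta>"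
  unfolding lam_UV_sum(2)[symmetric] gram11_def
  by (simp add: V\<^sub>1_def mult_linear axis_axis s_axis lam_simps lam_values lam_sgs lam_e' ring_nf)

text \<open>Multiplying \<open>U\<^sub>1 \<cdot> U\<^sub>1 - V\<^sub>1 \<cdot> V\<^sub>1\<close> by \<open>c 0\<close> leaves a known multiple of \<open>c 0\<close>. The difference
  equals \<open>(U\<^sub>1 + V\<^sub>1) \<cdot> (U\<^sub>1 - V\<^sub>1)\<close>, where the first factor is a combination of axes, so the
  square of \<open>s\<close>, still unknown, does not occur; the only unknown product in the expansion is
  \<open>c 0 \<cdot> e'\<close>.\<close>

lemma axis_e':
  "c 0 \<cdot> e' = cross_product \<xi> \<eta> \<zeta> (c 0) (c 1 + c (- 1)) (c 2 + c (- 2)) s e"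
proof -
  have "c 0 \<cdot> (U\<^sub>1 \<cdot> U\<^sub>1) = 0" "c 0 \<cdot> (V\<^sub>1 \<cdot> V\<^sub>1) = lam (c 0) (V\<^sub>1 \<cdot> V\<^sub>1) *s c 0"
    using fusion_zero_zero[OF axis_c UV_eigen(2) UV_eigen(2)]
        fusion_alpha_alpha'[OF axis_c UV_eigen(1) UV_eigen(1)] by auto
  moreover have "(c 1 + c (- 1) - (2 * \<xi>) *s c 0) \<cdot> (U\<^sub>1 - V\<^sub>1) = U\<^sub>1 \<cdot> U\<^sub>1 - V\<^sub>1 \<cdot> V\<^sub>1"
  proof -
    have "c 1 + c (- 1) - (2 * \<xi>) *s c 0 = U\<^sub>1 + V\<^sub>1" by (simp add: UV_sum)
    then show ?thesis by (simp add: mult_linear mult_commute[of V\<^sub>1 U\<^sub>1])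
  qed
  ultimately have "(2/3) *s (c 0 \<cdot> ((c 1 + c (- 1) - (2 * \<xi>) *s c 0) \<cdot> (U\<^sub>1 - V\<^sub>1))
      + lam (c 0) (V\<^sub>1 \<cdot> V\<^sub>1) *s c 0) = 0"
    by (simp add: mult_linear)
  then show ?thesis unfolding lam_V1_V1 gram11_def cross_product_def
    by (rule vec_eq_by)
      (simp add: U\<^sub>1_def V\<^sub>1_def mult_linear axis_axis s_axis axis_s axis_e functional_simps
          ring_nf)
qed

text \<open>In \<open>c 0 \<cdot> (U\<^sub>1 \<cdot> (c 1 + c (- 1))) = (1/4) *s (U\<^sub>1 \<cdot> V\<^sub>1)\<close> the left side is known by the
  preceding lemma, and the right side contains \<open>s \<cdot> s\<close>.\<close>

lemma s_s:
  "s \<cdot> s = sg_square \<xi> \<eta> \<zeta> (c 0) (c 1 + c (- 1)) (c 2 + c (- 2)) s e e'"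
proof -
  have uv: "c 0 \<cdot> (U\<^sub>1 \<cdot> U\<^sub>1) = 0" "c 0 \<cdot> (U\<^sub>1 \<cdot> V\<^sub>1) = (1/4) *s (U\<^sub>1 \<cdot> V\<^sub>1)" "c 0 \<cdot> U\<^sub>1 = 0"
    using fusion_zero_zero[OF axis_c UV_eigen(2) UV_eigen(2)]
        fusion_zero_alpha[OF axis_c UV_eigen(2) UV_eigen(1)]
      UV_eigen(2) by (auto dest: eigenspaceD)
  have "c 1 + c (- 1) = U\<^sub>1 + V\<^sub>1 + (2 * \<xi>) *s c 0" by (simp add: UV_sum)
  then have "c 0 \<cdot> (U\<^sub>1 \<cdot> (c 1 + c (- 1))) = (1/4) *s (U\<^sub>1 \<cdot> V\<^sub>1)"
    by (simp add: mult_linear uv mult_commute[of U\<^sub>1 "c 0"])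
  then have "(1/16) *s (c 0 \<cdot> (U\<^sub>1 \<cdot> (c 1 + c (- 1))) - (1/4) *s (U\<^sub>1 \<cdot> V\<^sub>1)) = 0" by simp
  then show ?thesis
    by (rule vec_eq_by)
      (simp add: U\<^sub>1_def V\<^sub>1_def mult_linear axis_axis s_axis axis_s axis_e axis_e'
        cross_product_def sg_square_def functional_simps ring_nf)
qed

end

section \<open>Axes at distance two and three, and equations between the parameters\<close>

text \<open>The values of \<open>lam (c 0)\<close> on \<open>V\<^sub>1 \<cdot> V\<^sub>2\<close> and \<open>V\<^sub>2 \<cdot> V\<^sub>2\<close>.\<close>

definition gram12 :: "'f::field_char_0 \<Rightarrow> 'f \<Rightarrow> 'f \<Rightarrow> 'f \<Rightarrow> 'f" where
  "gram12 x y z t = - 12288/49 * x^2 * y - 2048/49 * x * y^2 + 2976/7 * x^2 - 96 * x * y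
      - 124/7 * x * z - 8/7 * x * t - 16/7 * y * z - 124/7 * x + 16/7 * y - 19/112 * z + 19/112"

definition gram22 :: "'f::field_char_0 \<Rightarrow> 'f \<Rightarrow> 'f \<Rightarrow> 'f \<Rightarrow> 'f" where
  "gram22 x y z t = 3145728/343 * x^3 * y + 19398656/343 * x^2 * y^2 + 3145728/343 * x * y^3
      - 761856/49 * x^3 - 4460544/49 * x^2 * y + 22528/49 * x^2 * z + 2048/49 * x^2 * t
      + 1021952/49 * x * y^2 + 139264/49 * x * y * z + 12288/49 * x * y * t + 24576/49 * y^2 * z
      + 145120/49 * x^2 + 218144/49 * x * y - 2992/49 * x * z - 40/7 * x * t
      - 24576/49 * y^2 + 2992/49 * y * z - 36/7 * z^2 - 5688/49 * x - 2992/49 * y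
      + 61/16 * z + 149/112"

text \<open>The coefficients in the linear dependency between \<open>V\<^sub>1\<close> and \<open>V\<^sub>2\<close>.\<close>

definition dep_coeff1 :: "'f::field_char_0 \<Rightarrow> 'f \<Rightarrow> 'f \<Rightarrow> 'f \<Rightarrow> 'f" where
  "dep_coeff1 x y z t = 128/49 * x^2 - 4608/49 * x * y + 1280/7 * y^2 - 166/7 * x + 114/7 * y
      - 5/28 * z - 13/28 * t + 1/7"

definition dep_coeff2 :: "'f::field_char_0 \<Rightarrow> 'f \<Rightarrow> 'f" where
  "dep_coeff2 x y = 3/14 * x + 11/14 * y - 5/256"

text \<open>A scalar multiple of \<open>lam (c 0) (U\<^sub>2 \<cdot> (c 1 + c (- 1)))\<close>, hence zero at the parameters.\<close>

definition orth_cubic :: "'f::field_char_0 \<Rightarrow> 'f \<Rightarrow> 'f \<Rightarrow> 'f \<Rightarrow> 'f" where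
  "orth_cubic x y z t = - 2560 * x^3 - 21504 * x^2 * y + 24064 * x * y^2 - 6144 * x^2 + 6144 * x * y
      - 63 * x * z - 35 * x * t + 98 * y * z + 98 * x - 98 * y"

text \<open>The values of \<open>lam (c 0)\<close> on \<open>c 3\<close> and \<open>c 4\<close>.\<close>

definition lam_3_poly :: "'f::field_char_0 \<Rightarrow> 'f \<Rightarrow> 'f \<Rightarrow> 'f \<Rightarrow> 'f" where
  "lam_3_poly x y z t = - 196608/49 * x^2 * y - 32768/49 * x * y^2 + 47616/7 * x^2 - 1536 * x * y
      - 1536/7 * x * z - 128/7 * x * t - 256/7 * y * z - 2425/7 * x + 256/7 * y - 33/7 * z + 33/7"

definition lam_4_poly :: "'f::field_char_0 \<Rightarrow> 'f \<Rightarrow> 'f \<Rightarrow> 'f \<Rightarrow> 'f" where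
  "lam_4_poly x y z t = 50331648/343 * x^3 * y + 310378496/343 * x^2 * y^2 + 50331648/343 * x * y^3
      - 12189696/49 * x^3 - 71368704/49 * x^2 * y + 360448/49 * x^2 * z + 32768/49 * x^2 * t
      + 16351232/49 * x * y^2 + 2228224/49 * x * y * z + 196608/49 * x * y * t
      + 393216/49 * y^2 * z + 2321920/49 * x^2 + 3490304/49 * x * y - 47872/49 * x * z
      - 640/7 * x * t - 393216/49 * y^2 + 47872/49 * y * z - 128/7 * z^2 - 91008/49 * x
      - 47872/49 * y - 3 * z + 156/7"

text \<open>The coefficients of the inner and outer axes in the recurrence \<open>relation_0\<close>.\<close>

definition rel_inner :: "'f::field_char_0 \<Rightarrow> 'f \<Rightarrow> 'f \<Rightarrow> 'f" where
  "rel_inner x y z = 1/49 * (32768 * x^2 + 196608 * x * y - 8192 * x - 7936 * y + 896 * z + 231)"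

definition rel_outer :: "'f::field_char_0 \<Rightarrow> 'f \<Rightarrow> 'f" where
  "rel_outer x y = 1/7 * (256 * x + 1536 * y - 42)"

context char_0_algebra
begin

text \<open>The product of \<open>c 1\<close> and \<open>c (- 2)\<close>, obtained by multiplying the recurrence with \<open>c 1\<close>; the
  reflected product of \<open>c (- 1)\<close> and \<open>c 2\<close> has the same form.\<close>

definition distance_3_product :: "'f \<Rightarrow> 'f \<Rightarrow> 'f \<Rightarrow> 'f \<Rightarrow> 'v \<Rightarrow> 'v \<Rightarrow> 'v \<Rightarrow> 'v \<Rightarrow> 'v \<Rightarrow> 'v \<Rightarrow> 'v \<Rightarrow> 'v" where
  "distance_3_product x y z t a a\<^sub>2 a\<^sub>0 b b\<^sub>3 s e = (1/4704) *s
     ((- 98304 * x^2 - 5505024 * x * y + 25329664 * y^2 + 94464 * x - 1343488 * y - 2688 * z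
         - 33152 * t + 19082) *s a
      + (- 3145728 * x^2 - 18874368 * x * y - 2310144 * x + 6668288 * y - 86016 * z - 109984) *s s
      + (- 32256 * x + 94976 * y - 1813) *s a\<^sub>2
      + (- 98304 * x^2 - 589824 * x * y - 39936 * x + 113408 * y - 2688 * z - 1624) *s a\<^sub>0
      + (- 172032 * x - 1032192 * y + 10976) *s e
      + (- 5376 * x - 32256 * y + 539) *s b
      - 196 *s b\<^sub>3)"

end

context dihedral_axes
begin

lemma shift: "dihedral_axes scale mult (\<lambda>j. c (k + j))"
  using reindex[of k 1] by simp

lemma reverse: "dihedral_axes scale mult (\<lambda>j. c (- j))"
  using reindex[of 0 "-1"] by simp

lemma shift_even:
  assumes "even k"
  shows "dihedral_axes.\<xi> scale mult (\<lambda>j. c (k + j)) = \<xi>"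
      "dihedral_axes.\<eta> scale mult (\<lambda>j. c (k + j)) = \<eta>"
    "dihedral_axes.\<zeta> scale mult (\<lambda>j. c (k + j)) = \<zeta>"
        "dihedral_axes.\<theta> scale mult (\<lambda>j. c (k + j)) = \<theta>"
    "sg (\<lambda>j. c (k + j)) 1 0 = s" "sg (\<lambda>j. c (k + j)) 2 0 = e" "sg (\<lambda>j. c (k + j)) 2 1 = e'"
  unfolding dihedral_axes.\<xi>_def[OF shift] dihedral_axes.\<eta>_def[OF shift]
    dihedral_axes.\<zeta>_def[OF shift] dihedral_axes.\<theta>_def[OF shift]
  using assms sg_reindex[of c k 1] sg_1[of k] sg_2[of k] sg_2[of "k + 1"]
  by (simp_all add: lam_parity lam_values)

lemma shift_odd:
  assumes "odd k"
  shows "dihedral_axes.\<xi> scale mult (\<lambda>j. c (k + j)) = \<eta>"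
      "dihedral_axes.\<eta> scale mult (\<lambda>j. c (k + j)) = \<xi>"
    "dihedral_axes.\<zeta> scale mult (\<lambda>j. c (k + j)) = \<theta>"
        "dihedral_axes.\<theta> scale mult (\<lambda>j. c (k + j)) = \<zeta>"
    "sg (\<lambda>j. c (k + j)) 1 0 = s" "sg (\<lambda>j. c (k + j)) 2 0 = e'" "sg (\<lambda>j. c (k + j)) 2 1 = e"
  unfolding dihedral_axes.\<xi>_def[OF shift] dihedral_axes.\<eta>_def[OF shift]
    dihedral_axes.\<zeta>_def[OF shift] dihedral_axes.\<theta>_def[OF shift]
  using assms sg_reindex[of c k 1] sg_1[of k] sg_2[of k] sg_2[of "k + 1"]
  by (simp_all add: lam_parity lam_values)

lemma reverse_simps:
  "dihedral_axes.\<xi> scale mult (\<lambda>j. c (- j)) = \<xi>" "dihedral_axes.\<eta> scale mult (\<lambda>j. c (- j)) = \<eta>"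
  "dihedral_axes.\<zeta> scale mult (\<lambda>j. c (- j)) = \<zeta>" "dihedral_axes.\<theta> scale mult (\<lambda>j. c (- j)) = \<theta>"
  "sg (\<lambda>j. c (- j)) 1 0 = s" "sg (\<lambda>j. c (- j)) 2 0 = e" "sg (\<lambda>j. c (- j)) 2 1 = e'"
  unfolding dihedral_axes.\<xi>_def[OF reverse] dihedral_axes.\<eta>_def[OF reverse]
    dihedral_axes.\<zeta>_def[OF reverse] dihedral_axes.\<theta>_def[OF reverse]
  using sg_reindex[of c 0 "-1"] sg_1[of "-1"] sg_2[of "-2"] sg_2[of "-3"]
  by (simp_all add: lam_parity lam_values sg_neg)

lemma axis_other_e:
  "even i \<Longrightarrow> c i \<cdot> e' = cross_product \<xi> \<eta> \<zeta> (c i) (c (i + 1) + c (i - 1)) (c (i + 2) + c (i - 2)) s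
      e"
  "odd i \<Longrightarrow> c i \<cdot> e = cross_product \<eta> \<xi> \<theta> (c i) (c (i + 1) + c (i - 1)) (c (i + 2) + c (i - 2)) s e'"
proof -
  interpret d: dihedral_axes scale mult "\<lambda>j. c (i + j)" by (rule shift)
  show "c i \<cdot> e' = cross_product \<xi> \<eta> \<zeta> (c i) (c (i + 1) + c (i - 1)) (c (i + 2) + c (i - 2)) s e"
      if "even i"
    using d.axis_e'[unfolded shift_even[OF that]] by simp
  show "c i \<cdot> e = cross_product \<eta> \<xi> \<theta> (c i) (c (i + 1) + c (i - 1)) (c (i + 2) + c (i - 2)) s e'"
      if "odd i"
    using d.axis_e'[unfolded shift_odd[OF that]] by simp
qed

text \<open>The vector \<open>s\<close> is invariant under the shift by one, so \<open>s_s\<close> applies both to the sequence and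
  to its shift. The two values of \<open>s \<cdot> s\<close> involve \<open>c (- 2), \<dots>, c 2\<close> and \<open>c (- 1), \<dots>, c 3\<close>; their
  equality can be solved for \<open>c 3\<close>.\<close>

lemma relation_0:
  "c 3 = c (- 2) + rel_outer \<xi> \<eta> *s (c (- 1)) - rel_outer \<eta> \<xi> *s (c 2)
     + rel_inner \<xi> \<eta> \<zeta> *s (c 0) - rel_inner \<eta> \<xi> \<theta> *s (c 1) + (311296/49 * (\<xi> - \<eta>)) *s s
         - 32 *s (e - e')"
proof -
  interpret d: dihedral_axes scale mult "\<lambda>j. c (1 + j)" by (rule shift)
  have "s \<cdot> s = sg_square \<eta> \<xi> \<theta> (c 1) (c 2 + c 0) (c 3 + c (- 1)) s e' e"
    using d.s_s[unfolded shift_odd[OF odd_one]] by simp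
  then have "(196608/49) *s (sg_square \<eta> \<xi> \<theta> (c 1) (c 2 + c 0) (c 3 + c (- 1)) s e' e
      - sg_square \<xi> \<eta> \<zeta> (c 0) (c 1 + c (- 1)) (c 2 + c (- 2)) s e e') = 0"
    using s_s by simp
  then show ?thesis
    by (rule vec_eq_by) (simp add: sg_square_def rel_inner_def rel_outer_def functional_simps
        ring_nf)
qed

lemma relation_reverse:
  "c (- 3) = c 2 + rel_outer \<xi> \<eta> *s (c 1) - rel_outer \<eta> \<xi> *s (c (- 2))
     + rel_inner \<xi> \<eta> \<zeta> *s (c 0) - rel_inner \<eta> \<xi> \<theta> *s (c (- 1)) + (311296/49 * (\<xi> - \<eta>)) *s s
         - 32 *s (e - e')"
proof -
  interpret d: dihedral_axes scale mult "\<lambda>j. c (- j)" by (rule reverse)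
  show ?thesis using d.relation_0[unfolded reverse_simps] by simp
qed

lemma relation_4:
  "c 4 = c (- 1) + rel_outer \<eta> \<xi> *s (c 0) - rel_outer \<xi> \<eta> *s (c 3)
     + rel_inner \<eta> \<xi> \<theta> *s (c 1) - rel_inner \<xi> \<eta> \<zeta> *s (c 2) + (311296/49 * (\<eta> - \<xi>)) *s s
         - 32 *s (e' - e)"
proof -
  interpret d: dihedral_axes scale mult "\<lambda>j. c (1 + j)" by (rule shift)
  show ?thesis using d.relation_0[unfolded shift_odd[OF odd_one]] by simp
qed

lemma axis_axis_3_pos:
  "c 1 \<cdot> c (- 2) = distance_3_product \<xi> \<eta> \<zeta> \<theta> (c 1) (c 2) (c 0) (c (- 1)) (c 3) s e'"
proof -
  have "c 1 \<cdot> (c (- 2) + rel_outer \<xi> \<eta> *s (c (- 1)) - rel_outer \<eta> \<xi> *s (c 2)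
     + rel_inner \<xi> \<eta> \<zeta> *s (c 0) - rel_inner \<eta> \<xi> \<theta> *s (c 1) + (311296/49 * (\<xi> - \<eta>)) *s s
         - 32 *s (e - e') - c 3) = 0" using relation_0 by simp
  then show "c 1 \<cdot> c (- 2) = distance_3_product \<xi> \<eta> \<zeta> \<theta> (c 1) (c 2) (c 0) (c (- 1)) (c 3) s e'"
    by (rule vec_eq_by)
      (simp add: mult_linear axis_axis axis_s axis_e axis_other_e cross_product_def
          distance_3_product_def
        rel_inner_def rel_outer_def functional_simps ring_nf)
qed

lemma axis_axis_3_neg:
  "c (- 1) \<cdot> c 2 = distance_3_product \<xi> \<eta> \<zeta> \<theta> (c (- 1)) (c (- 2)) (c 0) (c 1) (c (- 3)) s e'"
proof -
  interpret d: dihedral_axes scale mult "\<lambda>j. c (- j)" by (rule reverse)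
  show ?thesis using d.axis_axis_3_pos[unfolded reverse_simps] by simp
qed

lemmas axis_axis_3 = axis_axis_3_pos axis_axis_3_neg

lemmas product_rules = mult_linear mult_commute[of e] mult_commute[of "c 2" "c 1"]
    mult_commute[of "c 2" "c (- 1)"]
  mult_commute[of "c (- 2)" "c 1"] mult_commute[of "c (- 2)" "c (- 1)"]
  axis_axis axis_axis_3 axis_other_e axis_s s_axis axis_e cross_product_def distance_3_product_def

text \<open>The analogue of \<open>lam_UV_sum\<close> for the second pair of eigenvectors.\<close>

lemma lam_U2_P: "lam (c 0) (U\<^sub>2 \<cdot> (c 1 + c (- 1))) = 0"
  and lam_V2_P: "lam (c 0) (V\<^sub>2 \<cdot> (c 1 + c (- 1))) = lam (c 0) (V\<^sub>1 \<cdot> V\<^sub>2)"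
proof -
  have *: "c 1 + c (- 1) = U\<^sub>1 + V\<^sub>1 + (2 * \<xi>) *s c 0" by (simp add: UV_sum)
  have "c 0 \<cdot> U\<^sub>2 = 0" "c 0 \<cdot> V\<^sub>2 = (1/4) *s V\<^sub>2" using UV_eigen by (auto dest: eigenspaceD)
  then have m: "U\<^sub>2 \<cdot> c 0 = 0" "V\<^sub>2 \<cdot> c 0 = (1/4) *s V\<^sub>2" by (simp_all add: mult_commute)
  note f = fusion_zero_zero[OF axis_c UV_eigen(4) UV_eigen(2)]
      fusion_zero_alpha[OF axis_c UV_eigen(4) UV_eigen(1)]
    fusion_zero_alpha[OF axis_c UV_eigen(2) UV_eigen(3)]
  show "lam (c 0) (U\<^sub>2 \<cdot> (c 1 + c (- 1))) = 0"
    unfolding * by (simp only: mult_linear m lam_simps f) simp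
  show "lam (c 0) (V\<^sub>2 \<cdot> (c 1 + c (- 1))) = lam (c 0) (V\<^sub>1 \<cdot> V\<^sub>2)"
    unfolding * using f(6) lam_eigen(3)[OF axis_c UV_eigen(3)]
    by (simp only: mult_linear m lam_simps mult_commute[of V\<^sub>2 U\<^sub>1] mult_commute[of V\<^sub>2 V\<^sub>1]) simp
qed

lemma lam_3: "lam (c 0) (c 3) = lam_3_poly \<xi> \<eta> \<zeta> \<theta>" "lam (c 0) (c (- 3)) = lam_3_poly \<xi> \<eta> \<zeta> \<theta>"
  using lam_neg(1)[of 3]
  by (simp_all add: relation_0 rel_inner_def rel_outer_def lam_3_poly_def lam_simps lam_values
      lam_sgs lam_e' ring_nf)

lemma lam_4: "lam (c 0) (c 4) = lam_4_poly \<xi> \<eta> \<zeta> \<theta>"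
  by (simp add: relation_4 rel_inner_def rel_outer_def lam_3 lam_3_poly_def lam_4_poly_def
      lam_simps lam_values lam_sgs lam_e' ring_nf)

lemma param_equation: "orth_cubic \<xi> \<eta> \<zeta> \<theta> = 0"
proof -
  have "orth_cubic \<xi> \<eta> \<zeta> \<theta> = (7/2) * lam (c 0) (U\<^sub>2 \<cdot> (c 1 + c (- 1)))"
    by (simp add: orth_cubic_def U\<^sub>2_def product_rules lam_simps lam_values lam_sgs lam_e' lam_3
        lam_3_poly_def ring_nf)
  then show ?thesis using lam_U2_P by simp
qed

text \<open>Both \<open>lam (c 0) (V\<^sub>2 \<cdot> (c 1 + c (- 1)))\<close> and the same value plus any multiple of the zero
  \<open>lam (c 0) (U\<^sub>2 \<cdot> (c 1 + c (- 1)))\<close> compute the scalar; the multiple is chosen so that the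
  terms in \<open>c 2 + c (- 2)\<close> cancel, which keeps \<open>gram12\<close> small.\<close>

lemma lam_V1_V2: "lam (c 0) (V\<^sub>1 \<cdot> V\<^sub>2) = gram12 \<xi> \<eta> \<zeta> \<theta>"
proof -
  have "gram12 \<xi> \<eta> \<zeta> \<theta> = lam (c 0) (V\<^sub>2 \<cdot> (c 1 + c (- 1))) - (1/7) * lam (c 0)
      (U\<^sub>2 \<cdot> (c 1 + c (- 1)))"
    by (simp add: gram12_def U\<^sub>2_def V\<^sub>2_def product_rules lam_simps lam_values lam_sgs lam_e' lam_3
        lam_3_poly_def ring_nf)
  then show ?thesis using lam_U2_P lam_V2_P by simp
qed

text \<open>The even members form a dihedral sequence of their own, whose first 1/4-eigenvector is \<open>V\<^sub>2\<close>.
  So \<open>gram11\<close> at the parameters of that sequence gives the value.\<close>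

lemma lam_V2_V2: "lam (c 0) (V\<^sub>2 \<cdot> V\<^sub>2) = gram22 \<xi> \<eta> \<zeta> \<theta>"
proof -
  have d: "dihedral_axes scale mult (\<lambda>j. c (2 * j))" using reindex[of 0 2] by simp
  interpret d: dihedral_axes scale mult "\<lambda>j. c (2 * j)" by (rule d)
  have p: "d.\<xi> = \<zeta>" "d.\<eta> = \<zeta>" "d.\<zeta> = lam_4_poly \<xi> \<eta> \<zeta> \<theta>"
    using lam_parity(1)[of 2 0] by (simp_all add: d.\<xi>_def d.\<eta>_def d.\<zeta>_def lam_values lam_4)
  have "d.V\<^sub>1 = V\<^sub>2" unfolding d.V\<^sub>1_def V\<^sub>2_def p using sg_reindex[of c 0 2 1 0] by simp
  then show ?thesis using d.lam_V1_V1 unfolding p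
      by (simp add: gram11_def gram22_def lam_4_poly_def ring_nf)
qed

definition \<gamma>\<^sub>1 :: 'f where "\<gamma>\<^sub>1 = dep_coeff1 \<xi> \<eta> \<zeta> \<theta>"
definition \<gamma>\<^sub>2 :: 'f where "\<gamma>\<^sub>2 = dep_coeff2 \<xi> \<eta>"

text \<open>Multiplication by \<open>c 0\<close> on the span of \<open>c 0\<close>, \<open>c 1 + c (- 1)\<close>, \<open>c 2 + c (- 2)\<close>, \<open>s\<close>, \<open>e\<close>,
  \<open>e'\<close>, which is fixed by the involution of \<open>c 0\<close>; its image lies in the span of the first five
  vectors.\<close>

lemma axis_mult_combination:
  "c 0 \<cdot> (k\<^sub>0 *s c 0 + k\<^sub>1 *s (c 1 + c (- 1)) + k\<^sub>2 *s (c 2 + c (- 2)) + k\<^sub>s *s s + k\<^sub>e *s e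
      + k\<^sub>o *s e') =
    (k\<^sub>0 + (1/16) * k\<^sub>1 + (1/16) * k\<^sub>2 + (3/4 * \<xi> - 25/1024) * k\<^sub>s + (3/4 * \<zeta> - 25/1024) * k\<^sub>e
        + (- 32/21 * \<xi>^2 - 64/7 * \<xi> * \<eta> + 7/6 * \<xi> + 1/2 * \<eta> - 1/24 * \<zeta> - 127/3072) * k\<^sub>o) *s c 0
     + ((1/32) * k\<^sub>1 + (7/2048) * k\<^sub>s + (- 1/12 * \<xi> + 1/4 * \<eta> - 19/3072) * k\<^sub>o) *s (c 1 + c (- 1))
     + ((1/32) * k\<^sub>2 + (7/2048) * k\<^sub>e + (7/6144) * k\<^sub>o) *s (c 2 + c (- 2))
     + (2 * k\<^sub>1 + (7/32) * k\<^sub>s + (- 16/3 * \<xi> + 16 * \<eta> - 19/48) * k\<^sub>o) *s s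
     + (2 * k\<^sub>2 + (7/32) * k\<^sub>e + (7/96) * k\<^sub>o) *s e"
  by (rule vec_eqI) (simp add: mult_linear axis_axis axis_s axis_e axis_other_e cross_product_def
      functional_simps ring_nf)

text \<open>The left side is \<open>(U\<^sub>1 + V\<^sub>1) \<cdot> U\<^sub>2 - V\<^sub>1 \<cdot> (U\<^sub>2 + V\<^sub>2) = U\<^sub>1 \<cdot> U\<^sub>2 - V\<^sub>1 \<cdot> V\<^sub>2\<close>. In this form
  one factor of each product is a combination of axes, so that \<open>s \<cdot> e\<close> does not occur; \<open>c 3\<close> and
  \<open>c (- 3)\<close> are removed by the recurrence.\<close>

lemma mixed_product:
  "(c 1 + c (- 1) - (2 * \<xi>) *s c 0) \<cdot> U\<^sub>2 - V\<^sub>1 \<cdot> (c 2 + c (- 2) - (2 * \<zeta>) *s c 0) =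
    (- 2560/21 * \<xi>^2 - 5120/7 * \<xi> * \<eta> - 4 * \<xi> * \<zeta> + 269/42 * \<xi> + 416/7 * \<eta> - 17/6 * \<zeta> - 209/192)
        *s c 0 + (- 768/49 * \<xi>^2 - 26112/49 * \<xi> * \<eta> + 4096 * \<eta>^2 - 68/21 * \<xi> - 1784/7 * \<eta> - 5/28 * \<zeta>
        - 26/7 * \<theta> + 1399/336) *s (c 1 + c (- 1)) + (55/28 * \<xi> + 128/7 * \<eta> - 193/384) *s (c 2
        + c (- 2)) + (- 49152/49 * \<xi>^2 - 294912/49 * \<xi> * \<eta> - 38912/21 * \<xi> + 3072 * \<eta>
        - 80/7 * \<zeta> - 656/21) *s s + (16 * \<xi> + 23/6) *s e + (- 384/7 * \<xi> - 2304/7 * \<eta>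
        - 2) *s e'"
  (is "_ = ?combination")
proof -
  have "(c 1 + c (- 1) - (2 * \<xi>) *s c 0) \<cdot> U\<^sub>2 - V\<^sub>1 \<cdot> (c 2 + c (- 2) - (2 * \<zeta>) *s c 0)
      = (1/18816) *s ((- 18874368 * \<xi>^2 - 113246208 * \<xi> * \<eta> - 18677760 * \<xi> + 41615360 * \<eta>
      - 215040 * \<zeta> - 587776) *s s
     + (- 294912 * \<xi>^2 - 15138816 * \<xi> * \<eta> + 76218368 * \<eta>^2 + 192000 * \<xi> - 4302848 * \<eta> - 3360 * \<zeta>
         - 93184 * \<theta> + 64694) *s c 1
     + (- 242592 * \<xi> + 297472 * \<eta> - 539) *s c 2
     + (- 589824 * \<xi>^2 - 3538944 * \<xi> * \<eta> - 75264 * \<xi> * \<zeta> - 305472 * \<xi> + 705536 * \<eta> - 6720 * \<zeta>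
         - 8470) *s c 0
     + (- 1032192 * \<xi> - 6193152 * \<eta> + 43904) *s e'
     + (- 294912 * \<xi>^2 - 15138816 * \<xi> * \<eta> + 76218368 * \<eta>^2 + 192000 * \<xi> - 4302848 * \<eta> - 3360 * \<zeta>
         - 93184 * \<theta> + 64694) *s c (- 1)
     + (- 1274) *s c 3
     + (- 242592 * \<xi> + 297472 * \<eta> - 539) *s c (- 2)
     + (- 1274) *s c (- 3)
     + (301056 * \<xi> - 9408) *s e)"
    by (rule vec_eqI)
      (simp add: U\<^sub>2_def V\<^sub>1_def product_rules functional_simps ring_nf)
  also have "\<dots> = ?combination"
    unfolding relation_0 relation_reverse
    by (rule vec_eqI) (simp add: rel_inner_def rel_outer_def functional_simps ring_nf)
  finally show ?thesis .
qed

text \<open>Multiplying \<open>U\<^sub>1 \<cdot> U\<^sub>2 - V\<^sub>1 \<cdot> V\<^sub>2\<close> by \<open>c 0\<close> gives \<open>- lam (c 0) (V\<^sub>1 \<cdot> V\<^sub>2) *s c 0\<close> by fusion.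
  Computed from the explicit form of the vector, the same product is a linear relation between
  \<open>c 0\<close>, \<open>c 1 + c (- 1)\<close>, \<open>c 2 + c (- 2)\<close>, \<open>s\<close> and \<open>e\<close>, and it turns out to involve these
  vectors only through \<open>V\<^sub>1\<close> and \<open>V\<^sub>2\<close>.\<close>

lemma proportional: "\<gamma>\<^sub>1 *s V\<^sub>1 + \<gamma>\<^sub>2 *s V\<^sub>2 = 0"
proof -
  have "c 0 \<cdot> (U\<^sub>1 \<cdot> U\<^sub>2) = 0" "c 0 \<cdot> (V\<^sub>1 \<cdot> V\<^sub>2) = lam (c 0) (V\<^sub>1 \<cdot> V\<^sub>2) *s c 0"
    using fusion_zero_zero[OF axis_c UV_eigen(2) UV_eigen(4)]
        fusion_alpha_alpha'[OF axis_c UV_eigen(1) UV_eigen(3)] by auto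
  moreover have "(c 1 + c (- 1) - (2 * \<xi>) *s c 0) \<cdot> U\<^sub>2 - V\<^sub>1 \<cdot> (c 2 + c (- 2) - (2 * \<zeta>) *s c 0)
      = U\<^sub>1 \<cdot> U\<^sub>2 - V\<^sub>1 \<cdot> V\<^sub>2"
  proof -
    have "c 1 + c (- 1) - (2 * \<xi>) *s c 0 = U\<^sub>1 + V\<^sub>1" "c 2 + c (- 2) - (2 * \<zeta>) *s c 0 = U\<^sub>2 + V\<^sub>2"
        by (simp_all add: UV_sum)
    then show ?thesis by (simp add: mult_linear)
  qed
  ultimately have 0: "c 0 \<cdot> ((c 1 + c (- 1) - (2 * \<xi>) *s c 0) \<cdot> U\<^sub>2
      - V\<^sub>1 \<cdot> (c 2 + c (- 2) - (2 * \<zeta>) *s c 0))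
      + lam (c 0) (V\<^sub>1 \<cdot> V\<^sub>2) *s c 0 = 0"
    by (simp add: mult_linear)
  \<comment> \<open>the coefficients of the combination in the preceding lemma, in the same order\<close>
  define k\<^sub>0 k\<^sub>1 k\<^sub>2 k\<^sub>s k\<^sub>e k\<^sub>o where k:
      "k\<^sub>0 = - 2560/21 * \<xi>^2 - 5120/7 * \<xi> * \<eta> - 4 * \<xi> * \<zeta> + 269/42 * \<xi> + 416/7 * \<eta> - 17/6 * \<zeta>
          - 209/192"
      "k\<^sub>1 = - 768/49 * \<xi>^2 - 26112/49 * \<xi> * \<eta> + 4096 * \<eta>^2 - 68/21 * \<xi> - 1784/7 * \<eta> - 5/28 * \<zeta>
          - 26/7 * \<theta> + 1399/336"
      "k\<^sub>2 = 55/28 * \<xi> + 128/7 * \<eta> - 193/384"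
      "k\<^sub>s = - 49152/49 * \<xi>^2 - 294912/49 * \<xi> * \<eta> - 38912/21 * \<xi> + 3072 * \<eta> - 80/7 * \<zeta> - 656/21"
      "k\<^sub>e = 16 * \<xi> + 23/6"
      "k\<^sub>o = - 384/7 * \<xi> - 2304/7 * \<eta> - 2"
  define m\<^sub>0 where "m\<^sub>0 = k\<^sub>0 + (1/16) * k\<^sub>1 + (1/16) * k\<^sub>2 + (3/4 * \<xi> - 25/1024) * k\<^sub>s
      + (3/4 * \<zeta> - 25/1024) * k\<^sub>e + (- 32/21 * \<xi>^2 - 64/7 * \<xi> * \<eta> + 7/6 * \<xi> + 1/2 * \<eta> - 1/24 * \<zeta>
      - 127/3072) * k\<^sub>o"
  \<comment> \<open>the coefficient of \<open>c 0\<close> agrees with that in \<open>V\<^sub>1\<close> and \<open>V\<^sub>2\<close> only modulo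
    \<open>orth_cubic\<close>\<close>
  have c: "m\<^sub>0 + lam (c 0) (V\<^sub>1 \<cdot> V\<^sub>2) = 2 * (\<gamma>\<^sub>1 * (1/4 - 8 * \<xi>) + \<gamma>\<^sub>2 * (1/4 - 8 * \<zeta>))
      + 12/49 * orth_cubic \<xi> \<eta> \<zeta> \<theta>"
    "(1/32) * k\<^sub>1 + (7/2048) * k\<^sub>s + (- 1/12 * \<xi> + 1/4 * \<eta> - 19/3072) * k\<^sub>o = \<gamma>\<^sub>1/4"
        "(1/32) * k\<^sub>2 + (7/2048) * k\<^sub>e + (7/6144) * k\<^sub>o = \<gamma>\<^sub>2/4"
        "2 * k\<^sub>1 + (7/32) * k\<^sub>s + (- 16/3 * \<xi> + 16 * \<eta> - 19/48) * k\<^sub>o = 16 * \<gamma>\<^sub>1"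
        "2 * k\<^sub>2 + (7/32) * k\<^sub>e + (7/96) * k\<^sub>o = 16 * \<gamma>\<^sub>2"
    unfolding m\<^sub>0_def k lam_V1_V2 \<gamma>\<^sub>1_def \<gamma>\<^sub>2_def dep_coeff1_def dep_coeff2_def gram12_def
        orth_cubic_def
    by (simp_all add: ring_nf)
  have c1: "m\<^sub>0 + lam (c 0) (V\<^sub>1 \<cdot> V\<^sub>2) = 2 * (\<gamma>\<^sub>1 * (1/4 - 8 * \<xi>) + \<gamma>\<^sub>2 * (1/4 - 8 * \<zeta>))"
    using c(1) unfolding param_equation by simp
  have "2 *s (\<gamma>\<^sub>1 *s V\<^sub>1 + \<gamma>\<^sub>2 *s V\<^sub>2) = (2 * (\<gamma>\<^sub>1 * (1/4 - 8 * \<xi>) + \<gamma>\<^sub>2 * (1/4 - 8 * \<zeta>))) *s c 0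
      + (\<gamma>\<^sub>1/4) *s (c 1 + c (- 1)) + (\<gamma>\<^sub>2/4) *s (c 2 + c (- 2)) + (16 * \<gamma>\<^sub>1) *s s + (16 * \<gamma>\<^sub>2) *s e"
    unfolding V\<^sub>1_def V\<^sub>2_def by (rule vec_eqI) (simp add: functional_simps ring_nf)
  also have "\<dots> = 0"
    using 0 unfolding c(2-5)[symmetric] c1[symmetric] mixed_product k[symmetric]
        axis_mult_combination m\<^sub>0_def
    by (simp add: scale_left_distrib add_ac)
  finally show ?thesis by simp
qed

lemma determinant_equations:
  "\<gamma>\<^sub>1 * lam (c 0) (V\<^sub>1 \<cdot> V\<^sub>1) + \<gamma>\<^sub>2 * lam (c 0) (V\<^sub>1 \<cdot> V\<^sub>2) = 0"
  "\<gamma>\<^sub>1 * lam (c 0) (V\<^sub>1 \<cdot> V\<^sub>2) + \<gamma>\<^sub>2 * lam (c 0) (V\<^sub>2 \<cdot> V\<^sub>2) = 0"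
proof -
  have "lam (c 0) (V\<^sub>1 \<cdot> (\<gamma>\<^sub>1 *s V\<^sub>1 + \<gamma>\<^sub>2 *s V\<^sub>2)) = 0"
      "lam (c 0) (V\<^sub>2 \<cdot> (\<gamma>\<^sub>1 *s V\<^sub>1 + \<gamma>\<^sub>2 *s V\<^sub>2)) = 0"
    by (simp_all only: proportional mult_zero_right lam_simps)
  then show "\<gamma>\<^sub>1 * lam (c 0) (V\<^sub>1 \<cdot> V\<^sub>1) + \<gamma>\<^sub>2 * lam (c 0) (V\<^sub>1 \<cdot> V\<^sub>2) = 0"
    "\<gamma>\<^sub>1 * lam (c 0) (V\<^sub>1 \<cdot> V\<^sub>2) + \<gamma>\<^sub>2 * lam (c 0) (V\<^sub>2 \<cdot> V\<^sub>2) = 0"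
    by (simp_all only: mult_linear lam_simps mult_commute[of V\<^sub>2 V\<^sub>1])
qed

end

section \<open>Solving the equations between the parameters\<close>

text \<open>For \<open>x \<noteq> y\<close>, and with \<open>z\<close> and \<open>t\<close> eliminated, the left sides of the two determinant equations
  are multiples of \<open>x * asym_cubic x y\<close> and \<open>x * asym_quartic x y\<close>.\<close>

definition asym_cubic :: "'f::field_char_0 \<Rightarrow> 'f \<Rightarrow> 'f" where
  "asym_cubic x y = - 10141696 * x^3 + 16916480 * x^2 * y - 92008448 * x * y^2 - 9248768 * y^3
      + 123494784 * x^2 + 62341056 * x * y - 81962304 * y^2 - 5144454 * x - 33111927 * y + 319788"

definition asym_quartic :: "'f::field_char_0 \<Rightarrow> 'f \<Rightarrow> 'f" where
  "asym_quartic x y = 1992294400 * x^4 + 6396313600 * x^3 * y - 19709034496 * x^2 * y^2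
      + 147599654912 * x * y^3 + 27323793408 * y^4 - 5965316096 * x^3 - 43713806336 * x^2 * y
      + 414116519936 * x * y^2 + 66711560192 * y^3 - 32114844672 * x^2 + 170223556608 * x * y
      + 27060320832 * y^2 - 142047288 * x - 1706275269 * y + 1952748"

text \<open>The left sides of the determinant equations for \<open>x = y\<close> and \<open>z = t\<close>, up to constant factors.\<close>

definition sym_quartic :: "'f::field_char_0 \<Rightarrow> 'f \<Rightarrow> 'f" where
  "sym_quartic x z = - 2097152 * x^4 + 2326528 * x^3 - 40960 * x^2 * z - 184320 * x^2 - 8896 * x * z
      - 128 * z^2 + 4800 * x + 167 * z - 39"

definition sym_quintic :: "'f::field_char_0 \<Rightarrow> 'f \<Rightarrow> 'f" where
  "sym_quintic x z = 1073741824 * x^5 - 1224736768 * x^4 + 52428800 * x^3 * z + 104562688 * x^3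
      - 3473408 * x^2 * z + 188416 * x * z^2 - 3010560 * x^2 + 269440 * x * z + 4672 * z^2
      + 29568 * x - 4633 * z - 39"

lemma factor_zero:
  fixes k h q :: "'f::idom"
  shows "k * (h * q) = r \<Longrightarrow> r = 0 \<Longrightarrow> k \<noteq> 0 \<Longrightarrow> h \<noteq> 0 \<Longrightarrow> q = 0"
  by simp

text \<open>The difference of each polynomial and its mirror image is divisible by \<open>x - y\<close>, and the
  quotients and the sum are polynomials in the symmetric functions \<open>a = x + y\<close> and \<open>b = x * y\<close>.
  Three of them have no common zero.\<close>

lemma unequal_parameters_core:
  fixes x y :: "'f::field_char_0"
  assumes c: "asym_cubic x y = 0" "asym_cubic y x = 0" and q: "asym_quartic x y = 0"
      "asym_quartic y x = 0" and ne: "x \<noteq> y"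
  shows False
proof -
  define a where "a = x + y"
  define b where "b = x * y"
  have "1 * ((x - y) * (- 892928 * a^2 + 205457088 * a + 109817856 * b + 27967473)) = asym_cubic x y
      - asym_cubic y x"
    unfolding a_def b_def asym_cubic_def asym_quartic_def by algebra
  then have 1: "- 892928 * a^2 + 205457088 * a + 109817856 * b + 27967473 = 0"
      by (rule factor_zero) (use c ne in simp_all)
  have "9 * (1 * (- 2154496 * a^3 + 4614720 * a^2 - 1880064 * a * b - 4250709 * a + 4624128 * b
      + 71064)) = asym_cubic x y + asym_cubic y x"
    unfolding a_def b_def asym_cubic_def asym_quartic_def by algebra
  then have 2: "- 2154496 * a^3 + 4614720 * a^2 - 1880064 * a * b - 4250709 * a + 4624128 * b
      + 71064 = 0" by (rule factor_zero) (use c in simp_all)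
  have "1 * ((x - y) * (- 25331499008 * a^3 - 72676876288 * a^2 - 90540343296 * a * b
      - 59175165504 * a - 385153449984 * b + 1564227981)) = asym_quartic x y - asym_quartic y x"
    unfolding a_def b_def asym_cubic_def asym_quartic_def by algebra
  then have 3: "- 25331499008 * a^3 - 72676876288 * a^2 - 90540343296 * a * b - 59175165504 * a
      - 385153449984 * b + 1564227981 = 0" by (rule factor_zero) (use q ne in simp_all)
  from 1 2 3 show False by algebra
qed

text \<open>The sum of \<open>orth_cubic\<close> and its mirror image is divisible by \<open>y - x\<close> and gives \<open>z - t\<close>; then
  \<open>orth_cubic\<close> is linear in \<open>z\<close>.\<close>

lemma unequal_parameters:
  fixes x y z t :: "'f::field_char_0"
  assumes p: "orth_cubic x y z t = 0" "orth_cubic y x t z = 0" and ne: "x \<noteq> y"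
  shows "z = 1 - x * (16384 * y + 2560 * x + 6144) / 63"
proof -
  have "(y - x) * (63 * (z - t) - 2 * (y - x) * (1280 * (x + y) + 3072)) = orth_cubic x y z t
      + orth_cubic y x t z"
    unfolding orth_cubic_def by algebra
  then have d: "63 * (z - t) - 2 * (y - x) * (1280 * (x + y) + 3072) = 0"
    using p ne by (metis add_0 mult_eq_0_iff right_minus_eq)
  have "14 * ((y - x) * (63 * (z - 1) + x * (16384 * y + 2560 * x + 6144)))
    = 9 * orth_cubic x y z t - 5 * x * (63 * (z - t) - 2 * (y - x) * (1280 * (x + y) + 3072))"
    unfolding orth_cubic_def by algebra
  then have "63 * (z - 1) + x * (16384 * y + 2560 * x + 6144) = 0"
    by (rule factor_zero) (use p d ne in simp_all)
  then have "63 * z = 63 - x * (16384 * y + 2560 * x + 6144)" by algebra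
  then have "z = (63 - x * (16384 * y + 2560 * x + 6144)) / 63"
      by (simp add: eq_divide_eq mult.commute)
  then show ?thesis by (simp add: diff_divide_distrib)
qed

lemma unequal_parameters_det:
  fixes x y z t :: "'f::field_char_0"
  assumes z: "z = 1 - x * (16384 * y + 2560 * x + 6144) / 63"
    and t: "t = 1 - y * (16384 * x + 2560 * y + 6144) / 63"
  shows "x * asym_cubic x y = 222264 * (dep_coeff1 x y z t * gram11 x y z + dep_coeff2 x y * gram12
      x y z t)"
    and "x * asym_quartic x y = 1555848 * (dep_coeff1 x y z t * gram12 x y z t
        + dep_coeff2 x y * gram22 x y z t)"
proof -
  have g: "dep_coeff1 x y z t = 4352/441 * x^2 + 512/7 * x * y + 88960/441 * y^2 - 926/147 * x
      + 9050/147 * y - 1/2" "dep_coeff2 x y = 3/14 * x + 11/14 * y - 5/256" "gram11 x y z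
      = - 1276/63 * x^2 - 160/63 * x * y - 44/21 * x" "gram12 x y z t = 317440/441 * x^3
      + 299008/63 * x^2 * y + 88064/147 * x * y^2 + 952384/441 * x^2 + 124576/441 * x * y
      - 2944/147 * x" "gram22 x y z t = - 83886080/3087 * x^4 - 118489088/343 * x^3 * y
      - 3450339328/3087 * x^2 * y^2 - 45088768/343 * x * y^3 - 304578560/3087 * x^3
      - 1908592640/3087 * x^2 * y - 70137856/1029 * x * y^2
      - 121109248/3087 * x^2 + 11825120/3087 * x * y + 65920/147 * x"
    unfolding dep_coeff1_def dep_coeff2_def gram11_def gram12_def gram22_def z t
        by (simp_all add: ring_nf eval_nat_numeral)
  show "x * asym_cubic x y = 222264 * (dep_coeff1 x y z t * gram11 x y z + dep_coeff2 x y * gram12 x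
      y z t)"
    "x * asym_quartic x y = 1555848 * (dep_coeff1 x y z t * gram12 x y z t + dep_coeff2 x y * gram22
        x y z t)"
    unfolding g asym_cubic_def asym_quartic_def by (simp_all add: ring_nf eval_nat_numeral)
qed

text \<open>Eliminating the square of \<open>z\<close> from the two equations gives a linear equation
  \<open>l\<^sub>1 * z + l\<^sub>0 = 0\<close>. Substituting it back gives the resultant, which splits into linear
  factors over the rationals. Only the double root \<open>x = 1/64\<close> leaves two values of \<open>z\<close>, for the
  types 3C and 4B: there \<open>l\<^sub>0\<close> and \<open>l\<^sub>1\<close> vanish and the quadratic equation decides.\<close>

lemma equal_parameters:
  fixes x z :: "'f::field_char_0"
  assumes "sym_quartic x z = 0" and "sym_quintic x z = 0"
  shows "(x, z) \<in> {(1, 1), (1/8, 1), (13/256, 13/256), (1/64, 1/64), (1/32, 0), (1/64, 1/8),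
      (3/128, 3/128), (5/256, 13/256)} \<or> x = 0"
proof -
  define l\<^sub>0 where "l\<^sub>0 = 268435456 * x^5 - 283115520 * x^4 + 10911744 * x^3 + 356352 * x^2
      - 19648 * x + 195"
  define l\<^sub>1 where "l\<^sub>1 = 1048576 * x^3 + 2408448 * x^2 - 25408 * x - 195"
  define q\<^sub>0 where "q\<^sub>0 = - 2097152 * x^4 + 2326528 * x^3 - 184320 * x^2 + 4800 * x - 39"
  define q\<^sub>1 where "q\<^sub>1 = - 40960 * x^2 - 8896 * x + 167"
  have "960 * (1 * (l\<^sub>1 * z + l\<^sub>0)) = (- 128) * sym_quintic x z - (188416 * x + 4672) * sym_quartic
      x z"
    unfolding l\<^sub>0_def l\<^sub>1_def sym_quartic_def sym_quintic_def by algebra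
  then have l: "l\<^sub>1 * z + l\<^sub>0 = 0" by (rule factor_zero) (use assms in simp_all)
  have quad: "sym_quartic x z = - 128 * z^2 + q\<^sub>1 * z + q\<^sub>0"
    unfolding q\<^sub>0_def q\<^sub>1_def sym_quartic_def by algebra
  have A: "49 * (1 * (x * (256 * x - 4) * (256 * x - 4) * (256 * x - 5) * (256 * x - 6)
      * (256 * x - 8) * (256 * x - 13) * (256 * x - 32) * (256 * x - 256)))
      = 32 * (- 128 * l\<^sub>0^2 - q\<^sub>1 * l\<^sub>0 * l\<^sub>1 + q\<^sub>0 * l\<^sub>1^2)"
    unfolding l\<^sub>0_def l\<^sub>1_def q\<^sub>0_def q\<^sub>1_def by algebra
  have B: "32 * (- 128 * l\<^sub>0^2 - q\<^sub>1 * l\<^sub>0 * l\<^sub>1 + q\<^sub>0 * l\<^sub>1^2) = 0"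
    using l assms(1) unfolding quad by algebra
  have "x * (256 * x - 4) * (256 * x - 4) * (256 * x - 5) * (256 * x - 6) * (256 * x - 8)
      * (256 * x - 13) * (256 * x - 32) * (256 * x - 256)
      = 0" by (rule factor_zero[OF A B]) simp_all
  then consider "x = 0" | "256 * x - 4 = 0" | "256 * x - 5 = 0" | "256 * x - 6 = 0" |
      "256 * x - 8 = 0"
    | "256 * x - 13 = 0" | "256 * x - 32 = 0" | "256 * x - 256 = 0"
    by (simp only: mult_eq_0_iff) blast
  then show ?thesis
  proof cases
    case 1 then show ?thesis by simp
  next
    case 2
    from 2 assms(1)[unfolded sym_quartic_def] have "(64 * z - 1) * (8 * z - 1) = 0" by algebra
    then have "z = 1/64 \<or> z = 1/8" by (auto simp: eq_divide_eq mult.commute)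
    moreover have "x = 1/64" using 2 by (simp add: eq_divide_eq mult.commute)
    ultimately show ?thesis by auto
  next
    case 3
    with l have "256 * z - 13 = 0" unfolding l\<^sub>0_def l\<^sub>1_def by algebra
    with 3 show ?thesis by (simp add: field_simps)
  next
    case 4
    with l have "128 * z - 3 = 0" unfolding l\<^sub>0_def l\<^sub>1_def by algebra
    with 4 show ?thesis by (simp add: field_simps)
  next
    case 5
    with l have "z = 0" unfolding l\<^sub>0_def l\<^sub>1_def by algebra
    with 5 show ?thesis by (simp add: field_simps)
  next
    case 6
    with l have "256 * z - 13 = 0" unfolding l\<^sub>0_def l\<^sub>1_def by algebra
    with 6 show ?thesis by (simp add: field_simps)
  next
    case 7
    with l have "z - 1 = 0" unfolding l\<^sub>0_def l\<^sub>1_def by algebra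
    with 7 show ?thesis by (simp add: field_simps)
  next
    case 8
    with l have "z - 1 = 0" unfolding l\<^sub>0_def l\<^sub>1_def by algebra
    with 8 show ?thesis by (simp add: field_simps)
  qed
qed

text \<open>For \<open>x = 0\<close> the equation \<open>orth_cubic = 0\<close> gives no information on \<open>z\<close> and \<open>t\<close>, so \<open>z = t\<close>
  cannot be presupposed.\<close>

lemma zero_parameters:
  fixes z t :: "'f::field_char_0"
  assumes "dep_coeff1 0 0 z t * gram11 0 0 z + dep_coeff2 0 0 * gram12 0 0 z t = 0"
    "dep_coeff1 0 0 z t * gram12 0 0 z t + dep_coeff2 0 0 * gram22 0 0 z t = 0"
    "dep_coeff1 0 0 t z * gram11 0 0 t + dep_coeff2 0 0 * gram12 0 0 t z = 0"
    "dep_coeff1 0 0 t z * gram12 0 0 t z + dep_coeff2 0 0 * gram22 0 0 t z = 0"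
  shows "z = 1 \<and> t = 1"
proof -
  have f: "dep_coeff1 0 0 z t * gram11 0 0 z + dep_coeff2 0 0 * gram12 0 0 z t
      = (1/28672) * ((1 - z) * (832 * t + 320 * z - 351))"
    "dep_coeff1 0 0 z t * gram12 0 0 z t + dep_coeff2 0 0 * gram22 0 0 z t
        = - (1/200704) * ((1 - z) * (15808 * t + 26240 * z + 351))"
    for z t :: 'f
    unfolding dep_coeff1_def dep_coeff2_def gram11_def gram12_def gram22_def
        by (simp_all add: ring_nf)
  have zt: "z = 1 \<or> 832 * t + 320 * z - 351 = 0" "z = 1 \<or> 15808 * t + 26240 * z + 351 = 0"
    "t = 1 \<or> 832 * z + 320 * t - 351 = 0" "t = 1 \<or> 15808 * z + 26240 * t + 351 = 0"
    using assms unfolding f by auto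
  have "z = 1"
  proof (rule ccontr)
    assume "z \<noteq> 1"
    then have 1: "832 * t + 320 * z - 351 = 0" "15808 * t + 26240 * z + 351 = 0" using zt by auto
    show False
    proof (cases "t = 1")
      case True with 1 show False by algebra
    next
      case False
      then have "832 * z + 320 * t - 351 = 0" using zt by auto
      with 1 show False by algebra
    qed
  qed
  moreover have "t = 1"
  proof (rule ccontr)
    assume "t \<noteq> 1"
    then have "832 * z + 320 * t - 351 = 0" "15808 * z + 26240 * t + 351 = 0" using zt by auto
    with \<open>z = 1\<close> show False by algebra
  qed
  ultimately show ?thesis by simp
qed

lemma parameters:
  fixes x y z t :: "'f::field_char_0"
  assumes p: "orth_cubic x y z t = 0" "orth_cubic y x t z = 0"
    and d: "dep_coeff1 x y z t * gram11 x y z + dep_coeff2 x y * gram12 x y z t = 0"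
      "dep_coeff1 x y z t * gram12 x y z t + dep_coeff2 x y * gram22 x y z t = 0"
      "dep_coeff1 y x t z * gram11 y x t + dep_coeff2 y x * gram12 y x t z = 0"
      "dep_coeff1 y x t z * gram12 y x t z + dep_coeff2 y x * gram22 y x t z = 0"
  shows "x = y \<and> z = t \<and> (x, z) \<in> {(1, 1), (1/8, 1), (0, 1), (13/256, 13/256), (1/64, 1/64),
    (1/32, 0), (1/64, 1/8), (3/128, 3/128), (5/256, 13/256)}"
proof -
  have xy: "x = y"
  proof (rule ccontr)
    assume ne: "x \<noteq> y"
    note zt = unequal_parameters[OF p ne] unequal_parameters[OF p(2) p(1) ne[symmetric]]
    have "x * asym_cubic x y = 0" "x * asym_quartic x y = 0" "y * asym_cubic y x = 0"
        "y * asym_quartic y x = 0"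
      using unequal_parameters_det[OF zt] unequal_parameters_det[OF zt(2) zt(1)] d
      by (simp_all only: mult_zero_right)
    then have x: "x = 0 \<or> asym_cubic x y = 0" "x = 0 \<or> asym_quartic x y = 0"
        and y: "y = 0 \<or> asym_cubic y x = 0" "y = 0 \<or> asym_quartic y x = 0"
      by (simp_all only: mult_eq_0_iff)
    consider "x \<noteq> 0" "y \<noteq> 0" | "x = 0" "y \<noteq> 0" | "x \<noteq> 0" "y = 0" using ne by auto
    then show False
    proof cases
      case 1 then show False using unequal_parameters_core[OF _ _ _ _ ne] x y by blast
    next
      case 2
      then have "asym_cubic y x = 0" "asym_quartic y x = 0" using y by blast+
      with 2(1) show False unfolding asym_cubic_def asym_quartic_def by algebra
    next
      case 3
      then have "asym_cubic x y = 0" "asym_quartic x y = 0" using x by blast+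
      with 3(2) show False unfolding asym_cubic_def asym_quartic_def by algebra
    qed
  qed
  show ?thesis
  proof (cases "x = 0")
    case True
    then have "z = 1 \<and> t = 1" using zero_parameters[of z t] d xy by simp
    then show ?thesis using True xy by simp
  next
    case False
    have "35 * (x * (z - t)) = orth_cubic x x z t" unfolding orth_cubic_def by algebra
    then have "z - t = 0" by (rule factor_zero) (use False p xy in simp_all)
    then have zt: "z = t" by simp
    have n: "sym_quartic x z = (28672/9) * (dep_coeff1 x x z z * gram11 x x z
        + dep_coeff2 x x * gram12 x x z z)"
      "sym_quintic x z = (200704/9) * (dep_coeff1 x x z z * gram12 x x z z + dep_coeff2 x x * gram22
          x x z z)"
      unfolding dep_coeff1_def dep_coeff2_def gram11_def gram12_def gram22_def sym_quartic_def
          sym_quintic_def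
      by (simp_all add: ring_nf eval_nat_numeral)
    have "sym_quartic x z = 0" "sym_quintic x z = 0"
      using n d(1,2) unfolding xy[symmetric] zt[symmetric] by (simp_all only: mult_zero_right)
    from equal_parameters[OF this] show ?thesis using False xy zt by auto
  qed
qed

context dihedral_axes
begin

lemma parameter_values:
  "\<eta> = \<xi>" "\<theta> = \<zeta>"
  "(\<xi>, \<zeta>) \<in> {(1, 1), (1/8, 1), (0, 1), (13/256, 13/256), (1/64, 1/64), (1/32, 0), (1/64, 1/8),
    (3/128, 3/128), (5/256, 13/256)}"
proof -
  interpret d: dihedral_axes scale mult "\<lambda>j. c (1 + j)" by (rule shift)
  note flip = shift_odd[OF odd_one]
  note D = determinant_equations[unfolded lam_V1_V1 lam_V1_V2 lam_V2_V2 \<gamma>\<^sub>1_def \<gamma>\<^sub>2_def]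
  note D' = d.determinant_equations[unfolded d.lam_V1_V1 d.lam_V1_V2 d.lam_V2_V2 d.\<gamma>\<^sub>1_def
      d.\<gamma>\<^sub>2_def,
      unfolded flip]
  note P = parameters[OF param_equation d.param_equation[unfolded flip] D D']
  show "\<eta> = \<xi>" "\<theta> = \<zeta>"
    "(\<xi>, \<zeta>) \<in> {(1, 1), (1/8, 1), (0, 1), (13/256, 13/256), (1/64, 1/64), (1/32, 0), (1/64, 1/8),
      (3/128, 3/128), (5/256, 13/256)}"
    by (rule P[THEN conjunct1, symmetric] P[THEN conjunct2, THEN conjunct1, symmetric]
        P[THEN conjunct2, THEN conjunct2])+
qed

end

section \<open>Recognizing a Norton-Sakuma algebra from a multiplication table\<close>

lemma periodic_mod:
  fixes c :: "int \<Rightarrow> 'a"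
  assumes per: "\<And>i. c (i + n) = c i"
  shows "c (i mod n) = c i"
proof -
  have "c (j + k * n) = c j" for j k
  proof (induction k rule: int_induct[of _ 0])
    case (step1 k) then show ?case using per[of "j + k * n"] by (simp add: algebra_simps)
  next
    case (step2 k) then show ?case using per[of "j + (k - 1) * n"] by (simp add: algebra_simps)
  qed simp
  from this[of "i mod n" "i div n"] show ?thesis by (simp add: algebra_simps)
qed

lemma finite_ns_basis: "finite (ns_basis T)"
  by (cases T) (simp_all add: ns_basis_def)

lemma ns_period_pos: "ns_period T > 0"
  by (cases T) simp_all

text \<open>The functions that describe the multiplication table are linear in the coordinates; hence a
  sum over the basis of table coefficients times scalars is the table entry evaluated at those
  scalars. The same holds in the next two lemmas.\<close>

lemma ns_axis_axis_sum:
  "(\<Sum>z\<in>Z. ns_axis_axis T k (\<lambda>m. A m z) (\<lambda>x. B x z) * g z) =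
    ns_axis_axis T k (\<lambda>m. \<Sum>z\<in>Z. A m z * g z) (\<lambda>x. \<Sum>z\<in>Z. B x z * (g z :: 'f::field_char_0))"
proof (induction Z rule: infinite_finite_induct)
  case (insert z Z)
  then show ?case by (cases T) (simp_all add: ns_axis_axis_def ring_nf)
qed (cases T; simp add: ns_axis_axis_def)+

lemma ns_axis_aux_sum:
  "(\<Sum>z\<in>Z. ns_axis_aux T x (\<lambda>m. A m z) (\<lambda>x. B x z) * g z) =
    ns_axis_aux T x (\<lambda>m. \<Sum>z\<in>Z. A m z * g z) (\<lambda>x. \<Sum>z\<in>Z. B x z * (g z :: 'f::field_char_0))"
proof (induction Z rule: infinite_finite_induct)
  case (insert z Z)
  then show ?case by (cases T; cases x) (simp_all add: ring_nf)
qed (cases T; cases x; simp)+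

lemma ns_aux_aux_sum:
  "(\<Sum>z\<in>Z. ns_aux_aux x y (\<lambda>m. A m z) (\<lambda>x. B x z) * g z) =
    ns_aux_aux x y (\<lambda>m. \<Sum>z\<in>Z. A m z * g z) (\<lambda>x. \<Sum>z\<in>Z. B x z * (g z :: 'f::field_char_0))"
proof (induction Z rule: infinite_finite_induct)
  case (insert z Z)
  then show ?case by (simp add: ns_aux_aux_def ring_nf)
qed (simp_all add: ns_aux_aux_def)

lemma ns_coeff_outside:
  assumes z: "z \<notin> ns_basis T" and b: "b \<in> ns_basis T" and c: "c \<in> ns_basis T"
  shows "ns_coeff T b c z = (0::'f::field)"
proof -
  have 1: "Ax (m mod ns_period T) \<noteq> z" for m
    using z ns_period_pos[of T] by (auto simp: ns_basis_def)
  have 2: "Aux x \<noteq> z" if "x \<in> ns_auxs T" for x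
    using z that by (auto simp: ns_basis_def)
  have 3: "ns_axis_axis T k (\<lambda>m. 0) (\<lambda>x. of_bool (Aux x = z)) = (0::'f)" for k
    using 2 unfolding ns_axis_axis_def by (cases T) simp_all
  have 4: "ns_axis_aux T x (\<lambda>m. 0) (\<lambda>x. of_bool (Aux x = z)) = (0::'f)" if "x \<in> ns_auxs T" for x
    using 2 that by (cases T) auto
  have 5: "ns_aux_aux x y (\<lambda>m. 0) (\<lambda>x. of_bool (Aux x = z)) = (0::'f)" if "x \<in> ns_auxs T" for x y
    using 2[of x] that by (cases "x = y") (simp_all add: ns_aux_aux_def)
  show ?thesis
    using b c 3 4 5 by (cases b; cases c) (auto simp: ns_basis_def 1 Let_def)
qed

context char_0_algebra
begin

lemma functional_sum: "functional f \<Longrightarrow> f (sum g A) = (\<Sum>i\<in>A. f (g i))"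
  by (induction A rule: infinite_finite_induct) (simp_all add: functional_simps)

text \<open>The linear map from coordinate vectors to the algebra that is given by \<open>b\<close> is multiplicative,
  injective by independence, and surjective because its range is a subalgebra that contains the
  generators. The required isomorphism is its inverse.\<close>

lemma isomorphic_to_nsI:
  fixes b :: "ns_elt \<Rightarrow> 'v"
  assumes mult: "\<And>u v. u \<in> ns_basis T \<Longrightarrow> v \<in> ns_basis T \<Longrightarrow>
      b u \<cdot> b v = (\<Sum>z\<in>ns_basis T. ns_coeff T u v z *s b z)"
    and indep: "\<And>k. (\<Sum>z\<in>ns_basis T. k z *s b z) = 0 \<Longrightarrow> \<forall>z\<in>ns_basis T. k z = 0"
    and gen: "subalgebra hull S = UNIV" "S \<subseteq> b ` ns_basis T"
  shows "isomorphic_to_ns T"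
proof -
  let ?B = "ns_basis T"
  let ?C = "ns_carrier T :: (ns_elt \<Rightarrow> 'f) set"
  have fin: "finite ?B" by (rule finite_ns_basis)
  define \<psi> where "\<psi> = (\<lambda>k. \<Sum>z\<in>?B. k z *s b z)"
  have add: "\<psi> (\<lambda>z. k z + l z) = \<psi> k + \<psi> l" for k l
    by (simp add: \<psi>_def scale_left_distrib sum.distrib)
  have scale: "\<psi> (\<lambda>z. r * k z) = r *s \<psi> k" for r k
    by (simp add: \<psi>_def scale_sum_right)
  have mul: "\<psi> (ns_mult T k l) = \<psi> k \<cdot> \<psi> l" for k l
  proof -
    have "\<psi> (ns_mult T k l) = (\<Sum>z\<in>?B. \<Sum>u\<in>?B. \<Sum>v\<in>?B. (k u * l v * ns_coeff T u v z) *s b z)"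
      by (simp add: \<psi>_def ns_mult_def scale_sum_left)
    also have "\<dots> = (\<Sum>u\<in>?B. \<Sum>z\<in>?B. \<Sum>v\<in>?B. (k u * l v * ns_coeff T u v z) *s b z)"
      by (rule sum.swap)
    also have "\<dots> = (\<Sum>u\<in>?B. \<Sum>v\<in>?B. \<Sum>z\<in>?B. (k u * l v * ns_coeff T u v z) *s b z)"
      by (intro sum.cong refl sum.swap)
    also have "\<dots> = (\<Sum>u\<in>?B. \<Sum>v\<in>?B. (k u * l v) *s (b u \<cdot> b v))"
      by (intro sum.cong refl) (simp add: mult scale_sum_right)
    also have "\<dots> = \<psi> k \<cdot> \<psi> l"
      unfolding \<psi>_def mult_sum_left by (simp only: mult_sum_right mult_scale_left mult_scale_right
          scale_scale mult.commute)
    finally show ?thesis .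
  qed
  have unit: "\<psi> (\<lambda>z. of_bool (z = u)) = b u" if "u \<in> ?B" for u
  proof -
    have "\<psi> (\<lambda>z. of_bool (z = u)) = (\<Sum>z\<in>?B. if z = u then b z else 0)"
      unfolding \<psi>_def by (intro sum.cong) auto
    then show ?thesis using that fin by simp
  qed
  have "subalgebra (range \<psi>)"
    unfolding subalgebra_def subspace_def
  proof (intro conjI ballI allI)
    show "0 \<in> range \<psi>" by (rule range_eqI[of _ _ "\<lambda>_. 0"]) (simp add: \<psi>_def)
    show "u + v \<in> range \<psi>" if "u \<in> range \<psi>" "v \<in> range \<psi>" for u v
      using that add by (metis rangeE rangeI)
    show "r *s u \<in> range \<psi>" if "u \<in> range \<psi>" for r u
      using that scale by (metis rangeE rangeI)
    show "u \<cdot> v \<in> range \<psi>" if "u \<in> range \<psi>" "v \<in> range \<psi>" for u v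
      using that mul by (metis rangeE rangeI)
  qed
  moreover have "S \<subseteq> range \<psi>"
    using gen(2) unit by (metis (no_types, lifting) image_subset_iff rangeI subset_iff imageE)
  ultimately have surj: "range \<psi> = UNIV"
    using gen(1) hull_minimal[of S "range \<psi>" subalgebra] by auto
  have cut: "\<psi> (\<lambda>z. if z \<in> ?B then k z else 0) = \<psi> k" for k
    unfolding \<psi>_def by (intro sum.cong) auto
  have "\<psi> ` ?C = UNIV"
  proof -
    have "v \<in> \<psi> ` ?C" for v
    proof -
      obtain k where "v = \<psi> k" using surj by (metis UNIV_I rangeE)
      then have "v = \<psi> (\<lambda>z. if z \<in> ?B then k z else 0)" by (simp add: cut)
      moreover have "(\<lambda>z. if z \<in> ?B then k z else 0) \<in> ?C" by (simp add: ns_carrier_def)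
      ultimately show ?thesis by blast
    qed
    then show ?thesis by blast
  qed
  moreover have inj: "inj_on \<psi> ?C"
  proof (rule inj_onI)
    fix k l assume kl: "k \<in> ?C" "l \<in> ?C" "\<psi> k = \<psi> l"
    have "\<psi> (\<lambda>z. k z + (- 1) * l z) = 0"
      unfolding add scale using kl(3) by simp
    then have "\<forall>z\<in>?B. k z + (- 1) * l z = 0" unfolding \<psi>_def by (rule indep)
    then show "k = l" using kl(1,2) by (auto simp: ns_carrier_def fun_eq_iff)
  qed
  ultimately have bij: "bij_betw \<psi> ?C UNIV" by (simp add: bij_betw_def)
  define \<phi> where "\<phi> = the_inv_into ?C \<psi>"
  have \<phi>: "\<phi> v \<in> ?C" "\<psi> (\<phi> v) = v" for v
    using bij unfolding \<phi>_def
    by (auto simp: bij_betw_def f_the_inv_into_f intro!: the_inv_into_into)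
  have eqI: "\<phi> v = k" if "k \<in> ?C" "\<psi> k = v" for v k
    using inj_onD[OF inj] \<phi> that by metis
  have "bij_betw \<phi> UNIV ?C" unfolding \<phi>_def by (rule bij_betw_the_inv_into[OF bij])
  moreover have "\<phi> (u + v) = (\<lambda>z. \<phi> u z + \<phi> v z)" for u v
    using \<phi> by (intro eqI) (auto simp: add ns_carrier_def)
  moreover have "\<phi> (r *s v) = (\<lambda>z. r * \<phi> v z)" for r v
    using \<phi> by (intro eqI) (auto simp: scale ns_carrier_def)
  moreover have "\<phi> (u \<cdot> v) = ns_mult T (\<phi> u) (\<phi> v)" for u v
  proof (rule eqI)
    show "ns_mult T (\<phi> u) (\<phi> v) \<in> ?C"
      by (auto simp: ns_carrier_def ns_mult_def ns_coeff_outside intro!: sum.neutral)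
  qed (simp add: mul \<phi>)
  ultimately show ?thesis unfolding isomorphic_to_ns_def by blast
qed

text \<open>The products are required in the form in which the table is written: one formula for each
  distance \<open>k\<close> with \<open>2 * k \<le> n\<close>, read at every position \<open>i\<close> in both directions. Each is stated
  for an arbitrary functional \<open>f\<close>, because \<open>ns_axis_axis\<close>, \<open>ns_axis_aux\<close> and \<open>ns_aux_aux\<close> take
  scalars as arguments.\<close>

lemma isomorphic_to_ns_table [case_names periodic zero axis_axis axis_aux aux_aux independent
    generated]:
  fixes c :: "int \<Rightarrow> 'v" and a :: "ns_aux \<Rightarrow> 'v"
  assumes per: "\<And>i. c (i + ns_period T) = c i"
    and zero: "\<And>x. x \<notin> ns_auxs T \<Longrightarrow> a x = 0"
    and axis_axis: "\<And>f i k. functional f \<Longrightarrow> 0 \<le> k \<Longrightarrow> 2 * k \<le> ns_period T \<Longrightarrow>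
      f (c i \<cdot> c (i + k)) = ns_axis_axis T k (\<lambda>m. f (c (i + m))) (\<lambda>x. f (a x)) \<and>
      f (c i \<cdot> c (i - k)) = ns_axis_axis T k (\<lambda>m. f (c (i - m))) (\<lambda>x. f (a x))"
    and axis_aux: "\<And>f i x. functional f \<Longrightarrow> x \<in> ns_auxs T \<Longrightarrow>
      f (c i \<cdot> a x) = ns_axis_aux T x (\<lambda>m. f (c (i + m))) (\<lambda>x. f (a x))"
    and aux_aux: "\<And>f x y. functional f \<Longrightarrow> x \<in> ns_auxs T \<Longrightarrow> y \<in> ns_auxs T \<Longrightarrow>
      f (a x \<cdot> a y) = ns_aux_aux x y (\<lambda>m. f (c m)) (\<lambda>x. f (a x))"
    and indep: "\<And>k. (\<Sum>i\<in>{0..<ns_period T}. k (Ax i) *s c i) + (\<Sum>x\<in>ns_auxs T. k (Aux x) *s a x) = 0 \<Longrightarrow>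
      \<forall>z\<in>ns_basis T. k z = 0"
    and gen: "subalgebra hull {c 0, c 1} = UNIV"
  shows "isomorphic_to_ns T"
proof -
  let ?n = "ns_period T"
  let ?B = "ns_basis T"
  define b where "b = (\<lambda>z. case z of Ax i \<Rightarrow> c i | Aux x \<Rightarrow> a x)"
  have c_mod: "c (i mod ?n) = c i" for i using per by (rule periodic_mod)
  have fin: "finite ?B" by (rule finite_ns_basis)
  have mem: "Ax (i mod ?n) \<in> ?B" for i using ns_period_pos[of T] by (simp add: ns_basis_def)
  have sum_Ax: "(\<Sum>z\<in>?B. of_bool (Ax (i mod ?n) = z) * f (b z)) = f (c i)" for i and f :: "'v \<Rightarrow> 'f"
  proof -
    have "(\<Sum>z\<in>?B. of_bool (Ax (i mod ?n) = z) * f (b z))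
        = (\<Sum>z\<in>?B. if z = Ax (i mod ?n) then f (b z) else 0)"
      by (intro sum.cong) auto
    then show ?thesis using fin mem by (simp add: b_def c_mod)
  qed
  have sum_Aux: "(\<Sum>z\<in>?B. of_bool (Aux x = z) * f (b z)) = f (a x)" if "functional f" for x f
  proof -
    have "(\<Sum>z\<in>?B. of_bool (Aux x = z) * f (b z)) = (\<Sum>z\<in>?B. if z = Aux x then f (b z) else 0)"
      by (intro sum.cong) auto
    moreover have "Aux x \<in> ?B \<longleftrightarrow> x \<in> ns_auxs T" by (auto simp: ns_basis_def)
    ultimately show ?thesis using fin zero[of x] functional_simps(3)[OF that] by (auto simp: b_def)
  qed
  show ?thesis
  proof (rule isomorphic_to_nsI)
    fix u v assume u: "u \<in> ?B" and v: "v \<in> ?B"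
    show "b u \<cdot> b v = (\<Sum>z\<in>?B. ns_coeff T u v z *s b z)"
    proof (rule vec_eqI)
      fix f :: "'v \<Rightarrow> 'f" assume f: "functional f"
      have "f (\<Sum>z\<in>?B. ns_coeff T u v z *s b z) = (\<Sum>z\<in>?B. ns_coeff T u v z * f (b z))"
        by (simp add: functional_sum[OF f] functional_simps[OF f])
      also have "\<dots> = f (b u \<cdot> b v)"
      proof (cases u)
        case (Ax i)
        show ?thesis
        proof (cases v)
          case (Ax j)
          define d where "d = (j - i) mod ?n"
          have d: "0 \<le> d" "d < ?n" using ns_period_pos[of T] by (simp_all add: d_def)
          show ?thesis
          proof (cases "2 * d \<le> ?n")
            case True
            have "c (i + d) = c j"
            proof -
              have "(i + d) mod ?n = j mod ?n" unfolding d_def by (simp add: mod_simps)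
              then show ?thesis using c_mod by metis
            qed
            then show ?thesis
              using True axis_axis[OF f d(1) True, of i]
              by (simp add: \<open>u = Ax i\<close> Ax Let_def b_def[symmetric] ns_axis_axis_sum sum_Ax
                  sum_Aux[OF f]
                  flip: d_def) (simp add: b_def)
          next
            case False
            have "c (i - (?n - d)) = c j"
            proof -
              have "(i - (?n - d)) mod ?n = (i + d - ?n) mod ?n" by (simp add: algebra_simps)
              also have "\<dots> = j mod ?n" unfolding d_def by (simp add: mod_simps)
              finally show ?thesis using c_mod by metis
            qed
            then show ?thesis
              using False axis_axis[OF f, of "?n - d" i] d
              by (simp add: \<open>u = Ax i\<close> Ax Let_def b_def[symmetric] ns_axis_axis_sum sum_Ax
                  sum_Aux[OF f]
                  flip: d_def) (simp add: b_def)
          qed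
        next
          case (Aux x)
          then have "x \<in> ns_auxs T" using v by (auto simp: ns_basis_def)
          then show ?thesis using axis_aux[OF f, of x i]
            by (simp add: \<open>u = Ax i\<close> Aux ns_axis_aux_sum sum_Ax sum_Aux[OF f]) (simp add: b_def)
        qed
      next
        case (Aux x)
        then have x: "x \<in> ns_auxs T" using u by (auto simp: ns_basis_def)
        show ?thesis
        proof (cases v)
          case (Ax i)
          then show ?thesis using x axis_aux[OF f, of x i]
            by (simp add: \<open>u = Aux x\<close> Ax ns_axis_aux_sum sum_Ax sum_Aux[OF f])
              (simp add: b_def mult_commute)
        next
          case (Aux y)
          then have "y \<in> ns_auxs T" using v by (auto simp: ns_basis_def)
          then show ?thesis using x aux_aux[OF f, of x y]
            by (simp add: \<open>u = Aux x\<close> Aux ns_aux_aux_sum sum_Ax sum_Aux[OF f]) (simp add: b_def)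
        qed
      qed
      finally show "f (b u \<cdot> b v) = f (\<Sum>z\<in>?B. ns_coeff T u v z *s b z)" ..
    qed
  next
    fix k assume k: "(\<Sum>z\<in>?B. k z *s b z) = 0"
    have "(\<Sum>z\<in>?B. k z *s b z) = (\<Sum>z\<in>Ax ` {0..<?n}. k z *s b z) + (\<Sum>z\<in>Aux ` ns_auxs T. k z *s b z)"
      unfolding ns_basis_def by (rule sum.union_disjoint) (cases T; auto)+
    also have "\<dots> = (\<Sum>i\<in>{0..<?n}. k (Ax i) *s c i) + (\<Sum>x\<in>ns_auxs T. k (Aux x) *s a x)"
      by (simp add: sum.reindex inj_on_def b_def)
    finally show "\<forall>z\<in>?B. k z = 0" using k indep by metis
  next
    show "subalgebra hull {c 0, c 1} = UNIV" by (rule gen)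
    have "c 0 = b (Ax (0 mod ?n))" "c 1 = b (Ax (1 mod ?n))"
        by (simp_all only: b_def ns_elt.case c_mod)
    then show "{c 0, c 1} \<subseteq> b ` ?B" using mem by blast
  qed
qed

end

section \<open>Relations along the sequence for symmetric parameters\<close>

context dihedral_axes
begin

text \<open>Now that \<open>\<eta> = \<xi>\<close> and \<open>\<theta> = \<zeta>\<close>, every shift of the sequence has the same parameters, so each
  fact about the position 0 holds at every position.\<close>

lemma shift_params:
  "dihedral_axes.\<xi> scale mult (\<lambda>j. c (i + j)) = \<xi>" "dihedral_axes.\<eta> scale mult (\<lambda>j. c (i + j)) = \<xi>"
  "dihedral_axes.\<zeta> scale mult (\<lambda>j. c (i + j)) = \<zeta>" "dihedral_axes.\<theta> scale mult (\<lambda>j. c (i + j)) = \<zeta>"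
  "sg (\<lambda>j. c (i + j)) 1 0 = s" "sg (\<lambda>j. c (i + j)) 2 0 = sg c 2 i"
      "sg (\<lambda>j. c (i + j)) 2 1 = sg c 2 (i + 1)"
  using sg_2[of i] sg_2[of "i + 1"]
  by (cases "even i"; simp add: shift_even shift_odd parameter_values(1,2))+

lemma lam_1: "lam (c i) (c (i + 1)) = \<xi>" "lam (c i) (c (i - 1)) = \<xi>"
  and lam_2: "lam (c i) (c (i + 2)) = \<zeta>" "lam (c i) (c (i - 2)) = \<zeta>"
  and lam_0: "lam (c i) (c i) = 1"
  and lam_s: "lam (c i) s = 31/32 * \<xi> - 1/32"
  and lam_e: "lam (c i) (sg c 2 i) = 31/32 * \<zeta> - 1/32"
proof -
  interpret d: dihedral_axes scale mult "\<lambda>j. c (i + j)" by (rule shift)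
  show "lam (c i) (c (i + 1)) = \<xi>" "lam (c i) (c (i - 1)) = \<xi>"
    "lam (c i) (c (i + 2)) = \<zeta>" "lam (c i) (c (i - 2)) = \<zeta>" "lam (c i) (c i) = 1"
    using d.lam_values[unfolded shift_params] by simp_all
  show "lam (c i) s = 31/32 * \<xi> - 1/32" "lam (c i) (sg c 2 i) = 31/32 * \<zeta> - 1/32"
    using d.lam_sgs[unfolded shift_params] by simp_all
qed

lemmas lam_near = lam_1 lam_2

lemma axis_s_at:
  "c i \<cdot> s = (3/4 * \<xi> - 25/1024) *s c i + (7/32) *s s + (7/2048) *s (c (i + 1) + c (i - 1))"
  using axis_s[of i] by (cases "even i") (simp_all add: parameter_values(1))

lemma axis_e_at:
  "c i \<cdot> sg c 2 i = (3/4 * \<zeta> - 25/1024) *s c i + (7/32) *s sg c 2 i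
      + (7/2048) *s (c (i + 2) + c (i - 2))"
  using axis_mult_sg[of i 2] by (simp add: lam_2)

lemma mult_1_at: "c i \<cdot> c (i + 1) = s + (1/32) *s (c i + c (i + 1))"
    "c i \<cdot> c (i - 1) = s + (1/32) *s (c i + c (i - 1))"
  using mult_1[of i] mult_1[of "i - 1"] by (simp_all add: mult_commute[of "c (i - 1)"] add.commute)

lemma mult_2_at: "c i \<cdot> c (i + 2) = sg c 2 i + (1/32) *s (c i + c (i + 2))"
  "c i \<cdot> c (i - 2) = sg c 2 i + (1/32) *s (c i + c (i - 2))"
  using mult_c[of i 2] mult_c[of "i - 2" 2] sg_shift[of 2 "i - 2"]
  by (simp_all add: mult_commute[of "c (i - 2)"] add.commute)

text \<open>Four families of vectors that vanish. The first two are the dependency of \<open>proportional\<close> and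
  the recurrence of \<open>relation_0\<close> at position \<open>i\<close>. Eliminating the vectors \<open>s\<close> and \<open>sg c 2 i\<close>
  from them yields relations between axes only: \<open>axis_relation\<close> combines the recurrence with the
  dependencies at \<open>i\<close> and \<open>i + 1\<close>, and \<open>skew_relation\<close> adds two consecutive recurrences.\<close>

abbreviation (input) dependency :: "int \<Rightarrow> 'v" where
  "dependency i \<equiv>
    dep_coeff1 \<xi> \<xi> \<zeta> \<zeta> *s (8 *s s + (1/8) *s (c (i + 1) + c (i - 1)) + (1/4 - 8 * \<xi>) *s c i)
    + dep_coeff2 \<xi> \<xi> *s (8 *s sg c 2 i + (1/8) *s (c (i + 2) + c (i - 2)) + (1/4 - 8 * \<zeta>) *s c i)"

abbreviation (input) step_relation :: "int \<Rightarrow> 'v" where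
  "step_relation i \<equiv>
    c (i - 2) - c (i + 3) + (256 * \<xi> - 6) *s (c (i - 1) - c (i + 2))
        + (32768/7 * \<xi>^2 - 2304/7 * \<xi> + 128/7 * \<zeta> + 33/7) *s (c i - c (i + 1))
    + 32 *s (sg c 2 (i + 1) - sg c 2 i)"

abbreviation (input) axis_relation :: "int \<Rightarrow> 'v" where
  "axis_relation i \<equiv>
    (3/2 * \<xi> - 15/512) *s (c (i - 2) - c (i + 3))
        + (2112/7 * \<xi>^2 - 213/14 * \<xi> - 9/28 * \<zeta> + 711/3584) *s (c (i - 1) - c (i + 2))
        + (12288/7 * \<xi>^3 - 960/7 * \<xi>^2 + 48/7 * \<xi> * \<zeta> + 27/7 * \<xi> - 3/56 * \<zeta> - 9/224)
        *s (c i - c (i + 1))"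

abbreviation (input) skew_relation :: "int \<Rightarrow> 'v" where
  "skew_relation i \<equiv>
    c (i - 3) - c (i + 3) + (- 256 * \<xi> + 5) *s (c (i + 2) - c (i - 2))
        + (- 32768/7 * \<xi>^2 + 512/7 * \<xi> - 128/7 * \<zeta> + 9/7) *s (c (i + 1) - c (i - 1))"

lemma dependency: "dependency i = 0"
proof -
  interpret d: dihedral_axes scale mult "\<lambda>j. c (i + j)" by (rule shift)
  show ?thesis
    using d.proportional[unfolded d.V\<^sub>1_def d.V\<^sub>2_def d.\<gamma>\<^sub>1_def d.\<gamma>\<^sub>2_def shift_params] by simp
qed

lemma step_relation: "step_relation i = 0"
proof -
  interpret d: dihedral_axes scale mult "\<lambda>j. c (i + j)" by (rule shift)
  note rel = d.relation_0[unfolded shift_params rel_inner_def rel_outer_def]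
  have "c (i + 3) + step_relation i = c (i + 3)"
  proof (rule vec_eqI)
    fix f assume "functional f"
    then show "f (c (i + 3) + step_relation i) = f (c (i + 3))"
      using arg_cong[OF rel, of f] by (simp add: functional_simps ring_nf)
  qed
  then show ?thesis by (simp only: add_cancel_left_right)
qed

lemma axis_other_at:
  "c i \<cdot> sg c 2 (i + 1) = cross_product \<xi> \<xi> \<zeta> (c i) (c (i + 1) + c (i - 1)) (c (i + 2) + c (i - 2))
      s (sg c 2 i)"
  using axis_other_e[of i, unfolded parameter_values(1,2)] sg_2[of "i + 1"] sg_2[of i]
  by (cases "even i") simp_all

lemma lam_3_at: "lam (c i) (c (i + 3)) = lam_3_poly \<xi> \<xi> \<zeta> \<zeta>"
proof -
  interpret d: dihedral_axes scale mult "\<lambda>j. c (i + j)" by (rule shift)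
  show ?thesis using d.lam_3(1)[unfolded shift_params] by simp
qed

lemma axis_relation: "axis_relation i = 0"
proof -
  have *: "dep_coeff2 \<xi> \<xi> *s step_relation i + 4 *s dependency i - 4 *s dependency (i + 1) = 0"
    by (simp only: step_relation dependency scale_zero_right add_0 diff_self)
  show ?thesis
    by (rule vec_eq_by[OF *]) (simp add: functional_simps dep_coeff1_def dep_coeff2_def ring_nf)
qed

lemma skew_relation: "skew_relation i = 0"
proof -
  have "sg c 2 (i - 1 + 1) - sg c 2 (i - 1) = - (sg c 2 (i + 1) - sg c 2 i)"
    using sg_shift[of 2 "i - 1"] by (simp add: add.commute)
  moreover have "step_relation i + step_relation (i - 1) = 0"
    by (simp only: step_relation add_0)
  ultimately have *: "step_relation i
     + (c (i - 1 - 2) - c (i - 1 + 3) + (256 * \<xi> - 6) *s (c (i - 1 - 1) - c (i - 1 + 2))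
         + (32768/7 * \<xi>^2 - 2304/7 * \<xi> + 128/7 * \<zeta> + 33/7) *s (c (i - 1) - c (i - 1 + 1))
      + 32 *s - (sg c 2 (i + 1) - sg c 2 i)) = 0"
    by (simp only:)
  show ?thesis
    by (rule vec_eq_by[OF *]) (simp add: functional_simps ring_nf)
qed

lemma const_int:
  fixes g :: "int \<Rightarrow> 'b"
  assumes "\<And>i. g (i + 1) = g i"
  shows "g i = g 0"
proof (induction i rule: int_induct[of _ 0])
  case (step2 i) then show ?case using assms[of "i - 1"] by simp
qed (simp_all add: assms)

end

section \<open>The nine types\<close>

context dihedral_axes
begin

lemmas relations_vanish = axis_relation skew_relation scale_zero_right add_0 diff_self minus_zero

text \<open>In the Laurent polynomials in the shift, \<open>axis_relation\<close> and \<open>skew_relation\<close> become two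
  polynomials with rational coefficients, for the given parameters. The combination in each of
  the following proofs is a Bezout identity for the multiple \<open>T\<^sup>n - 1\<close> of their greatest common
  divisor, \<open>T\<close> being the shift.\<close>

lemma period_2A:
  assumes xi: "\<xi> = 1/8" and zeta: "\<zeta> = 1"
  shows "c (i + 2) = c i"
proof -
  have "(- 29464/1215) *s axis_relation (i + 2) - (110704/1215) *s axis_relation (i + 3)
      - (37264/1215) *s axis_relation (i + 4) - (1384/1215) *s axis_relation (i + 5)
      + (2723/960) *s skew_relation (i + 3) + (61/20) *s skew_relation (i + 4)
      + (173/960) *s skew_relation (i + 5) = 0"
    by (simp only: relations_vanish)
  then show ?thesis by (rule vec_eq_by) (simp add: functional_simps xi zeta ring_nf)
qed

lemma period_1A:
  assumes xi: "\<xi> = 1" and zeta: "\<zeta> = 1"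
  shows "c (i + 2) = c i"
proof -
  have "(296/164845125) *s axis_relation (i - 1) + (2272/6593805) *s axis_relation i
      + (2272/6593805) *s axis_relation (i + 1) + (296/164845125) *s axis_relation (i + 2)
      - (9287/3516696000) *s skew_relation i - (629719/1758348000) *s skew_relation (i + 1)
      - (9287/3516696000) *s skew_relation (i + 2) = 0"
    by (simp only: relations_vanish)
  then show ?thesis by (rule vec_eq_by) (simp add: functional_simps xi zeta ring_nf)
qed

lemma period_2B:
  assumes xi: "\<xi> = 0" and zeta: "\<zeta> = 1"
  shows "c (i + 2) = c i"
proof -
  have "(11656/495) *s axis_relation (i + 2) - (28976/495) *s axis_relation (i + 3)
      + (7984/495) *s axis_relation (i + 4) - (1544/495) *s axis_relation (i + 5)
      - (655/2112) *s skew_relation (i + 3) - (81/220) *s skew_relation (i + 4)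
      - (193/2112) *s skew_relation (i + 5) = 0"
    by (simp only: relations_vanish)
  then show ?thesis by (rule vec_eq_by) (simp add: functional_simps xi zeta ring_nf)
qed

lemma period_3A:
  assumes xi: "\<xi> = 13/256" and zeta: "\<zeta> = 13/256"
  shows "c (i + 3) = c i"
proof -
  have "(- 544/9) *s axis_relation (i + 2) - (736/9) *s axis_relation (i + 3)
      - (32/3) *s axis_relation (i + 4) + (11/6) *s skew_relation (i + 3) + (1/2) *s skew_relation
      (i + 4) = 0"
    by (simp only: relations_vanish)
  then show ?thesis by (rule vec_eq_by) (simp add: functional_simps xi zeta ring_nf)
qed

lemma period_3C:
  assumes xi: "\<xi> = 1/64" and zeta: "\<zeta> = 1/64"
  shows "c (i + 3) = c i"
proof -
  have "(- 4096/63) *s axis_relation (i + 2) - (2560/63) *s axis_relation (i + 3)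
      + (1024/21) *s axis_relation (i + 4) - (29/21) *s skew_relation (i + 3)
      + (2/7) *s skew_relation (i + 4) = 0"
    by (simp only: relations_vanish)
  then show ?thesis by (rule vec_eq_by) (simp add: functional_simps xi zeta ring_nf)
qed

lemma period_4A:
  assumes xi: "\<xi> = 1/32" and zeta: "\<zeta> = 0"
  shows "c (i + 4) = c i"
proof -
  have "(- 1024/9) *s axis_relation (i + 2) - (512/9) *s axis_relation (i + 3)
      + skew_relation (i + 3) = 0"
    by (simp only: relations_vanish)
  then show ?thesis by (rule vec_eq_by) (simp add: functional_simps xi zeta ring_nf)
qed

lemma period_4B:
  assumes xi: "\<xi> = 1/64" and zeta: "\<zeta> = 1/8"
  shows "c (i + 4) = c i"
proof -
  have "(1024/9) *s axis_relation (i + 2) - (512/9) *s axis_relation (i + 3)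
      - (1/3) *s skew_relation (i + 3) = 0"
    by (simp only: relations_vanish)
  then show ?thesis by (rule vec_eq_by) (simp add: functional_simps xi zeta ring_nf)
qed

lemma period_5A:
  assumes xi: "\<xi> = 3/128" and zeta: "\<zeta> = 3/128"
  shows "c (i + 5) = c i"
proof -
  have "(- 512/3) *s axis_relation (i + 2) = 0"
    by (simp only: relations_vanish)
  then show ?thesis by (rule vec_eq_by) (simp add: functional_simps xi zeta ring_nf)
qed

lemma period_6A:
  assumes xi: "\<xi> = 5/256" and zeta: "\<zeta> = 13/256"
  shows "c (i + 6) = c i"
proof -
  have "- skew_relation (i + 3) = 0"
    by (simp only: relations_vanish)
  then show ?thesis by (rule vec_eq_by) (simp add: functional_simps xi zeta ring_nf)
qed

text \<open>The second coefficient vanishes exactly at the parameter of type 6A. In the other types the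
  dependency expresses \<open>sg c 2 i\<close> by \<open>s\<close> and axes; where the period alone determines \<open>sg c 2 i\<close>,
  it may express \<open>s\<close> by axes instead.\<close>

lemma numeric_proportional:
  "dep_coeff1 \<xi> \<xi> \<zeta> \<zeta> = 640/7 * \<xi>^2 - 52/7 * \<xi> - 9/14 * \<zeta> + 1/7" "dep_coeff2 \<xi> \<xi> = \<xi> - 5/256"
  by (simp_all add: dep_coeff1_def dep_coeff2_def ring_nf)

lemma product_s: "s \<cdot> c i = c i \<cdot> s" by (rule mult_commute)

text \<open>For each period two rewrite systems, one normalizing indices \<open>i + k\<close> to small \<open>k\<close> and one
  normalizing numerals.\<close>

lemma wrap_2:
  fixes h :: "int \<Rightarrow> 'b"
  assumes period: "\<And>i. h (i + 2) = h i"
  shows "h (i - 2) = h i" "h (i - 1) = h (i + 1)" "h (i + 2) = h i"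
  using period[of "i - 2"] period[of "i - 1"] period[of "i"] by (simp_all add: add.commute)

lemma residues_2:
  fixes h :: "int \<Rightarrow> 'b"
  assumes period: "\<And>i. h (i + 2) = h i"
  shows "h (- 4) = h 0" "h (- 3) = h 1" "h (- 2) = h 0" "h (- 1) = h 1" "h 2 = h 0" "h 3 = h 1"
      "h 4 = h 0" "h 5 = h 1" "h 6 = h 0"
  using period[of "-1"] period[of "-2"] period[of "-3"] period[of "-4"] period[of "0"]
      period[of "1"] period[of "2"] period[of "3"] period[of "4"] by simp_all

lemma wrap_3:
  fixes h :: "int \<Rightarrow> 'b"
  assumes period: "\<And>i. h (i + 3) = h i"
  shows "h (i - 3) = h i" "h (i - 2) = h (i + 1)" "h (i + 2) = h (i - 1)" "h (i + 3) = h i"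
  using period[of "i - 3"] period[of "i - 2"] period[of "i - 1"] period[of "i"]
      by (simp_all add: add.commute)

lemma residues_3:
  fixes h :: "int \<Rightarrow> 'b"
  assumes period: "\<And>i. h (i + 3) = h i"
  shows "h (- 4) = h 2" "h (- 3) = h 0" "h (- 2) = h 1" "h (- 1) = h 2" "h 3 = h 0" "h 4 = h 1"
      "h 5 = h 2" "h 6 = h 0" "h 7 = h 1" "h 8 = h 2"
  using period[of "-1"] period[of "-2"] period[of "-3"] period[of "-4"] period[of "0"]
      period[of "1"] period[of "2"] period[of "3"] period[of "4"] period[of "5"] by simp_all

lemma wrap_4:
  fixes h :: "int \<Rightarrow> 'b"
  assumes period: "\<And>i. h (i + 4) = h i"
  shows "h (i - 4) = h i" "h (i - 3) = h (i + 1)" "h (i - 2) = h (i + 2)" "h (i + 3) = h (i - 1)"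
      "h (i + 4) = h i"
  using period[of "i - 4"] period[of "i - 3"] period[of "i - 2"] period[of "i - 1"] period[of "i"]
      by (simp_all add: add.commute)

lemma residues_4:
  fixes h :: "int \<Rightarrow> 'b"
  assumes period: "\<And>i. h (i + 4) = h i"
  shows "h (- 4) = h 0" "h (- 3) = h 1" "h (- 2) = h 2" "h (- 1) = h 3" "h 4 = h 0" "h 5 = h 1"
      "h 6 = h 2" "h 7 = h 3" "h 8 = h 0" "h 9 = h 1" "h 10 = h 2"
  using period[of "-1"] period[of "-2"] period[of "-3"] period[of "-4"] period[of "0"]
      period[of "1"] period[of "2"] period[of "3"] period[of "4"] period[of "5"] period[of "6"]
      by simp_all

text \<open>The idempotent \<open>a\<^sub>\<rho>\<close>. The lemma is used again in types 4B and 6A, where \<open>c 0\<close> and \<open>c 2\<close>,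
  respectively \<open>c 0\<close> and \<open>c 3\<close>, belong to a sequence with these parameters.\<close>

lemma idempotent_2A:
  assumes xi: "\<xi> = 1/8" and zeta: "\<zeta> = 1"
  shows "((3/4) *s (c 0 + c 1) - 8 *s s) \<cdot> ((3/4) *s (c 0 + c 1) - 8 *s s) = (3/4) *s (c 0 + c 1)
      - 8 *s s"
proof -
  have p: "c 2 = c 0" "c (- 1) = c 1" "c (- 2) = c 0" "c 3 = c 1"
    using period_2A[OF xi zeta, of 0] period_2A[OF xi zeta, of "-1"] period_2A[OF xi zeta, of "-2"]
        period_2A[OF xi zeta, of 1] by simp_all
  have e: "e = (15/16) *s c 0"
    by (rule vec_eqI) (simp add: sg_def p functional_simps ring_nf)
  have e': "e' = (15/16) *s c 1"
    by (rule vec_eqI) (simp add: sg_def p functional_simps ring_nf)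
  note ss = s_s[unfolded parameter_values(1,2) xi zeta p e e' sg_square_def]
  note m = axis_s_at[of 0] axis_s_at[of 1] mult_1_at[of 0]
  show ?thesis
    by (rule vec_eqI)
      (simp add: mult_linear product_s ss m[simplified] mult_commute[of "c 1" "c 0"] p xi
          functional_simps ring_nf)
qed

text \<open>This proof sets the pattern for the types that follow. The additional basis vector is a
  combination \<open>g i\<close> of \<open>s\<close> and axes that does not depend on \<open>i\<close>; the choice is forced by the
  required product \<open>c 0 \<cdot> c 1\<close>. Its products with axes come from \<open>axis_s_at\<close>, its square from
  \<open>s_s\<close>. Applying the functionals \<open>lam (c i)\<close> to a linear relation gives one equation less than
  there are unknowns; the missing one is the value of \<open>lam (c 0)\<close> on the product of the relation
  with \<open>c 1\<close>.\<close>

lemma type_2A: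
  assumes xi: "\<xi> = 1/8" and zeta: "\<zeta> = 1" and gen: "subalgebra hull {c 0, c 1} = UNIV"
  shows "isomorphic_to_ns NS2A"
proof -
  note period = period_2A[OF xi zeta]
  note wrap = wrap_2[of c, OF period]
  note residues = residues_2[of c, OF period]
  define g where "g = (\<lambda>i. (3/4) *s (c i + c (i + 1)) - 8 *s s)"
  define r where "r = g 0"
  have "g (i + 1) = g i" for i
    unfolding g_def by (rule vec_eqI) (simp add: wrap functional_simps ring_nf)
  from const_int[of g, OF this, symmetric] have "r = g i" for i unfolding r_def .
  note u_at = this[unfolded g_def]
  have r_0: "r = (3/4) *s (c 0 + c 1) - 8 *s s" using u_at[of 0] by (simp add: residues add_ac)
  have e_eq: "sg c 2 i = (15/16) *s c i" for i
    by (rule vec_eqI) (simp add: sg_def wrap functional_simps ring_nf)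
  have plus_1: "c i \<cdot> c (i + 1) = (1/8) *s (c i + c (i + 1)) - (1/8) *s r" for i
    by (rule vec_eqI, simp only: mult_1_at mult_2_at wrap u_at[of i] functional_simps,
        simp add: ring_nf)
  have minus_1: "c i \<cdot> c (i - 1) = (1/8) *s (c i + c (i + 1)) - (1/8) *s r" for i
    by (rule vec_eqI, simp only: mult_1_at mult_2_at wrap u_at[of i] functional_simps,
        simp add: ring_nf)
  have mult_aux: "c i \<cdot> r = (1/8) *s c i + (1/8) *s r - (1/8) *s c (i + 1)" for i
    by (rule vec_eqI, simp only: u_at[of i] mult_linear mult_1_at mult_2_at e_eq axis_s_at idem_c
        wrap xi functional_simps, simp add: ring_nf)
  have lam_aux: "lam (c i) r = 1/8" for i
    by (simp only: u_at[of i] lam_simps lam_0 lam_1 lam_2 lam_s wrap xi zeta) (simp add: ring_nf)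
  have aux_square: "r \<cdot> r = r"
    using idempotent_2A[OF xi zeta] unfolding r_0 by (simp add: scale_right_distrib algebra_simps)
  note near = lam_1[of 0] lam_1[of 1]
  note lam_axes = lam_0 near[simplified, simplified residues xi zeta]
  note from_1 = plus_1[of 1] minus_1[of 1] mult_aux[of 1]
  note times_1 = from_1[simplified, simplified residues]
  define a where "a = (\<lambda>y. if y = A_rho then r else 0)"
  show ?thesis
  proof (induct rule: isomorphic_to_ns_table[where a = a and c = c])
    case periodic show ?case using period by simp
  next
    case zero then show ?case by (auto simp: a_def)
  next
    case (axis_axis f i k)
    note f = axis_axis(1)
    have "k = 0 \<or> k = 1" using axis_axis(2,3) by auto
    then show ?case by (elim disjE; simp add: ns_axis_axis_def a_def plus_1 minus_1
        functional_simps[OF f] wrap; simp add: ring_nf)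
  next
    case (axis_aux f i y)
    note f = axis_aux(1)
    show ?case using axis_aux by (auto simp: a_def mult_aux functional_simps[OF f] wrap;
        simp add: ring_nf)
  next
    case (aux_aux f y y')
    note f = aux_aux(1)
    show ?case using aux_aux by (auto simp: a_def ns_aux_aux_def aux_square functional_simps[OF f]
        ring_nf)
  next
    case (independent k)
    define rel where "rel = k (Ax 0) *s c 0 + k (Ax 1) *s c 1 + k (Aux A_rho) *s r"
    have set: "{0..<2::int} = {0, 1}" by auto
    have rel: "rel = 0" using independent unfolding rel_def by (simp add: set a_def add.assoc)
    have eq0: "8 * k (Ax 0) + k (Ax 1) + k (Aux A_rho) = 8 * lam (c 0) rel"
      by (simp add: rel_def mult_linear lam_simps lam_axes lam_aux ring_nf)
    have eq1: "k (Ax 0) + 8 * k (Ax 1) + k (Aux A_rho) = 8 * lam (c 1) rel"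
      by (simp add: rel_def mult_linear lam_simps lam_axes lam_aux ring_nf)
    have eq2: "4 * k (Ax 0) + 4 * k (Ax 1) - 3 * k (Aux A_rho) = 32 * lam (c 0) (c 1 \<cdot> rel)"
      by (simp add: rel_def mult_linear lam_simps lam_axes lam_aux times_1 ring_nf)
    have "k (Ax 0) = 0" "k (Ax 1) = 0" "k (Aux A_rho) = 0"
      using eq0 eq1 eq2 unfolding rel mult_zero_right lam_simps(3) by algebra+
    then show ?case by (simp add: ns_basis_def set)
  next
    case generated show ?case by (rule gen)
  qed
qed

text \<open>There is no additional basis vector: here, as in types 3C and 1A, the dependency expresses \<open>s\<close>
  by axes.\<close>

lemma type_2B:
  assumes xi: "\<xi> = 0" and zeta: "\<zeta> = 1" and gen: "subalgebra hull {c 0, c 1} = UNIV"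
  shows "isomorphic_to_ns NS2B"
proof -
  note period = period_2B[OF xi zeta]
  note wrap = wrap_2[of c, OF period]
  note residues = residues_2[of c, OF period]
  have e_eq: "sg c 2 i = (15/16) *s c i" for i
    by (rule vec_eqI) (simp add: sg_def wrap functional_simps ring_nf)
  have s_eq: "s = (- 1/32) *s (c i + c (i + 1))" for i
  proof -
    have *: "(- 1/4) *s dependency i = 0"
      by (simp only: dependency scale_zero_right)
    show ?thesis
      by (rule vec_eq_by[OF *[unfolded numeric_proportional, unfolded xi zeta e_eq]],
          simp only: wrap functional_simps, simp add: ring_nf)
  qed
  have plus_1: "c i \<cdot> c (i + 1) = 0" for i
    by (rule vec_eqI, simp only: mult_1_at mult_2_at wrap s_eq[of i] functional_simps,
        simp add: ring_nf)
  have minus_1: "c i \<cdot> c (i - 1) = 0" for i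
    by (rule vec_eqI, simp only: mult_1_at mult_2_at wrap s_eq[of i] functional_simps,
        simp add: ring_nf)
  note near = lam_1[of 0] lam_1[of 1]
  note lam_axes = lam_0 near[simplified, simplified residues xi zeta]
  note lam_aux = lam_0
  note from_1 = plus_1[of 1] minus_1[of 1]
  note times_1 = from_1[simplified, simplified residues]
  define a where "a = (\<lambda>y::ns_aux. 0 :: 'v)"
  show ?thesis
  proof (induct rule: isomorphic_to_ns_table[where a = a and c = c])
    case periodic show ?case using period by simp
  next
    case zero then show ?case by (auto simp: a_def)
  next
    case (axis_axis f i k)
    note f = axis_axis(1)
    have "k = 0 \<or> k = 1" using axis_axis(2,3) by auto
    then show ?case by (elim disjE; simp add: ns_axis_axis_def a_def plus_1 minus_1
        functional_simps[OF f] wrap; simp add: ring_nf)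
  next
    case (axis_aux f i y)
    note f = axis_aux(1)
    show ?case using axis_aux by (auto simp: a_def functional_simps[OF f] wrap; simp add: ring_nf)
  next
    case (aux_aux f y y')
    note f = aux_aux(1)
    show ?case using aux_aux by (auto simp: a_def ns_aux_aux_def functional_simps[OF f] ring_nf)
  next
    case (independent k)
    define rel where "rel = k (Ax 0) *s c 0 + k (Ax 1) *s c 1"
    have set: "{0..<2::int} = {0, 1}" by auto
    have rel: "rel = 0" using independent unfolding rel_def by (simp add: set a_def add.assoc)
    have eq0: "k (Ax 0) = lam (c 0) rel"
      by (simp add: rel_def mult_linear lam_simps lam_axes lam_aux ring_nf)
    have eq1: "k (Ax 1) = lam (c 1) rel"
      by (simp add: rel_def mult_linear lam_simps lam_axes lam_aux ring_nf)
    have "k (Ax 0) = 0" "k (Ax 1) = 0"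
      using eq0 eq1 unfolding rel mult_zero_right lam_simps(3) by simp_all
    then show ?case by (simp add: ns_basis_def set)
  next
    case generated show ?case by (rule gen)
  qed
qed

text \<open>Stated apart from the isomorphism because the even members of a sequence of type 6A have these
  parameters too.\<close>

lemma products_3A:
  assumes xi: "\<xi> = 13/256" and zeta: "\<zeta> = 13/256"
    and u_def: "u = (64/135) *s (c 0 + c 1 + c 2) - (2048/135) *s s"
  shows "u = (64/135) *s (c (i - 1) + c i + c (i + 1)) - (2048/135) *s s"
    and "c i \<cdot> c (i + 1) = (1/16) *s (c i + c (i + 1)) + (1/32) *s c (i - 1) - (135/2048) *s u"
        and "c i \<cdot> c (i - 1) = (1/16) *s (c (i - 1) + c i) + (1/32) *s c (i + 1) - (135/2048) *s u"
    and "c i \<cdot> u = (2/9) *s c i + (5/32) *s u - (1/9) *s (c (i - 1) + c (i + 1))"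
    and "u \<cdot> u = u"
proof -
  note period = period_3A[OF xi zeta]
  note wrap = wrap_3[of c, OF period]
  note residues = residues_3[of c, OF period]
  define g where "g = (\<lambda>i. (64/135) *s (c (i - 1) + c i + c (i + 1)) - (2048/135) *s s)"
  have "g (i + 1) = g i" for i
    unfolding g_def by (rule vec_eqI) (simp add: wrap functional_simps ring_nf)
  from const_int[of g, OF this, symmetric] have "g 0 = g i" for i .
  then have "u = g i" for i by (simp add: u_def g_def residues add_ac)
  note u_at = this[unfolded g_def]
  note u_0 = u_def
  have e_eq: "sg c 2 i = s" for i
    using sg_1[of "i - 1"] sg_neg[of 1 i] by (simp add: sg_def wrap)
  have plus_1: "c i \<cdot> c (i + 1) = (1/16) *s (c i + c (i + 1)) + (1/32) *s c (i - 1)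
      - (135/2048) *s u" for i
    by (rule vec_eqI, simp only: mult_1_at mult_2_at wrap u_at[of i] functional_simps,
        simp add: ring_nf)
  have minus_1: "c i \<cdot> c (i - 1) = (1/16) *s (c (i - 1) + c i) + (1/32) *s c (i + 1)
      - (135/2048) *s u" for i
    by (rule vec_eqI, simp only: mult_1_at mult_2_at wrap u_at[of i] functional_simps,
        simp add: ring_nf)
  have mult_aux: "c i \<cdot> u = (2/9) *s c i + (5/32) *s u - (1/9) *s (c (i - 1) + c (i + 1))" for i
    by (rule vec_eqI, simp only: u_at[of i] mult_linear mult_1_at mult_2_at e_eq axis_s_at idem_c
        wrap xi functional_simps, simp add: ring_nf)
  have aux_square: "u \<cdot> u = u"
  proof (rule vec_eqI)
    fix f assume f: "functional f"
    have fu: "f u = f ((64/135) *s (c 0 + c 1 + c 2) - (2048/135) *s s)" by (simp only: u_0)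
    have "f (u \<cdot> u) = f (((64/135) *s (c 0 + c 1 + c 2) - (2048/135) *s s) \<cdot> u)" by (simp only: u_0)
    also have "\<dots> = f u"
    proof -
      have su: "s \<cdot> u = s \<cdot> ((64/135) *s (c 0 + c 1 + c 2) - (2048/135) *s s)" by (simp only: u_0)
      note ss = s_s[unfolded parameter_values(1,2) xi zeta sg_square_def]
      note prods = mult_aux[of 0] mult_aux[of 1] mult_aux[of 2] axis_s_at[of 0] axis_s_at[of 1]
          axis_s_at[of 2]
      show ?thesis unfolding mult_linear
        by (simp add: su mult_linear ss e_eq product_s prods[simplified, simplified residues] fu
            functional_simps[OF f] residues xi ring_nf)
    qed
    finally show "f (u \<cdot> u) = f u" .
  qed
  show "u = (64/135) *s (c (i - 1) + c i + c (i + 1)) - (2048/135) *s s"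
    "c i \<cdot> c (i + 1) = (1/16) *s (c i + c (i + 1)) + (1/32) *s c (i - 1) - (135/2048) *s u"
        "c i \<cdot> c (i - 1) = (1/16) *s (c (i - 1) + c i) + (1/32) *s c (i + 1) - (135/2048) *s u"
    "c i \<cdot> u = (2/9) *s c i + (5/32) *s u - (1/9) *s (c (i - 1) + c (i + 1))"
    "u \<cdot> u = u"
    by (rule u_at plus_1 minus_1 mult_aux aux_square)+
qed

lemma type_3A:
  assumes xi: "\<xi> = 13/256" and zeta: "\<zeta> = 13/256" and gen: "subalgebra hull {c 0, c 1} = UNIV"
  shows "isomorphic_to_ns NS3A"
proof -
  note period = period_3A[OF xi zeta]
  note wrap = wrap_3[of c, OF period]
  note residues = residues_3[of c, OF period]
  define u where "u = (64/135) *s (c 0 + c 1 + c 2) - (2048/135) *s s"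
  note u_at = products_3A(1)[OF xi zeta u_def]
  note plus_1 = products_3A(2)[OF xi zeta u_def] and minus_1 = products_3A(3)[OF xi zeta u_def]
  note mult_aux = products_3A(4)[OF xi zeta u_def] and aux_square = products_3A(5)[OF xi zeta u_def]
  have lam_aux: "lam (c i) u = 1/4" for i
    by (simp only: u_at[of i] lam_simps lam_0 lam_1 lam_2 lam_s wrap xi zeta) (simp add: ring_nf)
  note near = lam_1[of 0] lam_1[of 1] lam_1[of 2]
  note lam_axes = lam_0 near[simplified, simplified residues xi zeta]
  note from_1 = plus_1[of 1] minus_1[of 1] mult_aux[of 1]
  note times_1 = from_1[simplified, simplified residues]
  define a where "a = (\<lambda>y. if y = U_rho then u else 0)"
  show ?thesis
  proof (induct rule: isomorphic_to_ns_table[where a = a and c = c])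
    case periodic show ?case using period by simp
  next
    case zero then show ?case by (auto simp: a_def)
  next
    case (axis_axis f i k)
    note f = axis_axis(1)
    have "k = 0 \<or> k = 1" using axis_axis(2,3) by auto
    then show ?case by (elim disjE; simp add: ns_axis_axis_def a_def plus_1 minus_1
        functional_simps[OF f] wrap; simp add: ring_nf)
  next
    case (axis_aux f i y)
    note f = axis_aux(1)
    show ?case using axis_aux by (auto simp: a_def mult_aux functional_simps[OF f] wrap;
        simp add: ring_nf)
  next
    case (aux_aux f y y')
    note f = aux_aux(1)
    show ?case using aux_aux by (auto simp: a_def ns_aux_aux_def aux_square functional_simps[OF f]
        ring_nf)
  next
    case (independent k)
    define rel where "rel = k (Ax 0) *s c 0 + k (Ax 1) *s c 1 + k (Ax 2) *s c 2
        + k (Aux U_rho) *s u"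
    have set: "{0..<3::int} = {0, 1, 2}" by auto
    have rel: "rel = 0" using independent unfolding rel_def by (simp add: set a_def add.assoc)
    have eq0: "256 * k (Ax 0) + 13 * k (Ax 1) + 13 * k (Ax 2) + 64 * k (Aux U_rho)
        = 256 * lam (c 0) rel"
      by (simp add: rel_def mult_linear lam_simps lam_axes lam_aux ring_nf)
    have eq1: "13 * k (Ax 0) + 256 * k (Ax 1) + 13 * k (Ax 2) + 64 * k (Aux U_rho)
        = 256 * lam (c 1) rel"
      by (simp add: rel_def mult_linear lam_simps lam_axes lam_aux ring_nf)
    have eq2: "13 * k (Ax 0) + 13 * k (Ax 1) + 256 * k (Ax 2) + 64 * k (Aux U_rho)
        = 256 * lam (c 2) rel"
      by (simp add: rel_def mult_linear lam_simps lam_axes lam_aux ring_nf)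
    have eq3: "416 * k (Ax 0) + 416 * k (Ax 1) + 173 * k (Ax 2) - 544 * k (Aux U_rho)
        = 8192 * lam (c 0) (c 1 \<cdot> rel)"
      by (simp add: rel_def mult_linear lam_simps lam_axes lam_aux times_1 ring_nf)
    have "k (Ax 0) = 0" "k (Ax 1) = 0" "k (Ax 2) = 0" "k (Aux U_rho) = 0"
      using eq0 eq1 eq2 eq3 unfolding rel mult_zero_right lam_simps(3) by algebra+
    then show ?case by (simp add: ns_basis_def set)
  next
    case generated show ?case by (rule gen)
  qed
qed

lemma type_3C:
  assumes xi: "\<xi> = 1/64" and zeta: "\<zeta> = 1/64" and gen: "subalgebra hull {c 0, c 1} = UNIV"
  shows "isomorphic_to_ns NS3C"
proof -
  note period = period_3C[OF xi zeta]
  note wrap = wrap_3[of c, OF period]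
  note residues = residues_3[of c, OF period]
  have e_eq: "sg c 2 i = s" for i
    using sg_1[of "i - 1"] sg_neg[of 1 i] by (simp add: sg_def wrap)
  have s_eq: "s = (- 1/64) *s (c (i - 1) + c i + c (i + 1))" for i
  proof -
    have *: "(32/9) *s dependency i = 0"
      by (simp only: dependency scale_zero_right)
    show ?thesis
      by (rule vec_eq_by[OF *[unfolded numeric_proportional, unfolded xi zeta e_eq]],
          simp only: wrap functional_simps, simp add: ring_nf)
  qed
  have plus_1: "c i \<cdot> c (i + 1) = (1/64) *s (c i + c (i + 1)) - (1/64) *s c (i - 1)" for i
    by (rule vec_eqI, simp only: mult_1_at mult_2_at wrap s_eq[of i] functional_simps,
        simp add: ring_nf)
  have minus_1: "c i \<cdot> c (i - 1) = (1/64) *s (c (i - 1) + c i) - (1/64) *s c (i + 1)" for i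
    by (rule vec_eqI, simp only: mult_1_at mult_2_at wrap s_eq[of i] functional_simps,
        simp add: ring_nf)
  note near = lam_1[of 0] lam_1[of 1] lam_1[of 2]
  note lam_axes = lam_0 near[simplified, simplified residues xi zeta]
  note lam_aux = lam_0
  note from_1 = plus_1[of 1] minus_1[of 1]
  note times_1 = from_1[simplified, simplified residues]
  define a where "a = (\<lambda>y::ns_aux. 0 :: 'v)"
  show ?thesis
  proof (induct rule: isomorphic_to_ns_table[where a = a and c = c])
    case periodic show ?case using period by simp
  next
    case zero then show ?case by (auto simp: a_def)
  next
    case (axis_axis f i k)
    note f = axis_axis(1)
    have "k = 0 \<or> k = 1" using axis_axis(2,3) by auto
    then show ?case by (elim disjE; simp add: ns_axis_axis_def a_def plus_1 minus_1
        functional_simps[OF f] wrap; simp add: ring_nf)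
  next
    case (axis_aux f i y)
    note f = axis_aux(1)
    show ?case using axis_aux by (auto simp: a_def functional_simps[OF f] wrap; simp add: ring_nf)
  next
    case (aux_aux f y y')
    note f = aux_aux(1)
    show ?case using aux_aux by (auto simp: a_def ns_aux_aux_def functional_simps[OF f] ring_nf)
  next
    case (independent k)
    define rel where "rel = k (Ax 0) *s c 0 + k (Ax 1) *s c 1 + k (Ax 2) *s c 2"
    have set: "{0..<3::int} = {0, 1, 2}" by auto
    have rel: "rel = 0" using independent unfolding rel_def by (simp add: set a_def add.assoc)
    have eq0: "64 * k (Ax 0) + k (Ax 1) + k (Ax 2) = 64 * lam (c 0) rel"
      by (simp add: rel_def mult_linear lam_simps lam_axes lam_aux ring_nf)
    have eq1: "k (Ax 0) + 64 * k (Ax 1) + k (Ax 2) = 64 * lam (c 1) rel"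
      by (simp add: rel_def mult_linear lam_simps lam_axes lam_aux ring_nf)
    have eq2: "k (Ax 0) + k (Ax 1) + 64 * k (Ax 2) = 64 * lam (c 2) rel"
      by (simp add: rel_def mult_linear lam_simps lam_axes lam_aux ring_nf)
    have "k (Ax 0) = 0" "k (Ax 1) = 0" "k (Ax 2) = 0"
      using eq0 eq1 eq2 unfolding rel mult_zero_right lam_simps(3) by algebra+
    then show ?case by (simp add: ns_basis_def set)
  next
    case generated show ?case by (rule gen)
  qed
qed

lemma type_4A:
  assumes xi: "\<xi> = 1/32" and zeta: "\<zeta> = 0" and gen: "subalgebra hull {c 0, c 1} = UNIV"
  shows "isomorphic_to_ns NS4A"
proof -
  note period = period_4A[OF xi zeta]
  note wrap = wrap_4[of c, OF period]
  note residues = residues_4[of c, OF period]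
  define g where "g = (\<lambda>i. (1/3) *s (c (i - 1) + c i + c (i + 1) + c (i + 2)) - (64/3) *s s)"
  define v where "v = g 0"
  have "g (i + 1) = g i" for i
    unfolding g_def by (rule vec_eqI) (simp add: wrap functional_simps ring_nf)
  from const_int[of g, OF this, symmetric] have "v = g i" for i unfolding v_def .
  note u_at = this[unfolded g_def]
  have v_0: "v = (1/3) *s (c 0 + c 1 + c 2 + c 3) - (64/3) *s s" using u_at[of 0]
      by (simp add: residues add_ac)
  have e_eq: "sg c 2 i = (- 1/32) *s (c i + c (i + 2))" for i
  proof -
    have *: "(32/3) *s dependency i = 0"
      by (simp only: dependency scale_zero_right)
    show ?thesis
      by (rule vec_eq_by[OF *[unfolded numeric_proportional, unfolded xi zeta]], simp only: wrap
          functional_simps, simp add: ring_nf)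
  qed
  have plus_1: "c i \<cdot> c (i + 1) = (3/64) *s (c i + c (i + 1)) + (1/64) *s (c (i - 1) + c (i + 2))
      - (3/64) *s v" for i
    by (rule vec_eqI, simp only: mult_1_at mult_2_at e_eq wrap u_at[of i] functional_simps,
        simp add: ring_nf)
  have minus_1: "c i \<cdot> c (i - 1) = (3/64) *s (c (i - 1) + c i) + (1/64) *s (c (i + 1) + c (i + 2))
      - (3/64) *s v" for i
    by (rule vec_eqI, simp only: mult_1_at mult_2_at e_eq wrap u_at[of i] functional_simps,
        simp add: ring_nf)
  have plus_2: "c i \<cdot> c (i + 2) = 0" for i
    by (rule vec_eqI, simp only: mult_1_at mult_2_at e_eq wrap u_at[of i] functional_simps,
        simp add: ring_nf)
  have minus_2: "c i \<cdot> c (i - 2) = 0" for i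
    by (rule vec_eqI, simp only: mult_1_at mult_2_at e_eq wrap u_at[of i] functional_simps,
        simp add: ring_nf)
  have mult_aux: "c i \<cdot> v = (5/16) *s c i + (3/16) *s v - (1/8) *s (c (i - 1) + c (i + 1))
      - (1/16) *s c (i + 2)" for i
    by (rule vec_eqI, simp only: u_at[of i] mult_linear mult_1_at mult_2_at e_eq axis_s_at idem_c
        wrap xi functional_simps, simp add: ring_nf)
  have lam_aux: "lam (c i) v = 3/8" for i
    by (simp only: u_at[of i] lam_simps lam_0 lam_1 lam_2 lam_s wrap xi zeta) (simp add: ring_nf)
  have aux_square: "v \<cdot> v = v"
  proof (rule vec_eqI)
    fix f assume f: "functional f"
    have fu: "f v = f ((1/3) *s (c 0 + c 1 + c 2 + c 3) - (64/3) *s s)" by (simp only: v_0)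
    have "f (v \<cdot> v) = f (((1/3) *s (c 0 + c 1 + c 2 + c 3) - (64/3) *s s) \<cdot> v)" by (simp only: v_0)
    also have "\<dots> = f v"
    proof -
      have su: "s \<cdot> v = s \<cdot> ((1/3) *s (c 0 + c 1 + c 2 + c 3) - (64/3) *s s)" by (simp only: v_0)
      note ss = s_s[unfolded parameter_values(1,2) xi zeta sg_square_def]
      note prods = mult_aux[of 0] mult_aux[of 1] mult_aux[of 2] mult_aux[of 3] axis_s_at[of 0]
          axis_s_at[of 1] axis_s_at[of 2] axis_s_at[of 3]
      show ?thesis unfolding mult_linear
        by (simp add: su mult_linear ss e_eq product_s prods[simplified, simplified residues] fu
            functional_simps[OF f] residues xi ring_nf)
    qed
    finally show "f (v \<cdot> v) = f v" .
  qed
  note near = lam_near[of 0] lam_near[of 1] lam_near[of 2] lam_near[of 3]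
  note lam_axes = lam_0 near[simplified, simplified residues xi zeta]
  note from_1 = plus_1[of 1] minus_1[of 1] plus_2[of 1] minus_2[of 1] mult_aux[of 1]
  note times_1 = from_1[simplified, simplified residues]
  define a where "a = (\<lambda>y. if y = V_rho then v else 0)"
  show ?thesis
  proof (induct rule: isomorphic_to_ns_table[where a = a and c = c])
    case periodic show ?case using period by simp
  next
    case zero then show ?case by (auto simp: a_def)
  next
    case (axis_axis f i k)
    note f = axis_axis(1)
    have "k = 0 \<or> k = 1 \<or> k = 2" using axis_axis(2,3) by auto
    then show ?case by (elim disjE; simp add: ns_axis_axis_def a_def plus_1 minus_1 plus_2 minus_2
        functional_simps[OF f] wrap; simp add: ring_nf)
  next
    case (axis_aux f i y)
    note f = axis_aux(1)
    show ?case using axis_aux by (auto simp: a_def mult_aux functional_simps[OF f] wrap;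
        simp add: ring_nf)
  next
    case (aux_aux f y y')
    note f = aux_aux(1)
    show ?case using aux_aux by (auto simp: a_def ns_aux_aux_def aux_square functional_simps[OF f]
        ring_nf)
  next
    case (independent k)
    define rel where "rel = k (Ax 0) *s c 0 + k (Ax 1) *s c 1 + k (Ax 2) *s c 2 + k (Ax 3) *s c 3
        + k (Aux V_rho) *s v"
    have set: "{0..<4::int} = {0, 1, 2, 3}" by auto
    have rel: "rel = 0" using independent unfolding rel_def by (simp add: set a_def add.assoc)
    have eq0: "32 * k (Ax 0) + k (Ax 1) + k (Ax 3) + 12 * k (Aux V_rho) = 32 * lam (c 0) rel"
      by (simp add: rel_def mult_linear lam_simps lam_axes lam_aux ring_nf)
    have eq1: "k (Ax 0) + 32 * k (Ax 1) + k (Ax 2) + 12 * k (Aux V_rho) = 32 * lam (c 1) rel"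
      by (simp add: rel_def mult_linear lam_simps lam_axes lam_aux ring_nf)
    have eq2: "k (Ax 1) + 32 * k (Ax 2) + k (Ax 3) + 12 * k (Aux V_rho) = 32 * lam (c 2) rel"
      by (simp add: rel_def mult_linear lam_simps lam_axes lam_aux ring_nf)
    have eq3: "k (Ax 0) + k (Ax 2) + 32 * k (Ax 3) + 12 * k (Aux V_rho) = 32 * lam (c 3) rel"
      by (simp add: rel_def mult_linear lam_simps lam_axes lam_aux ring_nf)
    have eq4: "2 * k (Ax 0) + 2 * k (Ax 1) - 3 * k (Aux V_rho) = 64 * lam (c 0) (c 1 \<cdot> rel)"
      by (simp add: rel_def mult_linear lam_simps lam_axes lam_aux times_1 ring_nf)
    have "k (Ax 0) = 0" "k (Ax 1) = 0" "k (Ax 2) = 0" "k (Ax 3) = 0" "k (Aux V_rho) = 0"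
      using eq0 eq1 eq2 eq3 eq4 unfolding rel mult_zero_right lam_simps(3) by algebra+
    then show ?case by (simp add: ns_basis_def set)
  next
    case generated show ?case by (rule gen)
  qed
qed

lemma type_4B:
  assumes xi: "\<xi> = 1/64" and zeta: "\<zeta> = 1/8" and gen: "subalgebra hull {c 0, c 1} = UNIV"
  shows "isomorphic_to_ns NS4B"
proof -
  note period = period_4B[OF xi zeta]
  note wrap = wrap_4[of c, OF period]
  note residues = residues_4[of c, OF period]
  define g where "g = (\<lambda>i. c (i - 1) + c i + c (i + 1) + c (i + 2) + 64 *s s)"
  define r where "r = g 0"
  have "g (i + 1) = g i" for i
    unfolding g_def by (rule vec_eqI) (simp add: wrap functional_simps ring_nf)
  from const_int[of g, OF this, symmetric] have "r = g i" for i unfolding r_def .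
  note u_at = this[unfolded g_def]
  have r_0: "r = c 0 + c 1 + c 2 + c 3 + 64 *s s" using u_at[of 0] by (simp add: residues add_ac)
  have e_eq: "sg c 2 i = (- 1/8) *s (c (i - 1) + c (i + 1)) - (1/32) *s (c i + c (i + 2)) - 8 *s s"
      for i
  proof -
    have *: "(- 32) *s dependency i = 0"
      by (simp only: dependency scale_zero_right)
    show ?thesis
      by (rule vec_eq_by[OF *[unfolded numeric_proportional, unfolded xi zeta]], simp only: wrap
          functional_simps, simp add: ring_nf)
  qed
  have plus_1: "c i \<cdot> c (i + 1) = (1/64) *s (c i + c (i + 1)) + (1/64) *s r
      - (1/64) *s (c (i - 1) + c (i + 2))" for i
    by (rule vec_eqI, simp only: mult_1_at mult_2_at e_eq wrap u_at[of i] functional_simps,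
        simp add: ring_nf)
  have minus_1: "c i \<cdot> c (i - 1) = (1/64) *s (c (i - 1) + c i) + (1/64) *s r
      - (1/64) *s (c (i + 1) + c (i + 2))" for i
    by (rule vec_eqI, simp only: mult_1_at mult_2_at e_eq wrap u_at[of i] functional_simps,
        simp add: ring_nf)
  have plus_2: "c i \<cdot> c (i + 2) = (1/8) *s (c i + c (i + 2)) - (1/8) *s r" for i
    by (rule vec_eqI, simp only: mult_1_at mult_2_at e_eq wrap u_at[of i] functional_simps,
        simp add: ring_nf)
  have minus_2: "c i \<cdot> c (i - 2) = (1/8) *s (c i + c (i + 2)) - (1/8) *s r" for i
    by (rule vec_eqI, simp only: mult_1_at mult_2_at e_eq wrap u_at[of i] functional_simps,
        simp add: ring_nf)
  have mult_aux: "c i \<cdot> r = (1/8) *s c i + (1/8) *s r - (1/8) *s c (i + 2)" for i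
    by (rule vec_eqI, simp only: u_at[of i] mult_linear mult_1_at mult_2_at e_eq axis_s_at idem_c
        wrap xi functional_simps, simp add: ring_nf)
  have lam_aux: "lam (c i) r = 1/8" for i
    by (simp only: u_at[of i] lam_simps lam_0 lam_1 lam_2 lam_s wrap xi zeta) (simp add: ring_nf)
  have aux_square: "r \<cdot> r = r"
  proof -
    interpret d: dihedral_axes scale mult "\<lambda>j. c (2 * j)" using reindex[of 0 2] by simp
    have p: "d.\<xi> = 1/8" "d.\<zeta> = 1" "sg (\<lambda>j. c (2 * j)) 1 0 = sg c 2 0"
      using zeta sg_reindex[of c 0 2 1 0] lam_0[of 0]
          by (simp_all add: d.\<xi>_def d.\<zeta>_def lam_values residues)
    have "r = (3/4) *s (c 0 + c 2) - 8 *s sg c 2 0"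
      by (rule vec_eqI) (simp add: e_eq r_0 functional_simps residues ring_nf)
    then show ?thesis using d.idempotent_2A[OF p(1,2)] unfolding p(3) by simp
  qed
  note near = lam_near[of 0] lam_near[of 1] lam_near[of 2] lam_near[of 3]
  note lam_axes = lam_0 near[simplified, simplified residues xi zeta]
  note from_1 = plus_1[of 1] minus_1[of 1] plus_2[of 1] minus_2[of 1] mult_aux[of 1]
  note times_1 = from_1[simplified, simplified residues]
  define a where "a = (\<lambda>y. if y = A_rho2 then r else 0)"
  show ?thesis
  proof (induct rule: isomorphic_to_ns_table[where a = a and c = c])
    case periodic show ?case using period by simp
  next
    case zero then show ?case by (auto simp: a_def)
  next
    case (axis_axis f i k)
    note f = axis_axis(1)
    have "k = 0 \<or> k = 1 \<or> k = 2" using axis_axis(2,3) by auto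
    then show ?case by (elim disjE; simp add: ns_axis_axis_def a_def plus_1 minus_1 plus_2 minus_2
        functional_simps[OF f] wrap; simp add: ring_nf)
  next
    case (axis_aux f i y)
    note f = axis_aux(1)
    show ?case using axis_aux by (auto simp: a_def mult_aux functional_simps[OF f] wrap;
        simp add: ring_nf)
  next
    case (aux_aux f y y')
    note f = aux_aux(1)
    show ?case using aux_aux by (auto simp: a_def ns_aux_aux_def aux_square functional_simps[OF f]
        ring_nf)
  next
    case (independent k)
    define rel where "rel = k (Ax 0) *s c 0 + k (Ax 1) *s c 1 + k (Ax 2) *s c 2 + k (Ax 3) *s c 3
        + k (Aux A_rho2) *s r"
    have set: "{0..<4::int} = {0, 1, 2, 3}" by auto
    have rel: "rel = 0" using independent unfolding rel_def by (simp add: set a_def add.assoc)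
    have eq0: "64 * k (Ax 0) + k (Ax 1) + 8 * k (Ax 2) + k (Ax 3) + 8 * k (Aux A_rho2)
        = 64 * lam (c 0) rel"
      by (simp add: rel_def mult_linear lam_simps lam_axes lam_aux ring_nf)
    have eq1: "k (Ax 0) + 64 * k (Ax 1) + k (Ax 2) + 8 * k (Ax 3) + 8 * k (Aux A_rho2)
        = 64 * lam (c 1) rel"
      by (simp add: rel_def mult_linear lam_simps lam_axes lam_aux ring_nf)
    have eq2: "8 * k (Ax 0) + k (Ax 1) + 64 * k (Ax 2) + k (Ax 3) + 8 * k (Aux A_rho2)
        = 64 * lam (c 2) rel"
      by (simp add: rel_def mult_linear lam_simps lam_axes lam_aux ring_nf)
    have eq3: "k (Ax 0) + 8 * k (Ax 1) + k (Ax 2) + 64 * k (Ax 3) + 8 * k (Aux A_rho2)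
        = 64 * lam (c 3) rel"
      by (simp add: rel_def mult_linear lam_simps lam_axes lam_aux ring_nf)
    have eq4: "4 * k (Ax 0) + 4 * k (Ax 1) - 3 * k (Ax 2) - 3 * k (Ax 3) + 4 * k (Aux A_rho2)
        = 256 * lam (c 0) (c 1 \<cdot> rel)"
      by (simp add: rel_def mult_linear lam_simps lam_axes lam_aux times_1 ring_nf)
    have "k (Ax 0) = 0" "k (Ax 1) = 0" "k (Ax 2) = 0" "k (Ax 3) = 0" "k (Aux A_rho2) = 0"
      using eq0 eq1 eq2 eq3 eq4 unfolding rel mult_zero_right lam_simps(3) by algebra+
    then show ?case by (simp add: ns_basis_def set)
  next
    case generated show ?case by (rule gen)
  qed
qed

lemma type_5A:
  assumes xi: "\<xi> = 3/128" and zeta: "\<zeta> = 3/128" and gen: "subalgebra hull {c 0, c 1} = UNIV"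
  shows "isomorphic_to_ns NS5A"
proof -
  note period = period_5A[OF xi zeta]
  have wrap0: "c (i - 4) = c (i + 1)" for i using period[of "i - 4"] by (simp add: add.commute)
  have wrap1: "c (i - 3) = c (i + 2)" for i using period[of "i - 3"] by (simp add: add.commute)
  have wrap2: "c (i + 3) = c (i - 2)" for i using period[of "i - 2"] by (simp add: add.commute)
  have wrap3: "c (i + 4) = c (i - 1)" for i using period[of "i - 1"] by (simp add: add.commute)
  note wrap = wrap0 wrap1 wrap2 wrap3
  have residues: "c (- 4) = c 1" "c (- 3) = c 2" "c (- 2) = c 3" "c (- 1) = c 4" "c 5 = c 0"
      "c 6 = c 1" "c 7 = c 2" "c 8 = c 3" "c 9 = c 4" "c 10 = c 0" "c 11 = c 1" "c 12 = c 2"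
    using period[of "-1"] period[of "-2"] period[of "-3"] period[of "-4"] period[of "0"]
        period[of "1"] period[of "2"] period[of "3"] period[of "4"] period[of "5"] period[of "6"]
        period[of "7"] by simp_all
  define g where "g = (\<lambda>i. (1/128) *s (c (i - 2) + c (i - 1) + c i + c (i + 1) + c (i + 2)) + s)"
  define w where "w = g 0"
  have "g (i + 1) = g i" for i
    unfolding g_def by (rule vec_eqI) (simp add: wrap functional_simps ring_nf)
  from const_int[of g, OF this, symmetric] have "w = g i" for i unfolding w_def .
  note u_at = this[unfolded g_def]
  have w_0: "w = (1/128) *s (c 0 + c 1 + c 2 + c 3 + c 4) + s" using u_at[of 0]
      by (simp add: residues add_ac)
  have e_eq: "sg c 2 i = (- 1/64) *s (c (i - 2) + c (i - 1) + c i + c (i + 1) + c (i + 2)) - s"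
      for i
  proof -
    have *: "32 *s dependency i = 0"
      by (simp only: dependency scale_zero_right)
    show ?thesis
      by (rule vec_eq_by[OF *[unfolded numeric_proportional, unfolded xi zeta]], simp only: wrap
          functional_simps, simp add: ring_nf)
  qed
  have plus_1: "c i \<cdot> c (i + 1) = (3/128) *s (c i + c (i + 1)) + w
      - (1/128) *s (c (i - 2) + c (i - 1) + c (i + 2))" for i
    by (rule vec_eqI, simp only: mult_1_at mult_2_at e_eq wrap u_at[of i] functional_simps,
        simp add: ring_nf)
  have minus_1: "c i \<cdot> c (i - 1) = (3/128) *s (c (i - 1) + c i) + w
      - (1/128) *s (c (i - 2) + c (i + 1) + c (i + 2))" for i
    by (rule vec_eqI, simp only: mult_1_at mult_2_at e_eq wrap u_at[of i] functional_simps,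
        simp add: ring_nf)
  have plus_2: "c i \<cdot> c (i + 2) = (3/128) *s (c i + c (i + 2))
      - (1/128) *s (c (i - 2) + c (i - 1) + c (i + 1)) - w" for i
    by (rule vec_eqI, simp only: mult_1_at mult_2_at e_eq wrap u_at[of i] functional_simps,
        simp add: ring_nf)
  have minus_2: "c i \<cdot> c (i - 2) = (3/128) *s (c (i - 2) + c i)
      - (1/128) *s (c (i - 1) + c (i + 1) + c (i + 2)) - w" for i
    by (rule vec_eqI, simp only: mult_1_at mult_2_at e_eq wrap u_at[of i] functional_simps,
        simp add: ring_nf)
  have mult_aux: "c i \<cdot> w = (7/4096) *s (c (i - 1) + c (i + 1)) + (7/32) *s w
      - (7/4096) *s (c (i - 2) + c (i + 2))" for i
    by (rule vec_eqI, simp only: u_at[of i] mult_linear mult_1_at mult_2_at e_eq axis_s_at idem_c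
        wrap xi functional_simps, simp add: ring_nf)
  have lam_aux: "lam (c i) w = 0" for i
    by (simp only: u_at[of i] lam_simps lam_0 lam_1 lam_2 lam_s wrap xi zeta) (simp add: ring_nf)
  have aux_square: "w \<cdot> w = (175/524288) *s (c (- 2) + c (- 1) + c 0 + c 1 + c 2)"
  proof (rule vec_eqI)
    fix f assume f: "functional f"
    have fu: "f w = f ((1/128) *s (c 0 + c 1 + c 2 + c 3 + c 4) + s)" by (simp only: w_0)
    have "f (w \<cdot> w) = f (((1/128) *s (c 0 + c 1 + c 2 + c 3 + c 4) + s) \<cdot> w)" by (simp only: w_0)
    also have "\<dots> = f ((175/524288) *s (c (- 2) + c (- 1) + c 0 + c 1 + c 2))"
    proof -
      have su: "s \<cdot> w = s \<cdot> ((1/128) *s (c 0 + c 1 + c 2 + c 3 + c 4) + s)" by (simp only: w_0)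
      note ss = s_s[unfolded parameter_values(1,2) xi zeta sg_square_def]
      note prods = mult_aux[of 0] mult_aux[of 1] mult_aux[of 2] mult_aux[of 3] mult_aux[of 4]
          axis_s_at[of 0] axis_s_at[of 1] axis_s_at[of 2] axis_s_at[of 3] axis_s_at[of 4]
      show ?thesis unfolding mult_linear
        by (simp add: su mult_linear ss e_eq product_s prods[simplified, simplified residues] fu
            functional_simps[OF f] residues xi ring_nf)
    qed
    finally show "f (w \<cdot> w) = f ((175/524288) *s (c (- 2) + c (- 1) + c 0 + c 1 + c 2))" .
  qed
  note near = lam_near[of 0] lam_near[of 1] lam_near[of 2] lam_near[of 3] lam_near[of 4]
  note lam_axes = lam_0 near[simplified, simplified residues xi zeta]
  note from_1 = plus_1[of 1] minus_1[of 1] plus_2[of 1] minus_2[of 1] mult_aux[of 1]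
  note times_1 = from_1[simplified, simplified residues]
  define a where "a = (\<lambda>y. if y = W_rho then w else 0)"
  show ?thesis
  proof (induct rule: isomorphic_to_ns_table[where a = a and c = c])
    case periodic show ?case using period by simp
  next
    case zero then show ?case by (auto simp: a_def)
  next
    case (axis_axis f i k)
    note f = axis_axis(1)
    have "k = 0 \<or> k = 1 \<or> k = 2" using axis_axis(2,3) by auto
    then show ?case by (elim disjE; simp add: ns_axis_axis_def a_def plus_1 minus_1 plus_2 minus_2
        functional_simps[OF f] wrap; simp add: ring_nf)
  next
    case (axis_aux f i y)
    note f = axis_aux(1)
    show ?case using axis_aux by (auto simp: a_def mult_aux functional_simps[OF f] wrap;
        simp add: ring_nf)
  next
    case (aux_aux f y y')
    note f = aux_aux(1)
    show ?case using aux_aux by (auto simp: a_def ns_aux_aux_def aux_square functional_simps[OF f]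
        ring_nf)
  next
    case (independent k)
    define rel where "rel = k (Ax 0) *s c 0 + k (Ax 1) *s c 1 + k (Ax 2) *s c 2 + k (Ax 3) *s c 3
        + k (Ax 4) *s c 4 + k (Aux W_rho) *s w"
    have set: "{0..<5::int} = {0, 1, 2, 3, 4}" by auto
    have rel: "rel = 0" using independent unfolding rel_def by (simp add: set a_def add.assoc)
    have eq0: "128 * k (Ax 0) + 3 * k (Ax 1) + 3 * k (Ax 2) + 3 * k (Ax 3) + 3 * k (Ax 4)
        = 128 * lam (c 0) rel"
      by (simp add: rel_def mult_linear lam_simps lam_axes lam_aux ring_nf)
    have eq1: "3 * k (Ax 0) + 128 * k (Ax 1) + 3 * k (Ax 2) + 3 * k (Ax 3) + 3 * k (Ax 4)
        = 128 * lam (c 1) rel"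
      by (simp add: rel_def mult_linear lam_simps lam_axes lam_aux ring_nf)
    have eq2: "3 * k (Ax 0) + 3 * k (Ax 1) + 128 * k (Ax 2) + 3 * k (Ax 3) + 3 * k (Ax 4)
        = 128 * lam (c 2) rel"
      by (simp add: rel_def mult_linear lam_simps lam_axes lam_aux ring_nf)
    have eq3: "3 * k (Ax 0) + 3 * k (Ax 1) + 3 * k (Ax 2) + 128 * k (Ax 3) + 3 * k (Ax 4)
        = 128 * lam (c 3) rel"
      by (simp add: rel_def mult_linear lam_simps lam_axes lam_aux ring_nf)
    have eq4: "3 * k (Ax 0) + 3 * k (Ax 1) + 3 * k (Ax 2) + 3 * k (Ax 3) + 128 * k (Ax 4)
        = 128 * lam (c 4) rel"
      by (simp add: rel_def mult_linear lam_simps lam_axes lam_aux ring_nf)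
    have eq5: "12288 * k (Ax 0) + 12288 * k (Ax 1) - 3712 * k (Ax 2) - 3712 * k (Ax 3)
        - 3712 * k (Ax 4) + 875 * k (Aux W_rho) = 524288 * lam (c 0) (c 1 \<cdot> rel)"
      by (simp add: rel_def mult_linear lam_simps lam_axes lam_aux times_1 ring_nf)
    have "k (Ax 0) = 0" "k (Ax 1) = 0" "k (Ax 2) = 0" "k (Ax 3) = 0" "k (Ax 4) = 0"
        "k (Aux W_rho) = 0"
      using eq0 eq1 eq2 eq3 eq4 eq5 unfolding rel mult_zero_right lam_simps(3) by algebra+
    then show ?case by (simp add: ns_basis_def set)
  next
    case generated show ?case by (rule gen)
  qed
qed

text \<open>The dependency gives \<open>c i \<cdot> c (i + 1) = c i\<close>, and at \<open>i + 1\<close>, as the period is 2, that the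
  product is also \<open>c (i + 1)\<close>; so the two axes coincide.\<close>

lemma type_1A:
  assumes xi: "\<xi> = 1" and zeta: "\<zeta> = 1" and gen: "subalgebra hull {c 0, c 1} = UNIV"
  shows "isomorphic_to_ns NS1A"
proof -
  note period = period_1A[OF xi zeta]
  have wrap0: "c (i - 2) = c i" for i using period[of "i - 2"] by (simp add: add.commute)
  have wrap1: "c (i - 1) = c (i + 1)" for i using period[of "i - 1"] by (simp add: add.commute)
  have wrap2: "c (i + 2) = c i" for i using period[of "i"] by (simp add: add.commute)
  note wrap = wrap0 wrap1 wrap2
  have e_eq: "sg c 2 i = (15/16) *s c i" for i
    by (rule vec_eqI) (simp add: sg_def wrap functional_simps ring_nf)
  have s_eq: "s = (31/32) *s c i - (1/32) *s c (i + 1)" for i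
  proof -
    have *: "(1/668) *s dependency i = 0"
      by (simp only: dependency scale_zero_right)
    show ?thesis
      by (rule vec_eq_by[OF *[unfolded numeric_proportional, unfolded xi zeta e_eq]],
          simp only: wrap functional_simps, simp add: ring_nf)
  qed
  have m: "c i \<cdot> c (i + 1) = c i" for i
    by (rule vec_eqI, simp only: mult_1_at s_eq[of i] functional_simps, simp add: ring_nf)
  have c1: "c (i + 1) = c i" for i
    using m[of i] m[of "i + 1"] period[of i] mult_commute[of "c i" "c (i + 1)"]
        by (simp add: add.commute)
  define a where "a = (\<lambda>y::ns_aux. 0 :: 'v)"
  show ?thesis
  proof (induct rule: isomorphic_to_ns_table[where a = a and c = c])
    case periodic show ?case using c1 by simp
  next
    case zero then show ?case by (simp add: a_def)
  next
    case (axis_axis f i k)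
    note f = axis_axis(1)
    have "k = 0" using axis_axis(2,3) by auto
    then show ?case by (simp add: ns_axis_axis_def)
  next
    case (axis_aux f i y)
    note f = axis_aux(1)
    show ?case using axis_aux by simp
  next
    case (aux_aux f y y')
    note f = aux_aux(1)
    show ?case using aux_aux by simp
  next
    case (independent k)
    have "{0..<1::int} = {0}" by auto
    then show ?case using independent axis_nonzero[OF axis_c, of 0] by (simp add: ns_basis_def)
  next
    case generated show ?case by (rule gen)
  qed
qed

text \<open>The vectors \<open>u\<close> and \<open>ar\<close> play the roles of \<open>u\<^sub>\<rho>\<^sub>2\<close> and \<open>a\<^sub>\<rho>\<^sub>3\<close>. The former is the idempotent
  of the sequence \<open>c (2 * j)\<close> of type 3A, the latter that of the sequence \<open>c (3 * j)\<close> of type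
  2A. The dependency gives no information, as both its coefficients are zero; the product of
  axes at distance three comes from \<open>c i \<cdot> sg c 2 (i + 1)\<close> instead.\<close>

lemma type_6A:
  assumes xi: "\<xi> = 5/256" and zeta: "\<zeta> = 13/256" and gen: "subalgebra hull {c 0, c 1} = UNIV"
  shows "isomorphic_to_ns NS6A"
proof -
  note period = period_6A[OF xi zeta]
  have wrap0: "c (i - 4) = c (i + 2)" for i using period[of "i - 4"] by (simp add: add.commute)
  have wrap1: "c (i - 3) = c (i + 3)" for i using period[of "i - 3"] by (simp add: add.commute)
  have wrap2: "c (i + 4) = c (i - 2)" for i using period[of "i - 2"] by (simp add: add.commute)
  note wrap = wrap0 wrap1 wrap2
  have residues: "c (- 4) = c 2" "c (- 3) = c 3" "c (- 2) = c 4" "c (- 1) = c 5" "c 6 = c 0"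
      "c 7 = c 1" "c 8 = c 2" "c 9 = c 3" "c 10 = c 4" "c 11 = c 5" "c 12 = c 0" "c 13 = c 1"
      "c 14 = c 2"
    using period[of "-1"] period[of "-2"] period[of "-3"] period[of "-4"] period[of "0"]
        period[of "1"] period[of "2"] period[of "3"] period[of "4"] period[of "5"] period[of "6"]
        period[of "7"] period[of "8"] by simp_all
  define g where "g = (\<lambda>i. (2048/135) *s ((1/32) *s (c i + c (i + 2) + c (i - 2)) - sg c 2 i))"
  define u where "u = g 0"
  have "g (i + 1) = g i" for i
  proof -
    have *: "- ((64/135) *s step_relation i) = 0"
      by (simp only: step_relation scale_zero_right neg_equal_0_iff_equal)
    have c: "c (i + 1 + 2) = c (i + 3)" "c (i + 1 - 2) = c (i - 1)" by (simp_all add: algebra_simps)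
    show ?thesis
      unfolding g_def by (rule vec_eq_by[OF *[unfolded xi zeta]], simp only: c functional_simps,
          simp add: ring_nf)
  qed
  from const_int[of g, OF this, symmetric] have "u = g i" for i unfolding u_def .
  note u_at = this[unfolded g_def]
  define h where "h = (\<lambda>i. 64 *s s + (c (i - 2) + c (i - 1) + c i + c (i + 1) + c (i + 2)
      + c (i + 3)) - (45/32) *s u)"
  define ar where "ar = h 0"
  have "h (i + 1) = h i" for i
    unfolding h_def by (rule vec_eqI) (simp add: wrap functional_simps ring_nf)
  from const_int[of h, OF this, symmetric] have "ar = h i" for i unfolding ar_def .
  note ar_at = this[unfolded h_def]
  have ar_0: "ar = 64 *s s + (c (- 2) + c (- 1) + c 0 + c 1 + c 2 + c 3) - (45/32) *s u"
      using ar_at[of 0] by simp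
  have e_eq: "sg c 2 i = (1/32) *s (c i + c (i + 2) + c (i - 2)) - (135/2048) *s u" for i
    by (rule vec_eqI) (simp add: u_at[of i] functional_simps)
  have e_next: "sg c 2 (i + 1) = (1/32) *s (c (i + 1) + c (i + 3) + c (i - 1)) - (135/2048) *s u"
      for i
    using e_eq[of "i + 1"] by (simp add: add.commute)
  have mult_u: "c i \<cdot> u = (2/9) *s c i + (5/32) *s u - (1/9) *s (c (i - 2) + c (i + 2))" for i
    by (rule vec_eqI, simp only: u_at[of i] mult_linear mult_2_at axis_e_at idem_c wrap zeta
        functional_simps, simp add: ring_nf)
  have plus_1: "c i \<cdot> c (i + 1) = (1/64) *s (c i + c (i + 1)) + (1/64) *s ar + (45/2048) *s u
      - (1/64) *s (c (i - 2) + c (i - 1) + c (i + 2) + c (i + 3))" for i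
    by (rule vec_eqI, simp only: mult_1_at mult_2_at e_eq wrap ar_at[of i] functional_simps,
        simp add: ring_nf)
  have minus_1: "c i \<cdot> c (i - 1) = (1/64) *s (c (i - 1) + c i) + (1/64) *s ar + (45/2048) *s u
      - (1/64) *s (c (i - 2) + c (i + 1) + c (i + 2) + c (i + 3))" for i
    by (rule vec_eqI, simp only: mult_1_at mult_2_at e_eq wrap ar_at[of i] functional_simps,
        simp add: ring_nf)
  have plus_2: "c i \<cdot> c (i + 2) = (1/16) *s (c i + c (i + 2)) + (1/32) *s c (i - 2)
      - (135/2048) *s u" for i
    by (rule vec_eqI, simp only: mult_1_at mult_2_at e_eq wrap ar_at[of i] functional_simps,
        simp add: ring_nf)
  have minus_2: "c i \<cdot> c (i - 2) = (1/16) *s (c (i - 2) + c i) + (1/32) *s c (i + 2)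
      - (135/2048) *s u" for i
    by (rule vec_eqI, simp only: mult_1_at mult_2_at e_eq wrap ar_at[of i] functional_simps,
        simp add: ring_nf)
  have plus_3: "c i \<cdot> c (i + 3) = (1/8) *s (c i + c (i + 3)) - (1/8) *s ar" for i
  proof -
    have *: "32 *s (c i \<cdot> ((1/32) *s (c (i + 1) + c (i + 3) + c (i - 1)) - (135/2048) *s u)
        - cross_product \<xi> \<xi> \<zeta> (c i) (c (i + 1) + c (i - 1)) (c (i + 2) + c (i - 2)) s (sg c 2 i))
        = 0"
      using axis_other_at[of i] by (simp only: e_next diff_self scale_zero_right)
    show ?thesis
      by (rule vec_eq_by[OF *], simp only: cross_product_def mult_linear mult_1_at mult_u e_eq wrap
          xi zeta ar_at[of i] functional_simps, simp add: ring_nf)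
  qed
  have minus_3: "c i \<cdot> c (i - 3) = (1/8) *s (c i + c (i + 3)) - (1/8) *s ar" for i
    using plus_3[of i] by (simp only: wrap)
  have lam_dist_3: "lam (c i) (c (i + 3)) = 1/8" for i
    by (simp add: lam_3_at lam_3_poly_def xi zeta ring_nf)
  have sg_3_eq: "sg c 3 i = (3/32) *s (c i + c (i + 3)) - (1/8) *s ar" for i
    by (rule vec_eqI, simp only: sg_def plus_3 functional_simps, simp add: ring_nf)
  have mult_ar: "c i \<cdot> ar = (1/8) *s c i + (1/8) *s ar - (1/8) *s c (i + 3)" for i
  proof -
    have ar: "ar = (3/4) *s (c i + c (i + 3)) - 8 *s sg c 3 i"
      by (rule vec_eqI) (simp add: sg_3_eq functional_simps ring_nf)
    show ?thesis
      by (rule vec_eqI, simp only: ar mult_linear plus_3 axis_mult_sg[of i 3] lam_dist_3 wrap idem_c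
          functional_simps,
          simp only: sg_def plus_3 functional_simps, simp add: ring_nf)
  qed
  have ar_square: "ar \<cdot> ar = ar"
  proof -
    interpret d: dihedral_axes scale mult "\<lambda>j. c (3 * j)" using reindex[of 0 3] by simp
    have p: "d.\<xi> = 1/8" "d.\<zeta> = 1" "sg (\<lambda>j. c (3 * j)) 1 0 = sg c 3 0"
      using lam_dist_3[of 0] sg_reindex[of c 0 3 1 0] lam_0[of 0]
          by (simp_all add: d.\<xi>_def d.\<zeta>_def residues)
    have "ar = (3/4) *s (c 0 + c 3) - 8 *s sg c 3 0"
      by (rule vec_eqI) (simp add: sg_3_eq[of 0] functional_simps ring_nf)
    then show ?thesis using d.idempotent_2A[OF p(1,2)] unfolding p(3) by simp
  qed
  have aux_square: "u \<cdot> u = u"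
  proof -
    interpret d: dihedral_axes scale mult "\<lambda>j. c (2 * j)" using reindex[of 0 2] by simp
    have p: "d.\<xi> = 13/256" "d.\<zeta> = 13/256" "sg (\<lambda>j. c (2 * j)) 1 0 = sg c 2 0"
      using zeta sg_reindex[of c 0 2 1 0] lam_2[of 0]
          by (simp_all add: d.\<xi>_def d.\<zeta>_def lam_values residues)
    have "u = (64/135) *s (c (2 * 0) + c (2 * 1) + c (2 * 2)) - (2048/135) *s sg (\<lambda>j. c (2 * j)) 1
        0"
      by (rule vec_eqI, simp only: p(3) u_at[of 0] functional_simps, simp add: residues ring_nf)
    then show ?thesis by (rule d.products_3A(5)[OF p(1,2)])
  qed
  have ar_u: "ar \<cdot> u = 0"
  proof -
    define y where "y = ar + (45/32) *s u"
    have y: "y = 64 *s s + (c (- 2) + c (- 1) + c 0 + c 1 + c 2 + c 3)" by (simp add: y_def ar_0)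
    \<comment> \<open>\<open>ar\<close> and \<open>u\<close> are idempotent, so apart from them \<open>y \<cdot> y\<close> involves only \<open>ar \<cdot> u\<close>;
      the other expansion uses only the known products of \<open>s\<close> and of the axes\<close>
    have "y \<cdot> y = (64 *s s + (c (- 2) + c (- 1) + c 0 + c 1 + c 2 + c 3)) \<cdot> y" by (simp only: y)
    also have "\<dots> = 64 *s (s \<cdot> y) + (c (- 2) \<cdot> y + c (- 1) \<cdot> y + c 0 \<cdot> y + c 1 \<cdot> y + c 2 \<cdot> y
        + c 3 \<cdot> y)" by (simp add: mult_linear)
    also have "s \<cdot> y = s \<cdot> (64 *s s + (c (- 2) + c (- 1) + c 0 + c 1 + c 2 + c 3))"
        by (simp only: y)
    finally have *: "(16/45) *s (y \<cdot> y - (64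
        *s (s \<cdot> (64 *s s + (c (- 2) + c (- 1) + c 0 + c 1 + c 2 + c 3)))
        + (c (- 2) \<cdot> y + c (- 1) \<cdot> y + c 0 \<cdot> y + c 1 \<cdot> y + c 2 \<cdot> y + c 3 \<cdot> y))) = 0" by simp
    note prods = mult_ar[of 0] mult_ar[of 1] mult_ar[of 2] mult_ar[of 3] mult_ar[of 4] mult_ar[of 5]
        mult_u[of 0] mult_u[of 1] mult_u[of 2] mult_u[of 3] mult_u[of 4] mult_u[of 5]
        axis_s_at[of 0] axis_s_at[of 1] axis_s_at[of 2] axis_s_at[of 3] axis_s_at[of 4]
        axis_s_at[of 5]
    note ss = s_s[unfolded parameter_values(1,2) xi zeta sg_square_def]
    show ?thesis
    proof (rule vec_eq_by[OF *])
      fix f assume f: "functional f"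
      have fr: "f ar = f (64 *s s + (c (- 2) + c (- 1) + c 0 + c 1 + c 2 + c 3) - (45/32) *s u)"
          by (simp only: ar_0)
      show "f (ar \<cdot> u) = f 0 + f ((16/45) *s (y \<cdot> y
          - (64 *s (s \<cdot> (64 *s s + (c (- 2) + c (- 1) + c 0 + c 1 + c 2 + c 3)))
          + (c (- 2) \<cdot> y + c (- 1) \<cdot> y + c 0 \<cdot> y + c 1 \<cdot> y + c 2 \<cdot> y + c 3 \<cdot> y))))"
        by (simp add: y_def mult_linear ar_square aux_square mult_commute[of u ar] ss
            e_eq[of 0, simplified] e_eq[of 1, simplified] product_s
            prods[simplified, simplified residues]
            fr functional_simps[OF f] residues xi ring_nf)
    qed
  qed
  have lu: "lam (c i) u = 1/4" for i
    by (simp only: u_at[of i] lam_simps lam_0 lam_2 lam_e zeta) (simp add: ring_nf)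
  have lr: "lam (c i) ar = 1/8" for i
    by (simp only: ar_at[of i] lam_simps lam_0 lam_1 lam_2 lam_dist_3 lam_s lu xi zeta)
        (simp add: ring_nf)
  note lam_aux = lu lr
  have lam_opposite: "lam (c 0) (c 3) = 1/8" "lam (c 1) (c 4) = 1/8" "lam (c 2) (c 5) = 1/8"
      "lam (c 3) (c 0) = 1/8" "lam (c 4) (c 1) = 1/8" "lam (c 5) (c 2) = 1/8"
    using lam_dist_3[of 0] lam_dist_3[of 1] lam_dist_3[of 2] lam_dist_3[of 3] lam_dist_3[of 4]
        lam_dist_3[of 5] by (simp_all add: residues)
  note near = lam_near[of 0] lam_near[of 1] lam_near[of 2] lam_near[of 3] lam_near[of 4]
      lam_near[of 5]
  note lam_axes = lam_0 near[simplified, simplified residues xi zeta] lam_opposite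
  note from_1 = plus_1[of 1] minus_1[of 1] plus_2[of 1] minus_2[of 1] plus_3[of 1] minus_3[of 1]
      mult_u[of 1] mult_ar[of 1]
  note times_1 = from_1[simplified, simplified residues]
  note from_2 = plus_1[of 2] minus_1[of 2] plus_2[of 2] minus_2[of 2] plus_3[of 2] minus_3[of 2]
      mult_u[of 2] mult_ar[of 2]
  note times_2 = from_2[simplified, simplified residues]
  define a where "a = (\<lambda>y. if y = A_rho3 then ar else if y = U_rho2 then u else 0)"
  show ?thesis
  proof (induct rule: isomorphic_to_ns_table[where a = a and c = c])
    case periodic show ?case using period by simp
  next
    case zero then show ?case by (auto simp: a_def)
  next
    case (axis_axis f i k)
    note f = axis_axis(1)
    have "k = 0 \<or> k = 1 \<or> k = 2 \<or> k = 3" using axis_axis(2,3) by auto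
    then show ?case by (elim disjE; simp add: ns_axis_axis_def a_def plus_1 minus_1 plus_2 minus_2
        plus_3 minus_3 functional_simps[OF f] wrap; simp add: ring_nf)
  next
    case (axis_aux f i y)
    note f = axis_aux(1)
    show ?case using axis_aux by (auto simp: a_def mult_u mult_ar functional_simps[OF f] wrap;
        simp add: ring_nf)
  next
    case (aux_aux f y y')
    note f = aux_aux(1)
    show ?case using aux_aux by (auto simp: a_def ns_aux_aux_def aux_square ar_square ar_u
        mult_commute[of u ar] functional_simps[OF f])
  next
    case (independent k)
    define rel where "rel = k (Ax 0) *s c 0 + k (Ax 1) *s c 1 + k (Ax 2) *s c 2 + k (Ax 3) *s c 3
        + k (Ax 4) *s c 4 + k (Ax 5) *s c 5 + k (Aux A_rho3) *s ar + k (Aux U_rho2) *s u"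
    have set: "{0..<6::int} = {0, 1, 2, 3, 4, 5}" by auto
    have rel: "rel = 0" using independent unfolding rel_def by (simp add: set a_def add.assoc)
    have eq0: "256 * k (Ax 0) + 5 * k (Ax 1) + 13 * k (Ax 2) + 32 * k (Ax 3) + 13 * k (Ax 4)
        + 5 * k (Ax 5) + 32 * k (Aux A_rho3) + 64 * k (Aux U_rho2) = 256 * lam (c 0) rel"
      by (simp add: rel_def mult_linear lam_simps lam_axes lam_aux ring_nf)
    have eq1: "5 * k (Ax 0) + 256 * k (Ax 1) + 5 * k (Ax 2) + 13 * k (Ax 3) + 32 * k (Ax 4)
        + 13 * k (Ax 5) + 32 * k (Aux A_rho3) + 64 * k (Aux U_rho2) = 256 * lam (c 1) rel"
      by (simp add: rel_def mult_linear lam_simps lam_axes lam_aux ring_nf)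
    have eq2: "13 * k (Ax 0) + 5 * k (Ax 1) + 256 * k (Ax 2) + 5 * k (Ax 3) + 13 * k (Ax 4)
        + 32 * k (Ax 5) + 32 * k (Aux A_rho3) + 64 * k (Aux U_rho2) = 256 * lam (c 2) rel"
      by (simp add: rel_def mult_linear lam_simps lam_axes lam_aux ring_nf)
    have eq3: "32 * k (Ax 0) + 13 * k (Ax 1) + 5 * k (Ax 2) + 256 * k (Ax 3) + 5 * k (Ax 4)
        + 13 * k (Ax 5) + 32 * k (Aux A_rho3) + 64 * k (Aux U_rho2) = 256 * lam (c 3) rel"
      by (simp add: rel_def mult_linear lam_simps lam_axes lam_aux ring_nf)
    have eq4: "13 * k (Ax 0) + 32 * k (Ax 1) + 13 * k (Ax 2) + 5 * k (Ax 3) + 256 * k (Ax 4)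
        + 5 * k (Ax 5) + 32 * k (Aux A_rho3) + 64 * k (Aux U_rho2) = 256 * lam (c 4) rel"
      by (simp add: rel_def mult_linear lam_simps lam_axes lam_aux ring_nf)
    have eq5: "5 * k (Ax 0) + 13 * k (Ax 1) + 32 * k (Ax 2) + 13 * k (Ax 3) + 5 * k (Ax 4)
        + 256 * k (Ax 5) + 32 * k (Aux A_rho3) + 64 * k (Aux U_rho2) = 256 * lam (c 5) rel"
      by (simp add: rel_def mult_linear lam_simps lam_axes lam_aux ring_nf)
    have eq6: "160 * k (Ax 0) + 160 * k (Ax 1) - 83 * k (Ax 2) - 56 * k (Ax 3) - 56 * k (Ax 4)
        - 83 * k (Ax 5) + 96 * k (Aux A_rho3) + 224 * k (Aux U_rho2) = 8192 * lam (c 0) (c 1 \<cdot> rel)"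
      by (simp add: rel_def mult_linear lam_simps lam_axes lam_aux times_1 ring_nf)
    have eq7: "416 * k (Ax 0) - 83 * k (Ax 1) + 416 * k (Ax 2) - 56 * k (Ax 3) + 173 * k (Ax 4)
        - 56 * k (Ax 5) + 160 * k (Aux A_rho3) - 544 * k (Aux U_rho2)
        = 8192 * lam (c 0) (c 2 \<cdot> rel)"
      by (simp add: rel_def mult_linear lam_simps lam_axes lam_aux times_2 ring_nf)
    have "k (Ax 0) = 0" "k (Ax 1) = 0" "k (Ax 2) = 0" "k (Ax 3) = 0" "k (Ax 4) = 0" "k (Ax 5) = 0"
        "k (Aux A_rho3) = 0" "k (Aux U_rho2) = 0"
      using eq0 eq1 eq2 eq3 eq4 eq5 eq6 eq7 unfolding rel mult_zero_right lam_simps(3) by algebra+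
    then show ?case by (simp add: ns_basis_def set)
  next
    case generated show ?case by (rule gen)
  qed
qed

end

theorem theorem1p5:
  fixes scale :: "'f::field_char_0 \<Rightarrow> 'v::ab_group_add \<Rightarrow> 'v"
    and mult :: "'v \<Rightarrow> 'v \<Rightarrow> 'v"
  assumes "comm_algebra scale mult"
    and "comm_algebra.two_generated_primitive_axial scale mult (1/4) (1/32)"
  shows "\<exists>T. comm_algebra.isomorphic_to_ns scale mult T"
proof -
  interpret comm_algebra scale mult by (rule assms(1))
  interpret char_0_algebra scale mult by unfold_locales
  obtain a b where ab: "axis a" "axis b" and gen: "subalgebra hull {a, b} = UNIV"
    using assms(2) unfolding two_generated_primitive_axial_def by blast
  obtain c where c: "dihedral c" "c 0 = a" "c 1 = b" using dihedral_exists[OF ab] by blast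
  interpret dihedral_axes scale mult c by unfold_locales (rule c(1))
  have gen: "subalgebra hull {c 0, c 1} = UNIV" using gen c by simp
  from parameter_values(3) show ?thesis
    using type_1A[OF _ _ gen] type_2A[OF _ _ gen] type_2B[OF _ _ gen] type_3A[OF _ _ gen]
      type_3C[OF _ _ gen] type_4A[OF _ _ gen] type_4B[OF _ _ gen] type_5A[OF _ _ gen] type_6A[OF _ _ gen]
    by auto
qed

end
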